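(* For each $s\in[0,T]$, let $\Pi_s:H\to\mathbb{R}^n$ be the evaluation map $\Pi_s(\mathbf{x})=\mathbf{x}^s$. Then $\Pi_s$ is continuous. Moreover, let $\alpha\in\mathcal{A}^W$ and let $\mathbf{X}^\alpha$ be the $H$-valued solution of the lifted SDE $$\mathbf{X}_t^\alpha=\mathbf{x}_0+\int_0^t B(r,\mathbf{X}_r^\alpha,\alpha_r)\,dr+\int_0^t\Sigma(r,\mathbf{X}_r^\alpha,\alpha_r)\,dW_r,\quad t\in[0,T],\ \mathbb{P}\text{-a.s.}\qquad(\mathrm{L})$$ Then for every $s\in[0,T]$ the process $X_t^{\alpha,s}:=\Pi_s(\mathbf{X}_t^\alpha)$, $t\in[0,T]$, satisfies $$X_t^{\alpha,s}=\mathbf{x}_0^s+\int_0^t b_r\big(s,X_r^{\alpha,r},X_r^{\alpha,s},\alpha_r\big)dr+\int_0^t\sigma_r\big(s,X_r^{\alpha,r},X_r^{\alpha,s},\alpha_r\big)dW_r.\qquad(\mathrm{P})$$ Conversely, assume that $(X^{\alpha,s})_{s\in[0,T]}$ is an $H$-valued family of processes (that is, $s\mapsto X^{\alpha,s}_t$ defines an $H$-valued process in $t$) such that (P) holds for every $s\in[0,T]$. Then the $H$-valued process $\mathbf{X}^\alpha$ defined by $\mathbf{X}_t^\alpha(\cdot):=X_t^{\alpha,\cdot}$ solves (L). Finally, if there exist coefficients $\bar b,\bar\sigma$ such that $b_r(s,x,y,a)=\bar b_r(s,x,a)$ and $\sigma_r(s,x,y,a)=\bar\sigma_r(s,x,a)$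 for all arguments, and if $\mathbf{X}_0^\alpha=\mathbf{p}(x)$ for some $x\in\mathbb{R}^n$, then the diagonal process $X_t:=X_t^{\alpha,t}$ solves the stochastic Volterra equation $$X_t=x+\int_0^t\bar b_r(t,X_r,\alpha_r)dr+\int_0^t\bar\sigma_r(t,X_r,\alpha_r)dW_r,\quad t\in[0,T].$$
   Context: Fix $T>0$, integers $n,d\ge1$ and a Polish space $A$. Let $H$ be the Hilbert space of $\mathbb{R}^n$-valued functions $\mathbf{x}=(\mathbf{x}_1,\dots,\mathbf{x}_n)$ on $[0,T]$ with each $\mathbf{x}_k$ in the Sobolev space $W^{1,2}([0,T])$, with $\langle\mathbf{x},\mathbf{y}\rangle_H=\sum_{k=1}^n\big(\int_0^T\mathbf{x}_k\mathbf{y}_k\,dt+\int_0^T\mathbf{x}_k'\mathbf{y}_k'\,dt\big)$. Every element of $H$ is identified with its continuous representative, and $\mathbf{x}^s$ (or $\mathbf{x}(s)$) denotes its value at $s\in[0,T]$. For $x\in\mathbb{R}^n$, $\mathbf{p}(x)\in H$ is the constant function equal to $x$. Let $b:[0,T]^2\times\mathbb{R}^n\times\mathbb{R}^n\times A\to\mathbb{R}^n$ and $\sigma:[0,T]^2\times\mathbb{R}^n\times\mathbb{R}^n\times A\to M_{n,d}(\mathbb{R})$, with values written $b_t(s,x,y,a)$ and $\sigma_t(s,x,y,a)$, be continuous in all variables. They are such that $B(t,\mathbf{x},a)(s):=b_t(s,\mathbf{x}^t,\mathbf{x}^s,a)$ and $\Sigma(t,\mathbf{x},a)(s):=\sigma_t(s,\mathbf{x}^t,\mathbf{x}^s,a)$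 define mappings on $[0,T]\times H\times A$ with values in $H$ and in $\mathcal{L}(\mathbb{R}^d,H)$ (bounded linear maps) respectively. $(\Omega,\mathcal{F},\mathbb{P})$ is a probability space with a standard $d$-dimensional Brownian motion $W$ with natural filtration $\mathbb{F}^W$. $\mathbf{x}_0\in H$ is the initial condition. $\mathcal{A}^W$ is the set of $\mathbb{F}^W$-progressively measurable $A$-valued processes $\alpha$ such that the $H$-valued SDE (L) has a unique strong solution.
   Formalization: In the converse it is additionally assumed that the two integrals in (L) exist along the lifted process (drift a.s. Bochner integrable in H, Σ Itô-integrable); (P) for every s does not imply this, and the converse can fail without it. *)

theory Defs
  imports "HOL-Probability.Probability"
begin

section \<open>The Sobolev space of paths\<close>

text \<open>Test functions of class \<open>C\<^sup>1\<close> with compact support in the open interval \<open>(0,T)\<close>,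
  given together with their derivative.\<close>

definition test_function :: "real \<Rightarrow> (real \<Rightarrow> real) \<Rightarrow> (real \<Rightarrow> real) \<Rightarrow> bool" where
  "test_function T \<phi> \<phi>' \<longleftrightarrow>
     (\<forall>s. (\<phi> has_real_derivative \<phi>' s) (at s)) \<and> continuous_on UNIV \<phi>' \<and>
     (\<exists>a b. 0 < a \<and> b < T \<and> (\<forall>s. s \<notin> {a..b} \<longrightarrow> \<phi> s = 0))"

definition weak_derivative :: "real \<Rightarrow> (real \<Rightarrow> real) \<Rightarrow> (real \<Rightarrow> real) \<Rightarrow> bool" where
  "weak_derivative T u g \<longleftrightarrow>
     set_borel_measurable lborel {0..T} g \<and>
     set_integrable lborel {0..T} (\<lambda>s. (g s)\<^sup>2) \<and>
     (\<forall>\<phi> \<phi>'. test_function T \<phi> \<phi>' \<longrightarrow>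
        (LINT s:{0..T}|lborel. u s * \<phi>' s) = - (LINT s:{0..T}|lborel. g s * \<phi> s))"

text \<open>\<open>W\<^sup>1\<^sup>,\<^sup>2([0,T])\<close>, each class being represented by its continuous member
  (which is automatically square integrable on \<open>[0,T]\<close>).\<close>

definition sobolev_W12 :: "real \<Rightarrow> (real \<Rightarrow> real) set" where
  "sobolev_W12 T = {u. continuous_on {0..T} u \<and> (\<exists>g. weak_derivative T u g)}"

text \<open>Weak derivatives are unique up to null sets, so the choice does not affect any integral.\<close>

definition wderiv :: "real \<Rightarrow> (real \<Rightarrow> real) \<Rightarrow> real \<Rightarrow> real" where
  "wderiv T u = (SOME g. weak_derivative T u g)"

text \<open>Functions on \<open>[0,T]\<close> are functions on \<open>\<real>\<close> with the value \<open>undefined\<close> outside \<open>[0,T]\<close>.\<close>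

definition sobolev_H :: "real \<Rightarrow> (real \<Rightarrow> real^'n) set" where
  "sobolev_H T = {x \<in> extensional {0..T}. \<forall>k. (\<lambda>s. x s $ k) \<in> sobolev_W12 T}"

definition H_inner :: "real \<Rightarrow> (real \<Rightarrow> real^'n) \<Rightarrow> (real \<Rightarrow> real^'n) \<Rightarrow> real" where
  "H_inner T x y =
     (\<Sum>k\<in>UNIV. (LINT s:{0..T}|lborel. x s $ k * y s $ k) +
        (LINT s:{0..T}|lborel. wderiv T (\<lambda>s. x s $ k) s * wderiv T (\<lambda>s. y s $ k) s))"

text \<open>Types cannot depend on the real number \<open>T\<close>, so the Hilbert space \<open>H\<close> appears as a type
  \<open>'h\<close> together with a linear isometric bijection \<open>val\<close> of \<open>'h\<close> onto the concrete function space: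
  \<open>val h\<close> is the function (continuous representative) that \<open>h\<close> stands for, and \<open>val h s\<close> its
  value at \<open>s\<close>.  The inner product of \<open>'h\<close> is thus that of \<open>H\<close>, and completeness and
  separability, imposed by the sort, are those of \<open>H\<close>.\<close>

definition represents_H ::
  "real \<Rightarrow> ('h::{real_inner, banach, second_countable_topology} \<Rightarrow> real \<Rightarrow> real^'n) \<Rightarrow> bool" where
  "represents_H T val \<longleftrightarrow>
     bij_betw val UNIV (sobolev_H T) \<and>
     (\<forall>h k. \<forall>s\<in>{0..T}. val (h + k) s = val h s + val k s) \<and>
     (\<forall>c h. \<forall>s\<in>{0..T}. val (c *\<^sub>R h) s = c *\<^sub>R val h s) \<and>
     (\<forall>h k. inner h k = H_inner T (val h) (val k))"

text \<open>The element of \<open>H\<close> given by a function on \<open>[0,T]\<close> that belongs to \<open>sobolev_H T\<close>.\<close>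

definition elem_of ::
  "real \<Rightarrow> ('h \<Rightarrow> real \<Rightarrow> real^'n) \<Rightarrow> (real \<Rightarrow> real^'n) \<Rightarrow> 'h" where
  "elem_of T val x = the_inv val (restrict x {0..T})"

definition const_path :: "real \<Rightarrow> ('h \<Rightarrow> real \<Rightarrow> real^'n) \<Rightarrow> real^'n \<Rightarrow> 'h" where
  "const_path T val x = elem_of T val (\<lambda>s. x)"


section \<open>Brownian motion and progressive measurability\<close>

definition natural_filtration ::
  "'w measure \<Rightarrow> (real \<Rightarrow> 'w \<Rightarrow> 'b::topological_space) \<Rightarrow> real \<Rightarrow> 'w measure" where
  "natural_filtration M W t =
     sigma (space M) {W s -` B \<inter> space M | s B. s \<in> {0..t} \<and> B \<in> sets borel}"

definition brownian_motion :: "'w measure \<Rightarrow> real \<Rightarrow> (real \<Rightarrow> 'w \<Rightarrow> real^'d) \<Rightarrow> bool" where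
  "brownian_motion M T W \<longleftrightarrow>
     (\<forall>t\<in>{0..T}. W t \<in> borel_measurable M) \<and>
     (AE \<omega> in M. W 0 \<omega> = 0) \<and>
     (AE \<omega> in M. continuous_on {0..T} (\<lambda>t. W t \<omega>)) \<and>
     (\<forall>s t. 0 \<le> s \<and> s < t \<and> t \<le> T \<longrightarrow>
        distributed M lborel (\<lambda>\<omega>. W t \<omega> - W s \<omega>)
          (\<lambda>z. ennreal (\<Prod>k\<in>UNIV. normal_density 0 (sqrt (t - s)) (z $ k))) \<and>
        prob_space.indep_set M (sets (natural_filtration M W s))
          {(\<lambda>\<omega>. W t \<omega> - W s \<omega>) -` B \<inter> space M | B. B \<in> sets borel})"

definition progressive ::
  "(real \<Rightarrow> 'w measure) \<Rightarrow> real \<Rightarrow> (real \<Rightarrow> 'w \<Rightarrow> 'b::topological_space) \<Rightarrow> bool" where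
  "progressive F T Y \<longleftrightarrow>
     (\<forall>t\<in>{0..T}. (\<lambda>(r, \<omega>). Y r \<omega>) \<in> (restrict_space borel {0..t} \<Otimes>\<^sub>M F t) \<rightarrow>\<^sub>M borel)"


section \<open>The stochastic integral\<close>

text \<open>Squared Hilbert--Schmidt norm of a linear map on \<open>\<real>\<^sup>d\<close>.\<close>

definition hs_norm_sq :: "((real^'d) \<Rightarrow>\<^sub>L 'b::real_normed_vector) \<Rightarrow> real" where
  "hs_norm_sq \<Phi> = (\<Sum>k\<in>UNIV. (norm (blinfun_apply \<Phi> (axis k 1)))\<^sup>2)"

text \<open>Elementary integrands \<open>\<Sum>i<m. \<xi>\<^sub>i 1\<^bsub>(\<tau>\<^sub>i,\<tau>\<^sub>i\<^sub>+\<^sub>1]\<^esub>\<close> on \<open>[0,t]\<close>, where \<open>\<xi>\<^sub>i\<close> is measurable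
  with respect to the \<open>\<sigma>\<close>-algebra at time \<open>\<tau>\<^sub>i\<close> and takes finitely many operator values.\<close>

definition elementary ::
  "(real \<Rightarrow> 'w measure) \<Rightarrow> real \<Rightarrow> nat \<Rightarrow> (nat \<Rightarrow> real) \<Rightarrow>
     (nat \<Rightarrow> 'w \<Rightarrow> ((real^'d) \<Rightarrow>\<^sub>L 'b::real_normed_vector)) \<Rightarrow> bool" where
  "elementary F t m \<tau> \<xi> \<longleftrightarrow>
     (\<forall>i<m. 0 \<le> \<tau> i \<and> \<tau> i \<le> \<tau> (Suc i) \<and> \<tau> (Suc i) \<le> t \<and> simple_function (F (\<tau> i)) (\<xi> i))"

definition elementary_process ::
  "nat \<Rightarrow> (nat \<Rightarrow> real) \<Rightarrow> (nat \<Rightarrow> 'w \<Rightarrow> ((real^'d) \<Rightarrow>\<^sub>L 'b::real_normed_vector)) \<Rightarrow>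
     real \<Rightarrow> 'w \<Rightarrow> ((real^'d) \<Rightarrow>\<^sub>L 'b)" where
  "elementary_process m \<tau> \<xi> r \<omega> = (\<Sum>i<m. indicator {\<tau> i<..\<tau> (Suc i)} r *\<^sub>R \<xi> i \<omega>)"

definition elementary_integral ::
  "(real \<Rightarrow> 'w \<Rightarrow> real^'d) \<Rightarrow> nat \<Rightarrow> (nat \<Rightarrow> real) \<Rightarrow>
     (nat \<Rightarrow> 'w \<Rightarrow> ((real^'d) \<Rightarrow>\<^sub>L 'b::real_normed_vector)) \<Rightarrow> 'w \<Rightarrow> 'b" where
  "elementary_integral W m \<tau> \<xi> \<omega> =
     (\<Sum>i<m. blinfun_apply (\<xi> i \<omega>) (W (\<tau> (Suc i)) \<omega> - W (\<tau> i) \<omega>))"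

text \<open>\<open>J\<close> is (a version of) the random variable \<open>\<integral>\<^sub>0\<^sup>t \<Phi>\<^sub>r dW\<^sub>r\<close>, for a progressive integrand with
  almost surely square integrable paths: there are elementary \<open>\<Phi>\<^sup>k\<close> such that, in probability,
  \<open>\<integral>\<^sub>0\<^sup>t \<parallel>\<Phi>\<^sup>k\<^sub>r - \<Phi>\<^sub>r\<parallel>\<^sup>2 dr\<close> tends to \<open>0\<close> and the elementary integrals tend to \<open>J\<close>.  By the Ito
  isometry and localisation, such a \<open>J\<close> exists for each of these integrands if \<open>'b\<close> is a Hilbert
  space, and is unique up to null sets.  Progressive measurability is required of every \<open>\<Phi>\<^sub>r z\<close>,
  that is, \<open>\<Phi>\<close> is strongly measurable; since \<open>\<real>\<^sup>d\<close> is finite-dimensional, this makes all events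
  below measurable.\<close>

definition has_ito_integral ::
  "'w measure \<Rightarrow> (real \<Rightarrow> 'w measure) \<Rightarrow> (real \<Rightarrow> 'w \<Rightarrow> real^'d) \<Rightarrow> real \<Rightarrow>
     (real \<Rightarrow> 'w \<Rightarrow> ((real^'d) \<Rightarrow>\<^sub>L 'b::{real_inner, banach, second_countable_topology})) \<Rightarrow>
     ('w \<Rightarrow> 'b) \<Rightarrow> bool" where
  "has_ito_integral M F W t \<Phi> J \<longleftrightarrow>
     (\<forall>z. progressive F t (\<lambda>r \<omega>. blinfun_apply (\<Phi> r \<omega>) z)) \<and>
     (AE \<omega> in M. (\<integral>\<^sup>+r\<in>{0..t}. ennreal (hs_norm_sq (\<Phi> r \<omega>)) \<partial>lborel) < \<infinity>) \<and>
     J \<in> borel_measurable M \<and>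
     (\<exists>m \<tau> \<xi>.
        (\<forall>k. elementary F t (m k) (\<tau> k) (\<xi> k)) \<and>
        (\<forall>\<epsilon>>0. (\<lambda>k. measure M {\<omega> \<in> space M. ennreal \<epsilon> <
             (\<integral>\<^sup>+r\<in>{0..t}. ennreal (hs_norm_sq (elementary_process (m k) (\<tau> k) (\<xi> k) r \<omega> - \<Phi> r \<omega>))
                \<partial>lborel)}) \<longlonglongrightarrow> 0) \<and>
        (\<forall>\<epsilon>>0. (\<lambda>k. measure M {\<omega> \<in> space M. \<epsilon> <
             norm (elementary_integral W (m k) (\<tau> k) (\<xi> k) \<omega> - J \<omega>)}) \<longlonglongrightarrow> 0))"

text \<open>The integral as a process: the almost surely continuous version of
  \<open>t \<mapsto> \<integral>\<^sub>0\<^sup>t \<Phi>\<^sub>r dW\<^sub>r\<close>, unique up to indistinguishability.\<close>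

definition has_ito_process ::
  "'w measure \<Rightarrow> (real \<Rightarrow> 'w measure) \<Rightarrow> (real \<Rightarrow> 'w \<Rightarrow> real^'d) \<Rightarrow> real \<Rightarrow>
     (real \<Rightarrow> 'w \<Rightarrow> ((real^'d) \<Rightarrow>\<^sub>L 'b::{real_inner, banach, second_countable_topology})) \<Rightarrow>
     (real \<Rightarrow> 'w \<Rightarrow> 'b) \<Rightarrow> bool" where
  "has_ito_process M F W T \<Phi> I \<longleftrightarrow>
     (AE \<omega> in M. continuous_on {0..T} (\<lambda>t. I t \<omega>)) \<and>
     (\<forall>t\<in>{0..T}. has_ito_integral M F W t \<Phi> (I t))"

definition ito_integrable ::
  "'w measure \<Rightarrow> (real \<Rightarrow> 'w measure) \<Rightarrow> (real \<Rightarrow> 'w \<Rightarrow> real^'d) \<Rightarrow> real \<Rightarrow>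
     (real \<Rightarrow> 'w \<Rightarrow> ((real^'d) \<Rightarrow>\<^sub>L 'b::{real_inner, banach, second_countable_topology})) \<Rightarrow> bool" where
  "ito_integrable M F W T \<Phi> \<longleftrightarrow> (\<exists>I. has_ito_process M F W T \<Phi> I)"

text \<open>\<open>X\<^sub>t = x\<^sub>0 + \<integral>\<^sub>0\<^sup>t \<beta>\<^sub>r dr + \<integral>\<^sub>0\<^sup>t \<Phi>\<^sub>r dW\<^sub>r\<close>, \<open>t \<in> [0,T]\<close>, almost surely; the first integral is a
  Bochner integral.\<close>

definition ito_equation ::
  "'w measure \<Rightarrow> (real \<Rightarrow> 'w measure) \<Rightarrow> (real \<Rightarrow> 'w \<Rightarrow> real^'d) \<Rightarrow> real \<Rightarrow>
     'b::{real_inner, banach, second_countable_topology} \<Rightarrow> (real \<Rightarrow> 'w \<Rightarrow> 'b) \<Rightarrow>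
     (real \<Rightarrow> 'w \<Rightarrow> ((real^'d) \<Rightarrow>\<^sub>L 'b)) \<Rightarrow> (real \<Rightarrow> 'w \<Rightarrow> 'b) \<Rightarrow> bool" where
  "ito_equation M F W T x\<^sub>0 \<beta> \<Phi> X \<longleftrightarrow>
     progressive F T X \<and>
     (AE \<omega> in M. set_integrable lborel {0..T} (\<lambda>r. \<beta> r \<omega>)) \<and>
     (\<exists>I. has_ito_process M F W T \<Phi> I \<and>
        (AE \<omega> in M. \<forall>t\<in>{0..T}. X t \<omega> = x\<^sub>0 + (LINT r:{0..t}|lborel. \<beta> r \<omega>) + I t \<omega>))"


section \<open>The lifted equation, the pointwise equations and the Volterra equation\<close>

definition mat_blinfun :: "real^'d^'n \<Rightarrow> ((real^'d) \<Rightarrow>\<^sub>L (real^'n))" where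
  "mat_blinfun A = Blinfun (\<lambda>z. A *v z)"

definition lifted_solution ::
  "'w measure \<Rightarrow> (real \<Rightarrow> 'w \<Rightarrow> real^'d) \<Rightarrow> real \<Rightarrow>
     (real \<Rightarrow> 'h::{real_inner, banach, second_countable_topology} \<Rightarrow> 'a \<Rightarrow> 'h) \<Rightarrow>
     (real \<Rightarrow> 'h \<Rightarrow> 'a \<Rightarrow> ((real^'d) \<Rightarrow>\<^sub>L 'h)) \<Rightarrow> 'h \<Rightarrow> (real \<Rightarrow> 'w \<Rightarrow> 'a) \<Rightarrow>
     (real \<Rightarrow> 'w \<Rightarrow> 'h) \<Rightarrow> bool" where
  "lifted_solution M W T B \<Sigma> x\<^sub>0 \<alpha> X \<longleftrightarrow>
     ito_equation M (natural_filtration M W) W T x\<^sub>0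
       (\<lambda>r \<omega>. B r (X r \<omega>) (\<alpha> r \<omega>)) (\<lambda>r \<omega>. \<Sigma> r (X r \<omega>) (\<alpha> r \<omega>)) X"

definition admissible_controls ::
  "'w measure \<Rightarrow> (real \<Rightarrow> 'w \<Rightarrow> real^'d) \<Rightarrow> real \<Rightarrow>
     (real \<Rightarrow> 'h::{real_inner, banach, second_countable_topology} \<Rightarrow> 'a \<Rightarrow> 'h) \<Rightarrow>
     (real \<Rightarrow> 'h \<Rightarrow> 'a \<Rightarrow> ((real^'d) \<Rightarrow>\<^sub>L 'h)) \<Rightarrow> 'h \<Rightarrow>
     (real \<Rightarrow> 'w \<Rightarrow> 'a::polish_space) set" where
  "admissible_controls M W T B \<Sigma> x\<^sub>0 =
     {\<alpha>. progressive (natural_filtration M W) T \<alpha> \<and>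
         (\<exists>X. lifted_solution M W T B \<Sigma> x\<^sub>0 \<alpha> X) \<and>
         (\<forall>X Y. lifted_solution M W T B \<Sigma> x\<^sub>0 \<alpha> X \<and> lifted_solution M W T B \<Sigma> x\<^sub>0 \<alpha> Y \<longrightarrow>
            (AE \<omega> in M. \<forall>t\<in>{0..T}. X t \<omega> = Y t \<omega>))}"

text \<open>Equation for the parameter \<open>s\<close> of a family \<open>Y s t \<omega> = X\<^sub>t\<^sup>s(\<omega>)\<close>; the diagonal \<open>Y r r\<close> enters
  the coefficients.\<close>

definition pointwise_solution ::
  "'w measure \<Rightarrow> (real \<Rightarrow> 'w \<Rightarrow> real^'d) \<Rightarrow> real \<Rightarrow>
     (real \<Rightarrow> real \<Rightarrow> real^'n \<Rightarrow> real^'n \<Rightarrow> 'a \<Rightarrow> real^'n) \<Rightarrow>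
     (real \<Rightarrow> real \<Rightarrow> real^'n \<Rightarrow> real^'n \<Rightarrow> 'a \<Rightarrow> real^'d^'n) \<Rightarrow>
     (real \<Rightarrow> real^'n) \<Rightarrow> (real \<Rightarrow> 'w \<Rightarrow> 'a) \<Rightarrow> (real \<Rightarrow> real \<Rightarrow> 'w \<Rightarrow> real^'n) \<Rightarrow> real \<Rightarrow> bool" where
  "pointwise_solution M W T b \<sigma> \<xi> \<alpha> Y s \<longleftrightarrow>
     ito_equation M (natural_filtration M W) W T (\<xi> s)
       (\<lambda>r \<omega>. b r s (Y r r \<omega>) (Y s r \<omega>) (\<alpha> r \<omega>))
       (\<lambda>r \<omega>. mat_blinfun (\<sigma> r s (Y r r \<omega>) (Y s r \<omega>) (\<alpha> r \<omega>))) (Y s)"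

text \<open>Since the integrands depend on the upper limit \<open>t\<close>, the stochastic integrals for different
  \<open>t\<close> are separate random variables and the equation is required almost surely for each \<open>t\<close>.\<close>

definition volterra_solution ::
  "'w measure \<Rightarrow> (real \<Rightarrow> 'w \<Rightarrow> real^'d) \<Rightarrow> real \<Rightarrow>
     (real \<Rightarrow> real \<Rightarrow> real^'n \<Rightarrow> 'a \<Rightarrow> real^'n) \<Rightarrow>
     (real \<Rightarrow> real \<Rightarrow> real^'n \<Rightarrow> 'a \<Rightarrow> real^'d^'n) \<Rightarrow>
     real^'n \<Rightarrow> (real \<Rightarrow> 'w \<Rightarrow> 'a) \<Rightarrow> (real \<Rightarrow> 'w \<Rightarrow> real^'n) \<Rightarrow> bool" where
  "volterra_solution M W T b \<sigma> x \<alpha> X \<longleftrightarrow>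
     progressive (natural_filtration M W) T X \<and>
     (\<forall>t\<in>{0..T}.
        (AE \<omega> in M. set_integrable lborel {0..t} (\<lambda>r. b r t (X r \<omega>) (\<alpha> r \<omega>))) \<and>
        (\<exists>J. has_ito_integral M (natural_filtration M W) W t
               (\<lambda>r \<omega>. mat_blinfun (\<sigma> r t (X r \<omega>) (\<alpha> r \<omega>))) J \<and>
             (AE \<omega> in M. X t \<omega> =
                x + (LINT r:{0..t}|lborel. b r t (X r \<omega>) (\<alpha> r \<omega>)) + J \<omega>)))"

end

theory Submission
  imports Defs
begin

text \<open>Testing the weak derivative of \<open>u\<close> against a \<open>C\<^sup>1\<close> step function that rises near \<open>s\<close> bounds
  \<open>u s\<close> by the Sobolev norm, so the evaluations \<open>\<Pi>\<^sub>s\<close> are bounded linear maps.  Bounded linear maps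
  commute with Bochner integrals and with the stochastic integral (apply them to the elementary
  approximations), which takes (L) to (P).

  For the converse, \<open>\<Pi>\<^sub>s\<close> of the stochastic integral in \<open>H\<close> and the stochastic integral in (P) are
  integrals of the same integrand, hence equal almost surely; so both sides of (L) have the same
  evaluation at every \<open>s\<close> in a countable dense set of parameters, and by continuity in \<open>s\<close> they
  agree.  Uniqueness of the stochastic integral follows from a Lenglart type bound for elementary
  integrands.  The evaluations separate points, so they generate the Borel sets of the separable
  space \<open>H\<close>; this gives progressive measurability of the \<open>H\<close>-valued process.

  The Volterra equation is (P) on the diagonal: at time \<open>0\<close> equation (P) shows that \<open>x\<^sub>0\<close> is constant.\<close>

section \<open>Point evaluations on the Sobolev space\<close>

text \<open>Three obstacles shape the proof. Each almost sure identity at a fixed parameter or time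
  has its own null set, so uncountably many of them can be merged only through a countable dense set
  and continuity. Stochastic integrals are known only as limits in probability, so they cannot be
  compared through second moments of the limits; a tail bound for stopped elementary sums takes
  their place. Finally, (P) controls evaluations, while the norm of \<open>H\<close> also contains
  derivatives: integrability of the evaluated coefficients does not produce an integral in
  \<open>H\<close>, and the converse takes the existence of the two \<open>H\<close>-valued
  integrals as a hypothesis. These integrals meet (P) only after evaluation, so uniqueness is needed
  just for values in \<open>real^'n\<close> and, by coordinates, for real values.\<close>

text \<open>Second differences of \<open>ramp\<close> are \<open>C\<^sup>1\<close> steps, with tents as derivatives; the difference of two
  steps is a test function.\<close>

definition ramp :: "real \<Rightarrow> real" where
  "ramp x = (max 0 x)\<^sup>2 / 2"

lemma DERIV_ramp: "(ramp has_real_derivative max 0 x) (at x)"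
proof -
  consider "x > 0" | "x < 0" | "x = 0" by linarith
  then show ?thesis
  proof cases
    case 1
    have "((\<lambda>x. x\<^sup>2 / 2) has_real_derivative x) (at x)"
      by (auto intro!: derivative_eq_intros)
    moreover have "\<forall>\<^sub>F y in nhds x. y\<^sup>2 / 2 = ramp y"
      using eventually_nhds_in_open[of "{0<..}" x] 1
      by (auto elim!: eventually_mono simp: ramp_def)
    ultimately show ?thesis using 1 by (simp add: DERIV_cong_ev)
  next
    case 2
    have "((\<lambda>x. 0) has_real_derivative 0) (at x)" by simp
    moreover have "\<forall>\<^sub>F y in nhds x. 0 = ramp y"
      using eventually_nhds_in_open[of "{..<0}" x] 2
      by (auto elim!: eventually_mono simp: ramp_def)
    ultimately show ?thesis using 2 by (simp add: DERIV_cong_ev)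
  next
    case 3
    have "((\<lambda>h. ramp h / h) \<longlongrightarrow> 0) (at 0)"
    proof (rule Lim_null_comparison)
      show "\<forall>\<^sub>F h in at 0. norm (ramp h / h) \<le> \<bar>h\<bar>"
        by (rule always_eventually)
          (auto simp: ramp_def max_def power2_eq_square divide_simps abs_mult)
      show "((\<lambda>h. \<bar>h\<bar>) \<longlongrightarrow> 0) (at (0::real))"
        by (auto intro!: tendsto_eq_intros)
    qed
    then show ?thesis using 3 by (simp add: DERIV_def ramp_def[of 0])
  qed
qed

text \<open>For positive \<delta> this is the hat function of height 1/\<delta> and mass 1 on
  [c - \<delta>, c + \<delta>]. Written as a second difference of positive parts, it acquires a
  primitive as soon as \<open>ramp\<close> replaces the positive part.\<close>

definition tent :: "real \<Rightarrow> real \<Rightarrow> real \<Rightarrow> real" where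
  "tent c \<delta> x = (max 0 (x - c + \<delta>) - 2 * max 0 (x - c) + max 0 (x - c - \<delta>)) / \<delta>\<^sup>2"

definition tent_step :: "real \<Rightarrow> real \<Rightarrow> real \<Rightarrow> real" where
  "tent_step c \<delta> x = (ramp (x - c + \<delta>) - 2 * ramp (x - c) + ramp (x - c - \<delta>)) / \<delta>\<^sup>2"

lemma DERIV_tent_step: "(tent_step c \<delta> has_real_derivative tent c \<delta> x) (at x)"
  unfolding tent_step_def tent_def
  by (rule DERIV_cdivide) (rule derivative_eq_intros DERIV_chain2[OF DERIV_ramp] refl | simp)+

lemma continuous_on_tent: "continuous_on S (tent c \<delta>)"
  unfolding tent_def by (cases "\<delta> = 0") (auto intro!: continuous_intros)

context
  fixes c \<delta> :: real
  assumes \<delta>: "0 < \<delta>"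
begin

lemma tent_nonneg: "0 \<le> tent c \<delta> x"
  using \<delta> by (auto simp: tent_def max_def)

lemma tent_le: "tent c \<delta> x \<le> 1 / \<delta>"
  using \<delta> by (auto simp: tent_def max_def field_simps power2_eq_square)

lemma tent_eq_0: "\<delta> \<le> \<bar>x - c\<bar> \<Longrightarrow> tent c \<delta> x = 0"
  using \<delta> by (auto simp: tent_def max_def abs_if split: if_splits)

lemma tent_step_left: "x \<le> c - \<delta> \<Longrightarrow> tent_step c \<delta> x = 0"
  using \<delta> by (auto simp: tent_step_def ramp_def max_def)

lemma tent_step_right: "c + \<delta> \<le> x \<Longrightarrow> tent_step c \<delta> x = 1"
  using \<delta> by (auto simp: tent_step_def ramp_def max_def field_simps power2_eq_square)

lemma mono_tent_step: "x \<le> y \<Longrightarrow> tent_step c \<delta> x \<le> tent_step c \<delta> y"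
  using DERIV_nonneg_imp_nondecreasing[of x y "tent_step c \<delta>"] DERIV_tent_step tent_nonneg
  by blast

text \<open>Monotonicity compares x with a point on each flat part, where the step is exactly 0 or
  1.\<close>

lemma tent_step_bounds: "0 \<le> tent_step c \<delta> x" "tent_step c \<delta> x \<le> 1"
  using mono_tent_step[of "min x (c - \<delta>)" x] mono_tent_step[of x "max x (c + \<delta>)"]
    tent_step_left[of "min x (c - \<delta>)"] tent_step_right[of "max x (c + \<delta>)"] by auto

lemma integral_tent:
  assumes "0 \<le> c - \<delta>" "c + \<delta> \<le> T"
  shows "(LINT s:{0..T}|lborel. tent c \<delta> s) = 1"
proof -
  have "(LINT s:{0..T}|lborel. tent c \<delta> s) = tent_step c \<delta> T - tent_step c \<delta> 0"
    unfolding set_lebesgue_integral_def real_scaleR_def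
    using assms \<delta> integral_FTC_Icc_real[of 0 T "tent_step c \<delta>" "tent c \<delta>"]
      DERIV_tent_step continuous_on_tent
    by (auto simp: mult.commute continuous_on_eq_continuous_within
        intro!: continuous_on_interior)
  then show ?thesis using assms by (simp add: tent_step_left tent_step_right)
qed

end

text \<open>A tent of mass 1 at s averages u to within e of u s. Its difference from a fixed tent at
  T/2 is the derivative of a test function, so the two averages differ only by an integral of g
  against a function bounded by 1. Hence the constant is the same for all s. The bound is quadratic;
  homogeneity makes it linear in \<open>val_bounded\<close>.\<close>

lemma sobolev_pointwise_bound:
  fixes T :: real
  assumes T: "0 < T"
  obtains C where "0 \<le> C"
    "\<And>u g s. continuous_on {0..T} u \<Longrightarrow> weak_derivative T u g \<Longrightarrow> s \<in> {0..T} \<Longrightarrow>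
       \<bar>u s\<bar> \<le> C * (1 + (LINT s:{0..T}|lborel. (u s)\<^sup>2) + (LINT s:{0..T}|lborel. (g s)\<^sup>2))"
proof
  \<comment> \<open>With a quarter of T the reference tent lives on [T/4, 3T/4], inside the open
    interval.\<close>
  define \<delta>0 where "\<delta>0 = T / 4"
  have \<delta>0: "0 < \<delta>0" using T by (simp add: \<delta>0_def)
  define \<psi> where "\<psi> = tent (T/2) \<delta>0"
  \<comment> \<open>The term \<open>1 / \<delta>0\<close> bounds the reference tent and the summand
    1 bounds the test function; the factor 1 + T absorbs the length of the interval.\<close>
  define C where "C = (1 + 1 / \<delta>0) * (1 + T)"
  show "0 \<le> C" using T \<delta>0 by (simp add: C_def)
  fix u g :: "real \<Rightarrow> real" and s
  assume u: "continuous_on {0..T} u" and g: "weak_derivative T u g" and s: "s \<in> {0..T}"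
  have g2: "set_integrable lborel {0..T} (\<lambda>s. (g s)\<^sup>2)"
    and gm: "set_borel_measurable lborel {0..T} g"
    using g by (auto simp: weak_derivative_def)
  have u2: "set_integrable lborel {0..T} (\<lambda>s. (u s)\<^sup>2)"
    by (intro borel_integrable_atLeastAtMost' continuous_intros u)
  have const: "set_integrable lborel {0..T} (\<lambda>s. c)" for c :: real
    by (intro borel_integrable_atLeastAtMost' continuous_intros)
  have const_int: "(LINT s:{0..T}|lborel. c) = T * c" for c :: real
    using T by (simp add: set_lebesgue_integral_def)
  \<comment> \<open>The inequality |v| \<le> 1 + v^2 stands in for Cauchy-Schwarz and keeps
    everything linear in the integral of v^2.\<close>
  have weight: "\<bar>LINT r:{0..T}|lborel. v r * w r\<bar> \<le> K * (T + (LINT r:{0..T}|lborel. (v r)\<^sup>2))"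
    if v: "set_integrable lborel {0..T} (\<lambda>s. (v s)\<^sup>2)" and K: "0 \<le> K"
      and w: "\<And>r. \<bar>w r\<bar> \<le> K" for v w :: "real \<Rightarrow> real" and K
  proof -
    have "\<bar>LINT r:{0..T}|lborel. v r * w r\<bar> \<le> (LINT r:{0..T}|lborel. K * (1 + (v r)\<^sup>2))"
    proof (cases "set_integrable lborel {0..T} (\<lambda>r. v r * w r)")
      case True
      have i2: "set_integrable lborel {0..T} (\<lambda>r. K * (1 + (v r)\<^sup>2))"
        by (intro set_integrable_mult_right set_integral_add const v)
      have le: "\<bar>v r * w r\<bar> \<le> K * (1 + (v r)\<^sup>2)" for r
      proof -
        have "\<bar>v r\<bar> \<le> 1 + (v r)\<^sup>2"
          using sum_squares_bound[of "\<bar>v r\<bar>" 1] by simp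
        then show ?thesis
          unfolding abs_mult using w[of r] K by (metis abs_ge_zero mult.commute mult_mono)
      qed
      show ?thesis
        by (rule order_trans[OF _ set_integral_mono[OF set_integrable_abs[OF True] i2 le]])
          (rule set_integral_norm_bound[OF True, simplified])
    next
      \<comment> \<open>A product that is not integrable has integral 0 by convention, so the bound
        holds in this case too.\<close>
      case False
      then have "(LINT r:{0..T}|lborel. v r * w r) = 0"
        by (simp add: set_lebesgue_integral_def set_integrable_def not_integrable_integral_eq)
      moreover have "0 \<le> (LINT r:{0..T}|lborel. K * (1 + (v r)\<^sup>2))"
        using K by (auto simp: set_lebesgue_integral_def intro!: integral_nonneg_AE)
      ultimately show ?thesis by simp
    qed
    also have "\<dots> = K * (T + (LINT r:{0..T}|lborel. (v r)\<^sup>2))"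
      by (simp add: set_integral_add(2)[OF const v] const_int)
    finally show ?thesis .
  qed
  define U where "U = (LINT s:{0..T}|lborel. (u s)\<^sup>2)"
  define G where "G = (LINT s:{0..T}|lborel. (g s)\<^sup>2)"
  have UG: "0 \<le> U" "0 \<le> G"
    by (auto simp: U_def G_def set_lebesgue_integral_def)
  \<comment> \<open>No tent around an end point fits into [0,T]; the two end points are reached by
    continuity afterwards.\<close>
  have interior: "\<bar>u s\<bar> \<le> C * (1 + U + G)" if s: "s \<in> {0<..<T}" for s
  proof (rule field_le_epsilon)
    fix e :: real assume e: "0 < e"
    have "continuous (at s) u"
      using u s by (auto intro!: continuous_on_interior)
    then obtain d where d: "0 < d" "\<And>r. \<bar>r - s\<bar> < d \<Longrightarrow> \<bar>u r - u s\<bar> < e"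
      using e unfolding continuous_at_real_range by (metis real_norm_def)
    \<comment> \<open>Halving puts the tent strictly inside both the continuity window around s and
      the interval (0,T).\<close>
    define \<delta> where "\<delta> = min d (min s (T - s)) / 2"
    have \<delta>: "0 < \<delta>" "\<delta> < d" "0 < s - \<delta>" "s + \<delta> < T"
      using d s by (auto simp: \<delta>_def min_def field_simps)
    define \<rho> where "\<rho> = tent s \<delta>"
    have \<rho>_int: "(LINT r:{0..T}|lborel. \<rho> r) = 1"
      unfolding \<rho>_def using \<delta> by (intro integral_tent) auto
    have \<rho>: "continuous_on {0..T} \<rho>" and \<psi>: "continuous_on {0..T} \<psi>"
      by (auto simp: \<rho>_def \<psi>_def continuous_on_tent)
    \<comment> \<open>Both steps rise from 0 to 1, so they cancel near both ends of the interval and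
      the difference has compact support.\<close>
    define \<phi> where "\<phi> r = tent_step s \<delta> r - tent_step (T/2) \<delta>0 r" for r
    have test: "test_function T \<phi> (\<lambda>r. \<rho> r - \<psi> r)"
      unfolding test_function_def
    proof (intro conjI allI exI)
      show "(\<phi> has_real_derivative \<rho> r - \<psi> r) (at r)" for r
        unfolding \<phi>_def \<rho>_def \<psi>_def by (intro DERIV_diff DERIV_tent_step)
      show "continuous_on UNIV (\<lambda>r. \<rho> r - \<psi> r)"
        unfolding \<rho>_def \<psi>_def by (intro continuous_intros continuous_on_tent)
      show "0 < min (s - \<delta>) (T/4)" "max (s + \<delta>) (3 * T/4) < T" using \<delta> T by auto
      show "r \<notin> {min (s - \<delta>) (T/4)..max (s + \<delta>) (3 * T/4)} \<longrightarrow> \<phi> r = 0" for r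
        using \<delta> \<delta>0 by (auto simp: \<phi>_def tent_step_left tent_step_right \<delta>0_def)
    qed
    have bnd: "\<bar>\<phi> r\<bar> \<le> 1" for r
      using tent_step_bounds[OF \<delta>(1), of s r] tent_step_bounds[OF \<delta>0, of "T/2" r]
      by (auto simp: \<phi>_def)
    have ip: "set_integrable lborel {0..T} (\<lambda>r. u r * \<rho> r)"
      "set_integrable lborel {0..T} (\<lambda>r. u r * \<psi> r)"
      "set_integrable lborel {0..T} (\<lambda>r. (u s - e) * \<rho> r)"
      "set_integrable lborel {0..T} (\<lambda>r. (u s + e) * \<rho> r)"
      by (intro borel_integrable_atLeastAtMost' continuous_intros u \<rho> \<psi>)+
    have "(LINT r:{0..T}|lborel. u r * (\<rho> r - \<psi> r)) = - (LINT r:{0..T}|lborel. g r * \<phi> r)"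
      using g test by (auto simp: weak_derivative_def)
    then have eq: "(LINT r:{0..T}|lborel. u r * \<rho> r)
        = (LINT r:{0..T}|lborel. u r * \<psi> r) - (LINT r:{0..T}|lborel. g r * \<phi> r)"
      by (simp add: right_diff_distrib set_integral_diff(2)[OF ip(1,2)])
    have "\<bar>LINT r:{0..T}|lborel. u r * \<psi> r\<bar> \<le> 1 / \<delta>0 * (T + U)"
      unfolding U_def using tent_nonneg[OF \<delta>0] tent_le[OF \<delta>0] \<delta>0
      by (intro weight u2) (auto simp: \<psi>_def)
    moreover have "\<bar>LINT r:{0..T}|lborel. g r * \<phi> r\<bar> \<le> 1 * (T + G)"
      unfolding G_def by (intro weight g2 bnd) auto
    ultimately have le: "\<bar>LINT r:{0..T}|lborel. u r * \<rho> r\<bar> \<le> 1 / \<delta>0 * (T + U) + (T + G)"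
      unfolding eq by (intro order_trans[OF abs_triangle_ineq4 add_mono]) auto
    \<comment> \<open>Off the support of \<rho> all terms are 0; on it, u stays within e of u
      s.\<close>
    have near: "(u s - e) * \<rho> r \<le> u r * \<rho> r" "u r * \<rho> r \<le> (u s + e) * \<rho> r" for r
    proof -
      have "\<rho> r = 0 \<or> (u s - e \<le> u r \<and> u r \<le> u s + e)"
      proof (cases "\<bar>r - s\<bar> < \<delta>")
        case True
        then have "\<bar>u r - u s\<bar> < e" using d(2)[of r] \<delta>(2) by linarith
        then show ?thesis by linarith
      next
        case False
        then show ?thesis using tent_eq_0[OF \<delta>(1), of r s] by (simp add: \<rho>_def)
      qed
      moreover have "0 \<le> \<rho> r" using tent_nonneg[OF \<delta>(1), of s r] by (simp add: \<rho>_def)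
      ultimately show "(u s - e) * \<rho> r \<le> u r * \<rho> r" "u r * \<rho> r \<le> (u s + e) * \<rho> r"
        by (metis mult_right_mono mult_zero_right order_refl)+
    qed
    have "u s - e \<le> (LINT r:{0..T}|lborel. u r * \<rho> r)"
      using set_integral_mono[OF ip(3,1) near(1)] by (simp add: \<rho>_int)
    moreover have "(LINT r:{0..T}|lborel. u r * \<rho> r) \<le> u s + e"
      using set_integral_mono[OF ip(1,4) near(2)] by (simp add: \<rho>_int)
    ultimately have "\<bar>u s\<bar> \<le> 1 / \<delta>0 * (T + U) + (T + G) + e" using le by linarith
    also have "1 / \<delta>0 * (T + U) + (T + G) \<le> C * (1 + U + G)"
    proof -
      have K: "0 \<le> 1 / \<delta>0" using \<delta>0 by simp
      have "T + U \<le> (1 + T) * (1 + U + G)" "T + G \<le> (1 + T) * (1 + U + G)"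
        using T UG by (auto simp: algebra_simps)
      then have "1 / \<delta>0 * (T + U) \<le> 1 / \<delta>0 * ((1 + T) * (1 + U + G))"
        using K by (intro mult_left_mono) auto
      moreover have "(1 + k) * a * b = k * (a * b) + a * b" for k a b :: real
        by (simp add: algebra_simps)
      ultimately show ?thesis
        unfolding C_def using \<open>T + G \<le> _\<close> by (simp only: add_mono)
    qed
    finally show "\<bar>u s\<bar> \<le> C * (1 + U + G) + e" by simp
  qed
  have "\<bar>u s\<bar> \<le> C * (1 + U + G)"
  proof (rule continuous_le_on_closure[where f = "\<lambda>s. \<bar>u s\<bar>" and S = "{0<..<T}"])
    show "continuous_on (closure {0<..<T}) (\<lambda>s. \<bar>u s\<bar>)"
      using T u by (auto intro!: continuous_intros)
  qed (use s T interior in auto)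
  then show "\<bar>u s\<bar> \<le> C * (1 + (LINT s:{0..T}|lborel. (u s)\<^sup>2) + (LINT s:{0..T}|lborel. (g s)\<^sup>2))"
    by (simp add: U_def G_def)
qed

text \<open>Gives \<open>const_path\<close> its meaning, since \<open>the_inv val\<close> recovers a
  function only if that function lies in \<open>sobolev_H T\<close>. The weak derivative is 0
  because the derivative of a test function integrates to 0.\<close>

lemma const_in_sobolev_H:
  fixes x :: "real^'n"
  assumes "0 < T"
  shows "restrict (\<lambda>s. x) {0..T} \<in> sobolev_H T"
proof -
  have "weak_derivative T (\<lambda>s. (restrict (\<lambda>s. x) {0..T}) s $ k) (\<lambda>s. 0)" for k
    unfolding weak_derivative_def
  proof (intro conjI allI impI)
    fix \<phi> \<phi>' assume t: "test_function T \<phi> \<phi>'"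
    then obtain a b where ab: "0 < a" "b < T" "\<And>s. s \<notin> {a..b} \<Longrightarrow> \<phi> s = 0"
      and D: "\<And>s. (\<phi> has_real_derivative \<phi>' s) (at s)" and c: "continuous_on UNIV \<phi>'"
      unfolding test_function_def by blast
    have "(LINT s:{0..T}|lborel. \<phi>' s) = \<phi> T - \<phi> 0"
      unfolding set_lebesgue_integral_def real_scaleR_def
      using assms integral_FTC_Icc_real[of 0 T \<phi> \<phi>'] D c
      by (auto simp: mult.commute continuous_on_eq_continuous_at)
    also have "\<dots> = 0" using ab by simp
    finally have 0: "(LINT s:{0..T}|lborel. \<phi>' s) = 0" .
    have "(LINT s:{0..T}|lborel. restrict (\<lambda>s. x) {0..T} s $ k * \<phi>' s)
        = (LINT s:{0..T}|lborel. x $ k * \<phi>' s)"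
      by (intro set_lebesgue_integral_cong) auto
    with 0 show "(LINT s:{0..T}|lborel. restrict (\<lambda>s. x) {0..T} s $ k * \<phi>' s)
        = - (LINT s:{0..T}|lborel. 0 * \<phi> s)"
      by simp
  qed (auto simp: set_borel_measurable_def set_integrable_def)
  moreover have "continuous_on {0..T} (\<lambda>s. (restrict (\<lambda>s. x) {0..T}) s $ k)" for k
    by (rule continuous_on_eq[of _ "\<lambda>s. x $ k"]) auto
  ultimately show ?thesis
    unfolding sobolev_H_def sobolev_W12_def by blast
qed

section \<open>Measurability in separable Hilbert spaces\<close>

text \<open>The parallelogram law makes a minimising sequence Cauchy, because midpoints of its
  members stay in \<open>G\<close>; the limit is a nearest point.\<close>

lemma closed_subspace_projection:
  fixes G :: "'h::{real_inner, banach} set"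
  assumes sub: "subspace G" and cl: "closed G"
  shows "\<exists>g\<in>G. \<forall>y\<in>G. inner (h - g) y = 0"
proof -
  define d where "d = (INF g\<in>G. (norm (h - g))\<^sup>2)"
  have ne: "G \<noteq> {}" using sub subspace_0 by blast
  have bdd: "bdd_below ((\<lambda>g. (norm (h - g))\<^sup>2) ` G)"
    by (rule bdd_belowI[of _ 0]) auto
  have lower: "d \<le> (norm (h - g))\<^sup>2" if "g \<in> G" for g
    unfolding d_def using bdd that by (rule cINF_lower)
  have "\<exists>g\<in>G. (norm (h - g))\<^sup>2 < d + 1 / real (Suc n)" for n
    using cINF_less_iff[OF ne bdd, of "d + 1 / real (Suc n)"] by (auto simp: d_def)
  then obtain g where g: "\<And>n. g n \<in> G" "\<And>n. (norm (h - g n))\<^sup>2 < d + 1 / real (Suc n)"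
    by metis
  have close: "(norm (g n - g m))\<^sup>2 \<le> 2 / real (Suc n) + 2 / real (Suc m)" for n m
  proof -
    have "(1/2) *\<^sub>R (g n + g m) \<in> G"
      using sub g(1) by (intro subspace_scale subspace_add)
    then have "d \<le> (norm (h - (1/2) *\<^sub>R (g n + g m)))\<^sup>2" by (rule lower)
    moreover have "(norm (g n - g m))\<^sup>2 + 4 * (norm (h - (1/2) *\<^sub>R (g n + g m)))\<^sup>2
        = 2 * (norm (h - g n))\<^sup>2 + 2 * (norm (h - g m))\<^sup>2"
      by (simp add: power2_norm_eq_inner inner_diff inner_add inner_commute algebra_simps)
    ultimately show ?thesis using g(2)[of n] g(2)[of m] by auto
  qed
  have "Cauchy g"
  proof (rule CauchyI)
    fix e :: real assume e: "0 < e"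
    obtain N where "4 / e\<^sup>2 < real N" using reals_Archimedean2 by blast
    then have N: "4 / e\<^sup>2 < real (Suc N)" by simp
    have "norm (g m - g n) < e" if "N \<le> m" "N \<le> n" for m n
    proof -
      have "2 / real (Suc m) + 2 / real (Suc n) \<le> 2 / real (Suc N) + 2 / real (Suc N)"
        using that by (intro add_mono divide_left_mono) auto
      also have "\<dots> = 4 / real (Suc N)" by simp
      also have "\<dots> < e\<^sup>2"
        using N e by (simp add: divide_less_eq mult.commute del: of_nat_Suc)
      finally have "(norm (g m - g n))\<^sup>2 < e\<^sup>2" using close[of m n] by linarith
      then show ?thesis using e by (simp add: power2_less_imp_less)
    qed
    then show "\<exists>M. \<forall>m\<ge>M. \<forall>n\<ge>M. norm (g m - g n) < e" by blast
  qed
  then obtain l where l: "g \<longlonglongrightarrow> l" using Cauchy_convergent_iff convergent_def by blast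
  have lG: "l \<in> G" using closed_sequentially[OF cl g(1) l] .
  have "(norm (h - l))\<^sup>2 \<le> d"
  proof (rule LIMSEQ_le)
    show "(\<lambda>n. (norm (h - g n))\<^sup>2) \<longlonglongrightarrow> (norm (h - l))\<^sup>2"
      by (intro tendsto_intros l)
    show "(\<lambda>n. d + 1 / real (Suc n)) \<longlonglongrightarrow> d"
      using tendsto_add[OF tendsto_const LIMSEQ_inverse_real_of_nat, of d]
      by (simp add: inverse_eq_divide)
    show "\<exists>N. \<forall>n\<ge>N. (norm (h - g n))\<^sup>2 \<le> d + 1 / real (Suc n)"
      using g(2) less_imp_le by blast
  qed
  then have min: "(norm (h - l))\<^sup>2 \<le> (norm (h - y))\<^sup>2" if "y \<in> G" for y
    using lower[OF that] by linarith
  show ?thesis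
  proof (rule bexI[OF _ lG], rule ballI)
    fix y assume y: "y \<in> G"
    define c where "c = inner (h - l) y"
    show "inner (h - l) y = 0"
    proof (cases "y = 0")
      case False
      \<comment> \<open>The minimiser along the line l + t y. Moving there lowers the squared
        distance by c^2 / |y|^2, so minimality of l forces c = 0.\<close>
      define t where "t = c / inner y y"
      have "l + t *\<^sub>R y \<in> G" using sub lG y by (intro subspace_scale subspace_add)
      then have "inner (h - l) (h - l) \<le> inner (h - l - t *\<^sub>R y) (h - l - t *\<^sub>R y)"
        using min by (metis power2_norm_eq_inner diff_diff_eq)
      also have "\<dots> = inner (h - l) (h - l) - 2 * t * c + t * t * inner y y"
        by (simp add: inner_diff inner_commute c_def algebra_simps)
      also have "\<dots> = inner (h - l) (h - l) - c * c / inner y y"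
        using False by (simp add: t_def field_simps)
      finally have "c * c / inner y y \<le> 0" by simp
      moreover have "0 < inner y y" using False by simp
      ultimately have "c * c \<le> 0" by (auto simp: divide_le_0_iff)
      then show ?thesis by (auto simp: c_def mult_le_0_iff)
    qed simp
  qed
qed

text \<open>The kernel of a nonzero functional has codimension 1: the part \<open>w\<close> of h
  orthogonal to it represents \<open>f\<close> after rescaling, because x - (f x / f w) w always
  lies in the kernel.\<close>

lemma riesz_representation:
  fixes f :: "'h::{real_inner, banach} \<Rightarrow> real"
  assumes f: "bounded_linear f"
  obtains v where "\<And>x. f x = inner v x"
proof (cases "\<forall>x. f x = 0")
  case True
  then show ?thesis using that[of 0] by simp
next
  case False
  then obtain h where h: "f h \<noteq> 0" by blast
  interpret f: bounded_linear f by (rule f)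
  have "subspace {x. f x = 0}"
    by (auto simp: subspace_def f.add f.scale)
  moreover have "closed {x. f x = 0}"
    using f.continuous_on[OF continuous_on_id, of UNIV] by (intro closed_Collect_eq) auto
  ultimately obtain g where "g \<in> {x. f x = 0}" "\<forall>y\<in>{x. f x = 0}. inner (h - g) y = 0"
    using closed_subspace_projection[of "{x. f x = 0}" h] by blast
  then have g: "f g = 0" "\<And>y. f y = 0 \<Longrightarrow> inner (h - g) y = 0" by auto
  define w where "w = h - g"
  have w: "w \<noteq> 0" "f w = f h" using h g(1) by (auto simp: w_def f.diff)
  have "f x = inner ((f w / inner w w) *\<^sub>R w) x" for x
  proof -
    have "f (x - (f x / f w) *\<^sub>R w) = 0" using h w by (simp add: f.diff f.scale)
    then have "inner w (x - (f x / f w) *\<^sub>R w) = 0" unfolding w_def by (rule g(2))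
    then have "inner w x = f x / f w * inner w w" by (simp add: inner_diff)
    then show ?thesis using w h by simp
  qed
  then show ?thesis using that by blast
qed

text \<open>The norm is a countable supremum of inner products, so distances to fixed points are
  measurable and preimages of balls are in \<open>N\<close>. By Lindelof every open set is a
  countable union of balls.\<close>

lemma borel_measurable_if_inner:
  fixes X :: "'w \<Rightarrow> 'h::{real_inner, second_countable_topology}"
  assumes X: "\<And>v. (\<lambda>\<omega>. inner v (X \<omega>)) \<in> borel_measurable N"
  shows "X \<in> borel_measurable N"
proof -
  obtain D :: "'h set" where D: "countable D" "\<And>U. open U \<Longrightarrow> U \<noteq> {} \<Longrightarrow> \<exists>d\<in>D. d \<in> U"
    using countable_dense_exists by blast
  have "(\<lambda>\<omega>. norm (X \<omega> - c)) \<in> borel_measurable N" for c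
  proof -
    \<comment> \<open>Normalised dense vectors close to y almost attain the norm. This uses
      continuity of \<open>sgn\<close> at y, which fails only at 0, hence the separate case.\<close>
    have norm: "norm y = (SUP d\<in>D. inner (sgn d) y)" for y :: 'h
    proof (rule antisym)
      have le: "inner (sgn d) y \<le> norm y" for d :: 'h
      proof -
        have "inner (sgn d) y \<le> norm (sgn d) * norm y" by (rule norm_cauchy_schwarz)
        also have "\<dots> \<le> 1 * norm y" by (intro mult_right_mono) (auto simp: norm_sgn)
        finally show ?thesis by simp
      qed
      have ne: "D \<noteq> {}" using D(2)[of UNIV] by auto
      show "(SUP d\<in>D. inner (sgn d) y) \<le> norm y" using ne le by (intro cSUP_least)
      have bdd: "bdd_above ((\<lambda>d. inner (sgn d) y) ` D)"
        using le by (intro bdd_aboveI[of _ "norm y"]) auto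
      show "norm y \<le> (SUP d\<in>D. inner (sgn d) y)"
      proof (cases "y = 0")
        case True
        then show ?thesis using ne by simp
      next
        case False
        show ?thesis
        proof (rule field_le_epsilon)
          fix e :: real assume e: "0 < e"
          have "isCont (\<lambda>d. inner (sgn d) y) y" using False by (intro continuous_intros) auto
          moreover have "inner (sgn y) y = norm y"
            using False by (simp add: sgn_div_norm power2_norm_eq_inner[symmetric] power2_eq_square)
          ultimately have "((\<lambda>d. inner (sgn d) y) \<longlongrightarrow> norm y) (nhds y)"
            by (metis isCont_def tendsto_at_iff_tendsto_nhds)
          then have "\<forall>\<^sub>F d in nhds y. norm y - e < inner (sgn d) y"
            using e by (intro order_tendstoD(1)) auto
          then obtain S where "open S" "y \<in> S" "\<forall>d\<in>S. norm y - e < inner (sgn d) y"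
            unfolding eventually_nhds by blast
          then obtain d where d: "d \<in> D" "norm y - e < inner (sgn d) y" using D(2)[of S] by blast
          then show "norm y \<le> (SUP d\<in>D. inner (sgn d) y) + e"
            using cSUP_upper[OF d(1) bdd] by linarith
        qed
      qed
    qed
    have "bdd_above ((\<lambda>d. inner (sgn d) y) ` D)" for y
      using order_trans[OF norm_cauchy_schwarz mult_right_mono[of "norm (sgn _)" 1 "norm y"]]
      by (intro bdd_aboveI[of _ "norm y"]) (auto simp: norm_sgn)
    moreover have "(\<lambda>\<omega>. inner (sgn d) (X \<omega> - c)) \<in> borel_measurable N" for d
      unfolding inner_diff_right by (intro borel_measurable_diff X) simp
    ultimately show ?thesis unfolding norm
      by (intro borel_measurable_cSUP D)
  qed
  then have ball: "X -` ball c r \<inter> space N \<in> sets N" for c r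
  proof -
    have "X -` ball c r \<inter> space N = {\<omega> \<in> space N. norm (X \<omega> - c) < r}"
      by (auto simp: dist_norm norm_minus_commute)
    then show ?thesis using \<open>\<And>c. (\<lambda>\<omega>. norm (X \<omega> - c)) \<in> borel_measurable N\<close> by simp
  qed
  show ?thesis
  proof (rule borel_measurableI)
    fix S :: "'h set" assume S: "open S"
    define F where "F = {ball c r | c r. ball c r \<subseteq> S}"
    have "\<Union>F = S"
    proof
      show "S \<subseteq> \<Union>F"
      proof
        fix x assume "x \<in> S"
        then obtain e where "0 < e" "ball x e \<subseteq> S" using S open_contains_ball by blast
        then have "ball x e \<in> F" "x \<in> ball x e" by (auto simp: F_def)
        then show "x \<in> \<Union>F" by blast
      qed
    qed (auto simp: F_def)
    have "\<And>U. U \<in> F \<Longrightarrow> open U" by (auto simp: F_def)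
    then obtain F' where F': "F' \<subseteq> F" "countable F'" "\<Union>F' = \<Union>F"
      using Lindelof by metis
    have "X -` S \<inter> space N = (\<Union>U\<in>F'. X -` U \<inter> space N)"
      using F' \<open>\<Union>F = S\<close> by blast
    also have "\<dots> \<in> sets N"
      using F' ball unfolding F_def by (intro sets.countable_UN') auto
    finally show "X -` S \<inter> space N \<in> sets N" .
  qed
qed

text \<open>The vectors \<open>v\<close> for which \<open>inner v X\<close> is measurable form a closed subspace, and by
  separation its orthogonal complement is trivial.\<close>

lemma borel_measurable_if_separating:
  fixes X :: "'w \<Rightarrow> 'h::{real_inner, banach, second_countable_topology}"
  assumes lin: "\<And>f. f \<in> \<F> \<Longrightarrow> bounded_linear f"
    and sep: "\<And>h. (\<And>f. f \<in> \<F> \<Longrightarrow> f h = (0::real)) \<Longrightarrow> h = 0"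
    and meas: "\<And>f. f \<in> \<F> \<Longrightarrow> (\<lambda>\<omega>. f (X \<omega>)) \<in> borel_measurable N"
  shows "X \<in> borel_measurable N"
proof (rule borel_measurable_if_inner)
  define G where "G = {v. (\<lambda>\<omega>. inner v (X \<omega>)) \<in> borel_measurable N}"
  have "subspace G"
    unfolding subspace_def G_def by (auto simp: inner_add_left)
  moreover have "closed G"
    unfolding closed_sequential_limits
  proof (intro allI impI, elim conjE)
    fix v l assume v: "\<forall>n. v n \<in> G" and l: "v \<longlonglongrightarrow> l"
    have "(\<lambda>n. inner (v n) (X \<omega>)) \<longlonglongrightarrow> inner l (X \<omega>)" for \<omega>
      by (intro tendsto_intros l)
    then have "(\<lambda>\<omega>. inner l (X \<omega>)) \<in> borel_measurable N"
      by (rule borel_measurable_LIMSEQ_real) (use v in \<open>simp add: G_def\<close>)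
    then show "l \<in> G" by (simp add: G_def)
  qed
  ultimately have proj: "\<exists>g\<in>G. \<forall>y\<in>G. inner (h - g) y = 0" for h
    by (rule closed_subspace_projection)
  fix v
  obtain g where g: "g \<in> G" "\<And>y. y \<in> G \<Longrightarrow> inner (v - g) y = 0" using proj by blast
  have "f (v - g) = 0" if f: "f \<in> \<F>" for f
  proof -
    \<comment> \<open>The representing vector of \<open>f\<close> belongs to \<open>G\<close> by
      measurability of \<open>f\<close>, so \<open>f\<close> vanishes on the residual v - g, which
      is orthogonal to \<open>G\<close>.\<close>
    obtain e where e: "\<And>x. f x = inner e x" using riesz_representation[OF lin[OF f]] by blast
    have "e \<in> G" using meas[OF f] by (simp add: G_def e)
    then show ?thesis using g(2) by (simp add: e inner_commute)
  qed
  then have "v - g = 0" by (rule sep)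
  then show "(\<lambda>\<omega>. inner v (X \<omega>)) \<in> borel_measurable N" using g(1) by (simp add: G_def)
qed

section \<open>The stochastic integral and bounded linear maps\<close>

locale brownian = prob_space M for M :: "'w measure" +
  fixes T :: real and W :: "real \<Rightarrow> 'w \<Rightarrow> real^'d"
  assumes W: "brownian_motion M T W"
begin

abbreviation F where "F \<equiv> natural_filtration M W"

lemma W_measurable: "t \<in> {0..T} \<Longrightarrow> W t \<in> borel_measurable M"
  using W by (simp add: brownian_motion_def)

lemma space_F [simp]: "space (F t) = space M"
  unfolding natural_filtration_def by (rule space_measure_of) auto

lemma sets_F:
  "sets (F t) = sigma_sets (space M) {W s -` B \<inter> space M | s B. s \<in> {0..t} \<and> B \<in> sets borel}"
  unfolding natural_filtration_def by (rule sets_measure_of) auto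

lemma subalgebra_F_F: "s \<le> t \<Longrightarrow> subalgebra (F t) (F s)"
  unfolding subalgebra_def sets_F
  by (auto intro!: sigma_sets_mono') (use order_trans in blast)

lemma subalgebra_M_F: "t \<le> T \<Longrightarrow> subalgebra M (F t)"
  unfolding subalgebra_def sets_F
  by (auto intro!: sets.sigma_sets_subset measurable_sets[OF W_measurable])

lemma W_measurable_F: "0 \<le> s \<Longrightarrow> s \<le> t \<Longrightarrow> W s \<in> borel_measurable (F t)"
  by (rule measurableI) (auto simp: sets_F intro!: sigma_sets.Basic)

text \<open>In contrast to \<open>progressive\<close>, this speaks of the final time t alone, which
  is what Tonelli's theorem asks for when the energy is integrated over [0,t].\<close>

definition jointly_measurable ::
  "real \<Rightarrow> (real \<Rightarrow> 'w \<Rightarrow> ((real^'d) \<Rightarrow>\<^sub>L 'b::{real_inner, banach, second_countable_topology})) \<Rightarrow> bool"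
where
  "jointly_measurable t \<Psi> \<longleftrightarrow> (\<forall>z. (\<lambda>(r, \<omega>). blinfun_apply (\<Psi> r \<omega>) z)
     \<in> (restrict_space borel {0..t} \<Otimes>\<^sub>M F t) \<rightarrow>\<^sub>M borel)"

section \<open>Measurability and comparison of energies\<close>

definition energy ::
  "real \<Rightarrow> (real \<Rightarrow> 'w \<Rightarrow> ((real^'d) \<Rightarrow>\<^sub>L 'b::real_normed_vector)) \<Rightarrow> 'w \<Rightarrow> ennreal"
where
  "energy t \<Psi> \<omega> = (\<integral>\<^sup>+r\<in>{0..t}. ennreal (hs_norm_sq (\<Psi> r \<omega>)) \<partial>lborel)"

lemma hs_norm_sq_nonneg: "0 \<le> hs_norm_sq \<Phi>"
  by (simp add: hs_norm_sq_def sum_nonneg)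

lemma energy_restrict:
  "energy t \<Psi> \<omega> = (\<integral>\<^sup>+r. ennreal (hs_norm_sq (\<Psi> r \<omega>)) \<partial>restrict_space lborel {0..t})"
  unfolding energy_def by (simp add: nn_integral_restrict_space)

text \<open>Bridges the two conventions: \<open>energy\<close> integrates against
  \<open>lborel\<close>, while \<open>progressive\<close> is stated over
  \<open>borel\<close>.\<close>

lemma sets_restrict_lborel_pair:
  "sets (restrict_space lborel {0..t} \<Otimes>\<^sub>M N) = sets (restrict_space borel {0..t} \<Otimes>\<^sub>M N)"
  by (intro sets_pair_measure_cong sets_restrict_space_cong) auto

text \<open>The Hilbert-Schmidt norm looks at the finitely many images of the basis vectors, so
  strong measurability is enough and no sigma-algebra on the operators enters.\<close>

lemma hs_norm_sq_measurable:
  assumes "jointly_measurable t \<Psi>"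
  shows "(\<lambda>(r, \<omega>). ennreal (hs_norm_sq (\<Psi> r \<omega>)))
     \<in> borel_measurable (restrict_space lborel {0..t} \<Otimes>\<^sub>M F t)"
proof -
  have "(\<lambda>x. norm (blinfun_apply (\<Psi> (fst x) (snd x)) z))
     \<in> borel_measurable (restrict_space borel {0..t} \<Otimes>\<^sub>M F t)" for z
    using assms
    by (intro measurable_compose[OF _ borel_measurable_norm])
      (simp add: jointly_measurable_def case_prod_beta')
  then show ?thesis
    unfolding hs_norm_sq_def case_prod_beta' measurable_cong_sets[OF sets_restrict_lborel_pair refl]
    by (intro measurable_compose[OF _ measurable_ennreal] borel_measurable_sum
        borel_measurable_power) auto
qed

lemma hs_norm_sq_section_measurable:
  assumes "jointly_measurable t \<Psi>" "\<omega> \<in> space M"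
  shows "(\<lambda>r. ennreal (hs_norm_sq (\<Psi> r \<omega>))) \<in> borel_measurable (restrict_space lborel {0..t})"
  using measurable_compose[OF measurable_Pair2'[of \<omega> "F t"] hs_norm_sq_measurable[OF assms(1)]]
    assms(2) by simp

lemma energy_measurable:
  assumes "jointly_measurable t \<Psi>" "t \<le> T"
  shows "energy t \<Psi> \<in> borel_measurable M"
proof -
  interpret sigma_finite_measure "restrict_space lborel {0..t}"
    by (rule sigma_finite_measure_restrict_space) (auto simp: lborel.sigma_finite_measure_axioms)
  have "(\<lambda>\<omega>. \<integral>\<^sup>+r. ennreal (hs_norm_sq (\<Psi> r \<omega>)) \<partial>restrict_space lborel {0..t})
      \<in> borel_measurable (F t)"
    using measurable_pair_swap[OF hs_norm_sq_measurable[OF assms(1)]]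
    by (intro borel_measurable_nn_integral) simp
  then show ?thesis
    unfolding energy_restrict[abs_def]
    using measurable_from_subalg[OF subalgebra_M_F[OF assms(2)]] by blast
qed

lemma energy_le:
  assumes "jointly_measurable t \<Phi>" "\<omega> \<in> space M" "0 \<le> c"
    and "\<And>r. r \<in> {0..t} \<Longrightarrow> hs_norm_sq (\<Psi> r \<omega>) \<le> c * hs_norm_sq (\<Phi> r \<omega>)"
  shows "energy t \<Psi> \<omega> \<le> ennreal c * energy t \<Phi> \<omega>"
proof -
  have "energy t \<Psi> \<omega> \<le> (\<integral>\<^sup>+r. ennreal c * ennreal (hs_norm_sq (\<Phi> r \<omega>))
      \<partial>restrict_space lborel {0..t})"
    unfolding energy_restrict using assms(3,4)
    by (intro nn_integral_mono)
      (auto simp: ennreal_mult[symmetric] space_restrict_space hs_norm_sq_nonneg intro!: ennreal_leI)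
  also have "\<dots> = ennreal c * energy t \<Phi> \<omega>"
    unfolding energy_restrict
    by (rule nn_integral_cmult) (rule hs_norm_sq_section_measurable[OF assms(1,2)])
  finally show ?thesis .
qed

lemma energy_le_add:
  assumes "jointly_measurable t \<Phi>" "jointly_measurable t \<Phi>'" "\<omega> \<in> space M" "0 \<le> c"
    and "\<And>r. r \<in> {0..t} \<Longrightarrow>
      hs_norm_sq (\<Psi> r \<omega>) \<le> c * (hs_norm_sq (\<Phi> r \<omega>) + hs_norm_sq (\<Phi>' r \<omega>))"
  shows "energy t \<Psi> \<omega> \<le> ennreal c * (energy t \<Phi> \<omega> + energy t \<Phi>' \<omega>)"
proof -
  note m = hs_norm_sq_section_measurable[OF assms(1,3)] hs_norm_sq_section_measurable[OF assms(2,3)]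
  have "energy t \<Psi> \<omega> \<le> (\<integral>\<^sup>+r. ennreal c * (ennreal (hs_norm_sq (\<Phi> r \<omega>))
      + ennreal (hs_norm_sq (\<Phi>' r \<omega>))) \<partial>restrict_space lborel {0..t})"
    unfolding energy_restrict using assms(4,5)
    by (intro nn_integral_mono)
      (auto simp: ennreal_mult[symmetric] ennreal_plus[symmetric] space_restrict_space hs_norm_sq_nonneg
        simp del: ennreal_plus intro!: ennreal_leI)
  also have "\<dots> = ennreal c * (energy t \<Phi> \<omega> + energy t \<Phi>' \<omega>)"
    unfolding energy_restrict using m
    by (subst nn_integral_cmult) (auto simp: nn_integral_add)
  finally show ?thesis .
qed

lemma jointly_measurable_diff:
  "jointly_measurable t \<Phi> \<Longrightarrow> jointly_measurable t \<Psi> \<Longrightarrow>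
     jointly_measurable t (\<lambda>r \<omega>. \<Phi> r \<omega> - \<Psi> r \<omega>)"
  unfolding jointly_measurable_def case_prod_beta'
  by (auto simp: blinfun.diff_left intro!: borel_measurable_diff)

lemma jointly_measurable_progressive:
  "(\<And>z. progressive F t (\<lambda>r \<omega>. blinfun_apply (\<Phi> r \<omega>) z)) \<Longrightarrow> 0 \<le> t \<Longrightarrow> jointly_measurable t \<Phi>"
  unfolding jointly_measurable_def progressive_def by auto

section \<open>Measurability of elementary processes and integrals\<close>

lemma elementary_apply_measurable:
  assumes "elementary F t m \<tau> \<xi>" "i < m"
  shows "(\<lambda>\<omega>. blinfun_apply (\<xi> i \<omega>) z) \<in> borel_measurable (F (\<tau> i))"
  using assms
  by (intro borel_measurable_simple_function)
    (auto simp: elementary_def intro!: simple_function_compose1[where g = "\<lambda>a. blinfun_apply a z"])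

lemma jointly_measurable_elementary:
  fixes \<xi> :: "nat \<Rightarrow> 'w \<Rightarrow> ((real^'d) \<Rightarrow>\<^sub>L 'b::{real_inner, banach, second_countable_topology})"
  assumes "elementary F t m \<tau> \<xi>"
  shows "jointly_measurable t (elementary_process m \<tau> \<xi>)"
  unfolding jointly_measurable_def
proof
  fix z
  have "(\<lambda>x. indicator {\<tau> i<..\<tau> (Suc i)} (fst x) *\<^sub>R blinfun_apply (\<xi> i (snd x)) z)
      \<in> borel_measurable (restrict_space borel {0..t} \<Otimes>\<^sub>M F t)" if i: "i < m" for i
  proof (rule borel_measurable_scaleR)
    have "(\<lambda>r. indicator {\<tau> i<..\<tau> (Suc i)} r :: real) \<in> borel_measurable (restrict_space borel {0..t})"
      by (rule measurable_restrict_space1) auto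
    then show "(\<lambda>x. indicator {\<tau> i<..\<tau> (Suc i)} (fst x) :: real)
      \<in> borel_measurable (restrict_space borel {0..t} \<Otimes>\<^sub>M F t)"
      by (rule measurable_compose[OF measurable_fst])
    have "\<tau> i \<le> t" using assms i by (auto simp: elementary_def intro: order_trans)
    then have "(\<lambda>\<omega>. blinfun_apply (\<xi> i \<omega>) z) \<in> borel_measurable (F t)"
      by (rule measurable_from_subalg[OF subalgebra_F_F elementary_apply_measurable[OF assms i]])
    then show "(\<lambda>x. blinfun_apply (\<xi> i (snd x)) z)
      \<in> borel_measurable (restrict_space borel {0..t} \<Otimes>\<^sub>M F t)"
      by (rule measurable_compose[OF measurable_snd])
  qed
  then show "(\<lambda>(r, \<omega>). blinfun_apply (elementary_process m \<tau> \<xi> r \<omega>) z)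
      \<in> borel_measurable (restrict_space borel {0..t} \<Otimes>\<^sub>M F t)"
    unfolding elementary_process_def case_prod_beta'
    by (simp only: blinfun.sum_left blinfun.scaleR_left) (intro borel_measurable_sum, simp only: lessThan_iff)
qed

text \<open>Splits an operator applied to a random vector into products of scalar increments and
  vectors, so that measurability follows from that of products, without treating evaluation as a map
  of two variables.\<close>

lemma blinfun_apply_axis_sum:
  fixes A :: "(real^'d) \<Rightarrow>\<^sub>L 'b::real_normed_vector"
  shows "blinfun_apply A z = (\<Sum>k\<in>UNIV. z $ k *\<^sub>R blinfun_apply A (axis k 1))"
proof -
  have "z = (\<Sum>k\<in>UNIV. z $ k *\<^sub>R axis k 1)"
    using basis_expansion[of z] by (simp add: scalar_mult_eq_scaleR)
  then have "blinfun_apply A z = blinfun_apply A (\<Sum>k\<in>UNIV. z $ k *\<^sub>R axis k 1)" by simp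
  then show ?thesis by (simp add: blinfun.sum_right blinfun.scaleR_right)
qed

lemma elementary_integral_measurable:
  fixes \<xi> :: "nat \<Rightarrow> 'w \<Rightarrow> ((real^'d) \<Rightarrow>\<^sub>L 'b::{real_inner, banach, second_countable_topology})"
  assumes "elementary F t m \<tau> \<xi>" "t \<le> T"
  shows "elementary_integral W m \<tau> \<xi> \<in> borel_measurable M"
proof -
  have "(\<lambda>\<omega>. (W (\<tau> (Suc i)) \<omega> - W (\<tau> i) \<omega>) $ k *\<^sub>R blinfun_apply (\<xi> i \<omega>) (axis k 1))
      \<in> borel_measurable M" if i: "i < m" for i k
  proof (rule borel_measurable_scaleR)
    have \<tau>: "0 \<le> \<tau> i" "\<tau> i \<le> \<tau> (Suc i)" "\<tau> (Suc i) \<le> T"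
      using assms i by (auto simp: elementary_def intro: order_trans)
    then have "(\<lambda>\<omega>. W (\<tau> (Suc i)) \<omega> - W (\<tau> i) \<omega>) \<in> borel_measurable M"
      by (intro borel_measurable_diff W_measurable) auto
    then show "(\<lambda>\<omega>. (W (\<tau> (Suc i)) \<omega> - W (\<tau> i) \<omega>) $ k) \<in> borel_measurable M"
      by (rule measurable_compose) (auto intro!: borel_measurable_continuous_onI continuous_intros)
    show "(\<lambda>\<omega>. blinfun_apply (\<xi> i \<omega>) (axis k 1)) \<in> borel_measurable M"
      using \<tau> by (intro measurable_from_subalg[OF subalgebra_M_F elementary_apply_measurable[OF assms(1) i]])
        auto
  qed
  then show ?thesis
    unfolding elementary_integral_def[abs_def]
    by (subst blinfun_apply_axis_sum) (auto intro!: borel_measurable_sum)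
qed

lemma has_ito_integral_iff_energy:
  fixes \<Phi> :: "real \<Rightarrow> 'w \<Rightarrow> ((real^'d) \<Rightarrow>\<^sub>L 'b::{real_inner, banach, second_countable_topology})"
  shows "has_ito_integral M F W t \<Phi> J \<longleftrightarrow>
     (\<forall>z. progressive F t (\<lambda>r \<omega>. blinfun_apply (\<Phi> r \<omega>) z)) \<and>
     (AE \<omega> in M. energy t \<Phi> \<omega> < \<infinity>) \<and>
     J \<in> borel_measurable M \<and>
     (\<exists>m \<tau> \<xi>.
        (\<forall>k. elementary F t (m k) (\<tau> k) (\<xi> k)) \<and>
        (\<forall>\<epsilon>>0. (\<lambda>k. measure M {\<omega> \<in> space M. ennreal \<epsilon> <
           energy t (\<lambda>r \<omega>. elementary_process (m k) (\<tau> k) (\<xi> k) r \<omega> - \<Phi> r \<omega>) \<omega>}) \<longlonglongrightarrow> 0) \<and>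
        (\<forall>\<epsilon>>0. (\<lambda>k. measure M {\<omega> \<in> space M. \<epsilon> <
             norm (elementary_integral W (m k) (\<tau> k) (\<xi> k) \<omega> - J \<omega>)}) \<longlonglongrightarrow> 0))"
  unfolding has_ito_integral_def energy_def ..

text \<open>The elementary approximations of \<open>\<Phi>\<close>, composed with \<open>f\<close>,
  approximate \<open>\<Psi>\<close>: with |f x| \<le> K |x|, energies grow at most by K^2 and
  integrals by K, so both convergences in probability persist. The link between
  \<open>\<Psi>\<close> and \<open>\<Phi>\<close> is asked for on [0,t] only; with \<open>f\<close>
  the identity the lemma thus also exchanges integrands that agree there.\<close>

lemma has_ito_integral_bounded_linear:
  fixes \<Phi> :: "real \<Rightarrow> 'w \<Rightarrow> ((real^'d) \<Rightarrow>\<^sub>L 'b::{real_inner, banach, second_countable_topology})"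
    and \<Psi> :: "real \<Rightarrow> 'w \<Rightarrow> ((real^'d) \<Rightarrow>\<^sub>L 'c::{real_inner, banach, second_countable_topology})"
  assumes J: "has_ito_integral M F W t \<Phi> J" and t: "t \<in> {0..T}" and f: "bounded_linear f"
    and \<Psi>: "\<And>r \<omega> z. r \<in> {0..t} \<Longrightarrow> \<omega> \<in> space M \<Longrightarrow>
      blinfun_apply (\<Psi> r \<omega>) z = f (blinfun_apply (\<Phi> r \<omega>) z)"
  shows "has_ito_integral M F W t \<Psi> (\<lambda>\<omega>. f (J \<omega>))"
proof -
  interpret f: bounded_linear f by (rule f)
  obtain K where K: "0 < K" "\<And>x. norm (f x) \<le> norm x * K" using f.pos_bounded by blast
  have f_meas: "f \<in> borel_measurable borel"
    by (intro borel_measurable_continuous_onI f.continuous_on continuous_on_id)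
  have \<Phi>: "\<And>z. progressive F t (\<lambda>r \<omega>. blinfun_apply (\<Phi> r \<omega>) z)"
    and fin: "AE \<omega> in M. energy t \<Phi> \<omega> < \<infinity>" and Jm: "J \<in> borel_measurable M"
    using J by (auto simp: has_ito_integral_iff_energy)
  obtain m \<tau> \<xi> where el: "\<And>k. elementary F t (m k) (\<tau> k) (\<xi> k)"
    and c1: "\<And>\<epsilon>. \<epsilon> > 0 \<Longrightarrow> (\<lambda>k. measure M {\<omega> \<in> space M. ennreal \<epsilon> <
        energy t (\<lambda>r \<omega>. elementary_process (m k) (\<tau> k) (\<xi> k) r \<omega> - \<Phi> r \<omega>) \<omega>}) \<longlonglongrightarrow> 0"
    and c2: "\<And>\<epsilon>. \<epsilon> > 0 \<Longrightarrow> (\<lambda>k. measure M {\<omega> \<in> space M. \<epsilon> <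
        norm (elementary_integral W (m k) (\<tau> k) (\<xi> k) \<omega> - J \<omega>)}) \<longlonglongrightarrow> 0"
    using J unfolding has_ito_integral_iff_energy by blast
  \<comment> \<open>Composition with \<open>f\<close> keeps the range finite, so these coefficients
    are again simple.\<close>
  define \<xi>' where "\<xi>' k i \<omega> = Blinfun f o\<^sub>L \<xi> k i \<omega>" for k i \<omega>
  have \<xi>'_apply: "blinfun_apply (\<xi>' k i \<omega>) z = f (blinfun_apply (\<xi> k i \<omega>) z)" for k i \<omega> z
    by (simp add: \<xi>'_def bounded_linear_Blinfun_apply[OF f])
  have el': "elementary F t (m k) (\<tau> k) (\<xi>' k)" for k
    using el[of k] unfolding elementary_def \<xi>'_def
    by (auto intro!: simple_function_compose1[where g = "\<lambda>a. Blinfun f o\<^sub>L a"])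
  have proc: "blinfun_apply (elementary_process (m k) (\<tau> k) (\<xi>' k) r \<omega>) z
      = f (blinfun_apply (elementary_process (m k) (\<tau> k) (\<xi> k) r \<omega>) z)" for k r \<omega> z
    by (simp add: elementary_process_def blinfun.sum_left blinfun.scaleR_left \<xi>'_apply
        f.sum f.scale)
  have int: "elementary_integral W (m k) (\<tau> k) (\<xi>' k) \<omega>
      = f (elementary_integral W (m k) (\<tau> k) (\<xi> k) \<omega>)" for k \<omega>
    by (simp add: elementary_integral_def \<xi>'_apply f.sum)
  have hs_le: "hs_norm_sq A' \<le> K\<^sup>2 * hs_norm_sq A"
    if "\<And>z. blinfun_apply A' z = f (blinfun_apply A z)" for A' A
  proof -
    have "(norm (f x))\<^sup>2 \<le> K\<^sup>2 * (norm x)\<^sup>2" for x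
      using power_mono[OF K(2)[of x], of 2] by (simp add: power_mult_distrib mult.commute)
    then show ?thesis
      unfolding hs_norm_sq_def that sum_distrib_left by (intro sum_mono)
  qed
  have jm\<Phi>: "jointly_measurable t \<Phi>"
    using t \<Phi> by (intro jointly_measurable_progressive) auto
  have jm: "jointly_measurable t (\<lambda>r \<omega>. elementary_process (m k) (\<tau> k) (\<xi> k) r \<omega> - \<Phi> r \<omega>)" for k
    by (intro jointly_measurable_diff jointly_measurable_elementary el jm\<Phi>)
  show ?thesis
    unfolding has_ito_integral_iff_energy
  proof (intro conjI allI exI impI)
    show "progressive F t (\<lambda>r \<omega>. blinfun_apply (\<Psi> r \<omega>) z)" for z
      unfolding progressive_def
    proof
      fix u assume u: "u \<in> {0..t}"
      have "(\<lambda>x. f (case x of (r, \<omega>) \<Rightarrow> blinfun_apply (\<Phi> r \<omega>) z))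
          \<in> borel_measurable (restrict_space borel {0..u} \<Otimes>\<^sub>M F u)"
        using \<Phi>[of z] u by (intro measurable_compose[OF _ f_meas]) (auto simp: progressive_def)
      then show "(\<lambda>(r, \<omega>). blinfun_apply (\<Psi> r \<omega>) z)
          \<in> borel_measurable (restrict_space borel {0..u} \<Otimes>\<^sub>M F u)"
        by (rule measurable_cong[THEN iffD1, rotated])
          (use u \<Psi> in \<open>auto simp: space_pair_measure space_restrict_space\<close>)
    qed
    show "AE \<omega> in M. energy t \<Psi> \<omega> < \<infinity>"
      using fin
    proof (rule AE_mp, intro AE_I2 impI)
      fix \<omega> assume \<omega>: "\<omega> \<in> space M" "energy t \<Phi> \<omega> < \<infinity>"
      have "energy t \<Psi> \<omega> \<le> ennreal (K\<^sup>2) * energy t \<Phi> \<omega>"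
        using \<Psi> \<omega> by (intro energy_le jm\<Phi> hs_le) auto
      also have "\<dots> < \<infinity>" using \<omega>(2) by (auto simp: ennreal_mult_less_top)
      finally show "energy t \<Psi> \<omega> < \<infinity>" .
    qed
    show "(\<lambda>\<omega>. f (J \<omega>)) \<in> borel_measurable M"
      using measurable_compose[OF Jm f_meas] .
    show "elementary F t (m k) (\<tau> k) (\<xi>' k)" for k by (rule el')
    fix \<epsilon> :: real assume \<epsilon>: "\<epsilon> > 0"
    show "(\<lambda>k. measure M {\<omega> \<in> space M. ennreal \<epsilon> <
        energy t (\<lambda>r \<omega>. elementary_process (m k) (\<tau> k) (\<xi>' k) r \<omega> - \<Psi> r \<omega>) \<omega>}) \<longlonglongrightarrow> 0"
    \<comment> \<open>An energy above \<epsilon> after applying \<open>f\<close> forces one above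
      \<epsilon> / K^2 before.\<close>
    proof (rule Lim_null_comparison[OF always_eventually c1[of "\<epsilon> / K\<^sup>2"]], intro allI)
      fix k
      define A A' where "A = energy t (\<lambda>r \<omega>. elementary_process (m k) (\<tau> k) (\<xi> k) r \<omega> - \<Phi> r \<omega>)"
        and "A' = energy t (\<lambda>r \<omega>. elementary_process (m k) (\<tau> k) (\<xi>' k) r \<omega> - \<Psi> r \<omega>)"
      have "ennreal (\<epsilon> / K\<^sup>2) < A \<omega>" if \<omega>: "\<omega> \<in> space M" "ennreal \<epsilon> < A' \<omega>" for \<omega>
      proof (rule ccontr)
        assume "\<not> ennreal (\<epsilon> / K\<^sup>2) < A \<omega>"
        then have "ennreal (K\<^sup>2) * A \<omega> \<le> ennreal (K\<^sup>2) * ennreal (\<epsilon> / K\<^sup>2)"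
          by (intro mult_left_mono) auto
        also have "\<dots> = ennreal \<epsilon>" using K \<epsilon> by (simp add: ennreal_mult[symmetric])
        finally have "ennreal (K\<^sup>2) * A \<omega> \<le> ennreal \<epsilon>" .
        moreover have "A' \<omega> \<le> ennreal (K\<^sup>2) * A \<omega>"
          unfolding A_def A'_def using \<omega>(1) \<Psi>
          by (intro energy_le jm hs_le) (auto simp: blinfun.diff_left proc f.diff)
        ultimately show False using \<omega>(2) by (meson leD order_trans)
      qed
      moreover have "A \<in> borel_measurable M"
        unfolding A_def using t by (intro energy_measurable jm) auto
      ultimately have "measure M {\<omega> \<in> space M. ennreal \<epsilon> < A' \<omega>}
          \<le> measure M {\<omega> \<in> space M. ennreal (\<epsilon> / K\<^sup>2) < A \<omega>}"
        by (intro finite_measure_mono) auto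
      then show "norm (measure M {\<omega> \<in> space M. ennreal \<epsilon> <
          energy t (\<lambda>r \<omega>. elementary_process (m k) (\<tau> k) (\<xi>' k) r \<omega> - \<Psi> r \<omega>) \<omega>})
        \<le> measure M {\<omega> \<in> space M. ennreal (\<epsilon> / K\<^sup>2) <
          energy t (\<lambda>r \<omega>. elementary_process (m k) (\<tau> k) (\<xi> k) r \<omega> - \<Phi> r \<omega>) \<omega>}"
        by (simp add: A_def A'_def)
    qed (use \<epsilon> K in auto)
    show "(\<lambda>k. measure M {\<omega> \<in> space M. \<epsilon> <
        norm (elementary_integral W (m k) (\<tau> k) (\<xi>' k) \<omega> - f (J \<omega>))}) \<longlonglongrightarrow> 0"
    proof (rule Lim_null_comparison[OF always_eventually c2[of "\<epsilon> / K"]], intro allI)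
      fix k
      have "elementary_integral W (m k) (\<tau> k) (\<xi> k) \<in> borel_measurable M"
        using t by (intro elementary_integral_measurable[OF el]) auto
      moreover have "\<epsilon> / K < norm x" if "\<epsilon> < norm (f x)" for x
        using that K(2)[of x] K(1) by (simp add: divide_less_eq)
      ultimately have "measure M {\<omega> \<in> space M. \<epsilon> <
          norm (f (elementary_integral W (m k) (\<tau> k) (\<xi> k) \<omega> - J \<omega>))}
        \<le> measure M {\<omega> \<in> space M. \<epsilon> / K <
          norm (elementary_integral W (m k) (\<tau> k) (\<xi> k) \<omega> - J \<omega>)}"
        using Jm by (intro finite_measure_mono) auto
      then show "norm (measure M {\<omega> \<in> space M. \<epsilon> <
          norm (elementary_integral W (m k) (\<tau> k) (\<xi>' k) \<omega> - f (J \<omega>))})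
        \<le> measure M {\<omega> \<in> space M. \<epsilon> / K <
          norm (elementary_integral W (m k) (\<tau> k) (\<xi> k) \<omega> - J \<omega>)}"
        by (simp add: int f.diff)
    qed (use \<epsilon> K in auto)
  qed
qed

lemma AE_zero_if_tail_zero:
  fixes Z :: "'w \<Rightarrow> 'b::{real_normed_vector, second_countable_topology}"
  assumes Z: "Z \<in> borel_measurable M"
    and tail: "\<And>\<epsilon>. \<epsilon> > 0 \<Longrightarrow> measure M {\<omega> \<in> space M. \<epsilon> < norm (Z \<omega>)} = 0"
  shows "AE \<omega> in M. Z \<omega> = 0"
proof -
  have "AE \<omega> in M. \<forall>n. norm (Z \<omega>) \<le> 1 / real (Suc n)"
    unfolding AE_all_countable
  proof
    fix n
    have "AE \<omega> in M. \<not> 1 / real (Suc n) < norm (Z \<omega>)"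
      using tail[of "1 / real (Suc n)"] Z
      by (subst AE_iff_measurable[OF _ refl]) (auto simp: emeasure_eq_measure)
    then show "AE \<omega> in M. norm (Z \<omega>) \<le> 1 / real (Suc n)" by (simp add: not_less)
  qed
  then show ?thesis
  proof eventually_elim
    case (elim \<omega>)
    have "norm (Z \<omega>) \<le> 0"
      by (rule LIMSEQ_le_const[OF LIMSEQ_inverse_real_of_nat])
        (use elim in \<open>auto simp: inverse_eq_divide\<close>)
    then show ?case by simp
  qed
qed

text \<open>With final time 0 all partition times collapse to 0, so every approximating integral
  vanishes identically. This identifies the initial condition in the Volterra case.\<close>

lemma has_ito_integral_0:
  assumes "has_ito_integral M F W 0 \<Phi> J"
  shows "AE \<omega> in M. J \<omega> = 0"
proof (rule AE_zero_if_tail_zero)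
  show "J \<in> borel_measurable M" using assms by (simp add: has_ito_integral_def)
  obtain m \<tau> \<xi> where el: "\<And>k. elementary F 0 (m k) (\<tau> k) (\<xi> k)"
    and c2: "\<And>\<epsilon>. \<epsilon> > 0 \<Longrightarrow> (\<lambda>k. measure M {\<omega> \<in> space M. \<epsilon> <
        norm (elementary_integral W (m k) (\<tau> k) (\<xi> k) \<omega> - J \<omega>)}) \<longlonglongrightarrow> 0"
    using assms unfolding has_ito_integral_def by blast
  have "elementary_integral W (m k) (\<tau> k) (\<xi> k) \<omega> = 0" for k \<omega>
    unfolding elementary_integral_def
  proof (rule sum.neutral, intro ballI)
    fix i assume "i \<in> {..<m k}"
    then have "0 \<le> \<tau> k i \<and> \<tau> k i \<le> \<tau> k (Suc i) \<and> \<tau> k (Suc i) \<le> 0"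
      using el[of k] by (simp add: elementary_def)
    then have "\<tau> k (Suc i) = \<tau> k i" by linarith
    then show "blinfun_apply (\<xi> k i \<omega>) (W (\<tau> k (Suc i)) \<omega> - W (\<tau> k i) \<omega>) = 0"
      by (simp add: blinfun.zero_right)
  qed
  then show "measure M {\<omega> \<in> space M. \<epsilon> < norm (J \<omega>)} = 0" if "\<epsilon> > 0" for \<epsilon>
    using c2[OF that] by (simp add: LIMSEQ_const_iff)
qed

end

section \<open>Uniqueness of the stochastic integral\<close>

text \<open>Brownian increments are specified by their joint density; this extracts one coordinate.
  By Tonelli the integral factors over the basis, and each factor other than the k-th is a total
  mass 1.\<close>

lemma prod_normal_marginal:
  fixes g :: "real \<Rightarrow> ennreal" and k :: "'d::finite"
  assumes \<sigma>: "0 < \<sigma>" and g [measurable]: "g \<in> borel_measurable borel"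
  shows "(\<integral>\<^sup>+z. ennreal (\<Prod>j\<in>UNIV. normal_density 0 \<sigma> ((z::real^'d) $ j)) * g (z $ k) \<partial>lborel)
    = (\<integral>\<^sup>+x. ennreal (normal_density 0 \<sigma> x) * g x \<partial>lborel)"
proof -
  have inj: "inj (\<lambda>j::'d. axis j (1::real))" by (auto simp: inj_on_def axis_eq_axis)
  have Basis: "(Basis :: (real^'d) set) = range (\<lambda>j. axis j 1)" by (auto simp: Basis_vec_def)
  \<comment> \<open>The weight \<open>g\<close> is attached to the k-th coordinate only, which turns
    the integrand into a product of one-dimensional functions.\<close>
  define f where "f b x = ennreal (normal_density 0 \<sigma> x) * (if b = axis k (1::real) then g x else 1)"
    for b x
  have "(\<Prod>b\<in>Basis. f b (z \<bullet> b))
      = ennreal (\<Prod>j\<in>UNIV. normal_density 0 \<sigma> (z $ j)) * g (z $ k)" for z :: "real^'d"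
  proof -
    have "(\<Prod>b\<in>Basis. f b (z \<bullet> b))
        = (\<Prod>j\<in>UNIV. ennreal (normal_density 0 \<sigma> (z $ j))) * (\<Prod>j\<in>UNIV. if j = k then g (z $ j) else 1)"
      unfolding Basis prod.reindex[OF inj] comp_def f_def prod.distrib
      by (simp add: inner_axis axis_eq_axis)
    then show ?thesis by (simp add: prod_ennreal prod.delta)
  qed
  moreover have "f b \<in> borel_measurable borel" for b
    unfolding f_def[abs_def] by (cases "b = axis k 1") simp_all
  ultimately have "(\<integral>\<^sup>+z. ennreal (\<Prod>j\<in>UNIV. normal_density 0 \<sigma> ((z::real^'d) $ j)) * g (z $ k) \<partial>lborel)
      = (\<Prod>b\<in>(Basis :: (real^'d) set). \<integral>\<^sup>+x. f b x \<partial>lborel)"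
    by (subst nn_integral_lborel_prod[symmetric]) auto
  also have "\<dots> = (\<Prod>j\<in>UNIV. if j = k then \<integral>\<^sup>+x. ennreal (normal_density 0 \<sigma> x) * g x \<partial>lborel else 1)"
  proof -
    have "(\<integral>\<^sup>+x. ennreal (normal_density 0 \<sigma> x) \<partial>lborel) = 1"
      using \<sigma> by (subst nn_integral_eq_integral) (auto simp: integrable_normal_density)
    then show ?thesis
      unfolding Basis prod.reindex[OF inj] comp_def f_def
      by (intro prod.cong) (auto simp: axis_eq_axis)
  qed
  also have "\<dots> = (\<integral>\<^sup>+x. ennreal (normal_density 0 \<sigma> x) * g x \<partial>lborel)"
    by (simp add: prod.delta)
  finally show ?thesis .
qed

context brownian
begin

section \<open>Moments of Brownian increments\<close>

definition incr :: "real \<Rightarrow> real \<Rightarrow> 'd \<Rightarrow> 'w \<Rightarrow> real" where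
  "incr s t k \<omega> = (W t \<omega> - W s \<omega>) $ k"

lemma incr_distributed:
  assumes "0 \<le> s" "s < t" "t \<le> T"
  shows "distributed M lborel (incr s t k) (normal_density 0 (sqrt (t - s)))"
proof -
  have D: "distributed M lborel (\<lambda>\<omega>. W t \<omega> - W s \<omega>)
      (\<lambda>z. ennreal (\<Prod>k\<in>UNIV. normal_density 0 (sqrt (t - s)) (z $ k)))"
    using W assms by (auto simp: brownian_motion_def)
  have [measurable]: "(\<lambda>z::real^'d. z $ k) \<in> borel_measurable borel"
    by (intro borel_measurable_continuous_onI continuous_intros)
  have m: "(\<lambda>\<omega>. W t \<omega> - W s \<omega>) \<in> borel_measurable M"
    using distributed_measurable[OF D] by simp
  have [measurable]: "incr s t k \<in> borel_measurable M"
    unfolding incr_def[abs_def] by (rule measurable_compose[OF m]) measurable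
  have "distr M lborel (incr s t k) = density lborel (\<lambda>x. ennreal (normal_density 0 (sqrt (t - s)) x))"
  proof (rule measure_eqI)
    fix A assume "A \<in> sets (distr M lborel (incr s t k))"
    then have A [measurable]: "A \<in> sets borel" by simp
    have "emeasure (distr M lborel (incr s t k)) A = (\<integral>\<^sup>+x. indicator A x \<partial>distr M lborel (incr s t k))"
      by simp
    also have "\<dots> = (\<integral>\<^sup>+\<omega>. indicator A (incr s t k \<omega>) \<partial>M)"
      by (rule nn_integral_distr) measurable
    also have "\<dots> = (\<integral>\<^sup>+z. ennreal (\<Prod>j\<in>UNIV. normal_density 0 (sqrt (t - s)) ((z::real^'d) $ j))
        * indicator A (z $ k) \<partial>lborel)"
      unfolding incr_def by (subst distributed_nn_integral[OF D]) auto
    also have "\<dots> = (\<integral>\<^sup>+x. ennreal (normal_density 0 (sqrt (t - s)) x) * indicator A x \<partial>lborel)"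
      using assms by (intro prod_normal_marginal) auto
    also have "\<dots> = emeasure (density lborel (\<lambda>x. ennreal (normal_density 0 (sqrt (t - s)) x))) A"
      by (subst emeasure_density) auto
    finally show "emeasure (distr M lborel (incr s t k)) A = \<dots>" .
  qed simp
  then show ?thesis by (simp add: distributed_def)
qed

text \<open>Brownian motion is defined through independence of set systems. Restricting to the
  sigma-algebras generated by Z and by h of the increment gives independence of random variables,
  and then expectations factor.\<close>

lemma increment_indep_expectation:
  fixes h :: "real^'d \<Rightarrow> real"
  assumes st: "0 \<le> s" "s < t" "t \<le> T" and Z: "Z \<in> borel_measurable (F s)" "integrable M Z"
    and h: "h \<in> borel_measurable borel" "integrable M (\<lambda>\<omega>. h (W t \<omega> - W s \<omega>))"
  shows "integrable M (\<lambda>\<omega>. Z \<omega> * h (W t \<omega> - W s \<omega>))"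
    "expectation (\<lambda>\<omega>. Z \<omega> * h (W t \<omega> - W s \<omega>))
      = expectation Z * expectation (\<lambda>\<omega>. h (W t \<omega> - W s \<omega>))"
proof -
  let ?I = "\<lambda>\<omega>. W t \<omega> - W s \<omega>"
  have ind: "indep_set (sets (F s)) {?I -` B \<inter> space M | B. B \<in> sets borel}"
    using W st by (auto simp: brownian_motion_def)
  have "sigma_sets (space M) {Z -` A \<inter> space M | A. A \<in> sets borel} \<subseteq> sets (F s)"
    by (rule sets.sigma_sets_subset[of _ "F s", unfolded space_F])
      (use measurable_sets[OF Z(1)] in auto)
  moreover have "sigma_sets (space M) {(\<lambda>\<omega>. h (?I \<omega>)) -` A \<inter> space M | A. A \<in> sets borel}
      \<subseteq> {?I -` B \<inter> space M | B. B \<in> sets borel}"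
  proof -
    \<comment> \<open>Preimages of Borel sets under a single map already form a sigma-algebra, so
      generating one from them adds no sets.\<close>
    have v: "sets (vimage_algebra (space M) ?I borel) = {?I -` B \<inter> space M | B. B \<in> sets borel}"
      by (rule sets_vimage_algebra2) auto
    have "{(\<lambda>\<omega>. h (?I \<omega>)) -` A \<inter> space M | A. A \<in> sets borel}
        \<subseteq> sets (vimage_algebra (space M) ?I borel)"
    proof
      fix S assume "S \<in> {(\<lambda>\<omega>. h (?I \<omega>)) -` A \<inter> space M | A. A \<in> sets borel}"
      then obtain A where A: "A \<in> sets borel" "S = ?I -` (h -` A) \<inter> space M" by auto
      moreover have "h -` A \<in> sets borel" using measurable_sets[OF h(1) A(1)] by simp
      ultimately show "S \<in> sets (vimage_algebra (space M) ?I borel)" unfolding v by blast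
    qed
    then show ?thesis
      using sets.sigma_sets_subset[of _ "vimage_algebra (space M) ?I borel"] unfolding v by auto
  qed
  ultimately have "indep_set
      (sigma_sets (space M) {Z -` A \<inter> space M | A. A \<in> sets borel})
      (sigma_sets (space M) {(\<lambda>\<omega>. h (?I \<omega>)) -` A \<inter> space M | A. A \<in> sets borel})"
    using ind unfolding indep_set_def
    by (elim indep_sets_mono_sets) (auto split: bool.split)
  then have v: "indep_var borel Z borel (\<lambda>\<omega>. h (?I \<omega>))"
    unfolding indep_var_eq using Z(2) h(2) by auto
  show "integrable M (\<lambda>\<omega>. Z \<omega> * h (?I \<omega>))"
    by (rule indep_var_integrable[OF v Z(2) h(2)])
  show "expectation (\<lambda>\<omega>. Z \<omega> * h (?I \<omega>)) = expectation Z * expectation (\<lambda>\<omega>. h (?I \<omega>))"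
    by (rule indep_var_lebesgue_integral[OF v Z(2) h(2)])
qed

text \<open>The martingale and isometry identities with a weight known at time s. The case s = t is
  included because elementary partitions may have empty cells, while an increment has a density only
  for s < t.\<close>

lemma incr_moments:
  assumes st: "0 \<le> s" "s \<le> t" "t \<le> T" and Z: "Z \<in> borel_measurable (F s)" "integrable M Z"
  shows "integrable M (\<lambda>\<omega>. Z \<omega> * incr s t k \<omega>)"
    "expectation (\<lambda>\<omega>. Z \<omega> * incr s t k \<omega>) = 0"
    "integrable M (\<lambda>\<omega>. Z \<omega> * (incr s t k \<omega>)\<^sup>2)"
    "expectation (\<lambda>\<omega>. Z \<omega> * (incr s t k \<omega>)\<^sup>2) = expectation Z * (t - s)"
proof -
  consider "s = t" | "s < t" using st by linarith
  then have "integrable M (\<lambda>\<omega>. Z \<omega> * incr s t k \<omega>) \<and>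
    expectation (\<lambda>\<omega>. Z \<omega> * incr s t k \<omega>) = 0 \<and>
    integrable M (\<lambda>\<omega>. Z \<omega> * (incr s t k \<omega>)\<^sup>2) \<and>
    expectation (\<lambda>\<omega>. Z \<omega> * (incr s t k \<omega>)\<^sup>2) = expectation Z * (t - s)"
  proof cases
    case 1
    then show ?thesis by (simp add: incr_def)
  next
    case 2
    have D: "distributed M lborel (incr s t k) (normal_density 0 (sqrt (t - s)))"
      using st 2 by (intro incr_distributed) auto
    have \<sigma>: "0 < sqrt (t - s)" using 2 by simp
    have i1: "integrable M (incr s t k)"
      using distributed_integrable[OF D, of "\<lambda>x. x"] integrable_normal_moment_nz_1[OF \<sigma>, of 0]
      by simp
    have i2: "integrable M (\<lambda>\<omega>. (incr s t k \<omega>)\<^sup>2)"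
      using distributed_integrable[OF D, of "\<lambda>x. x\<^sup>2"] integrable_normal_moment[OF \<sigma>, of 0 2]
      by simp
    have e1: "expectation (incr s t k) = 0"
      using normal_distributed_expectation[OF \<sigma> D] .
    have e2: "expectation (\<lambda>\<omega>. (incr s t k \<omega>)\<^sup>2) = t - s"
      using normal_distributed_variance[OF \<sigma> D] 2 by (simp add: e1)
    have [measurable]: "(\<lambda>z::real^'d. z $ k) \<in> borel_measurable borel"
      by (intro borel_measurable_continuous_onI continuous_intros)
    note P1 = increment_indep_expectation[OF st(1) 2 st(3) Z, of "\<lambda>z. z $ k"]
    note P2 = increment_indep_expectation[OF st(1) 2 st(3) Z, of "\<lambda>z. (z $ k)\<^sup>2"]
    show ?thesis
      using P1 P2 i1 i2 e1 e2 unfolding incr_def[abs_def] by simp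
  qed
  then show "integrable M (\<lambda>\<omega>. Z \<omega> * incr s t k \<omega>)"
    "expectation (\<lambda>\<omega>. Z \<omega> * incr s t k \<omega>) = 0"
    "integrable M (\<lambda>\<omega>. Z \<omega> * (incr s t k \<omega>)\<^sup>2)"
    "expectation (\<lambda>\<omega>. Z \<omega> * (incr s t k \<omega>)\<^sup>2) = expectation Z * (t - s)"
    by auto
qed

lemma hs_norm_sq_real: "hs_norm_sq (A :: (real^'d) \<Rightarrow>\<^sub>L real) = (\<Sum>k\<in>UNIV. (blinfun_apply A (axis k 1))\<^sup>2)"
  by (simp add: hs_norm_sq_def)

section \<open>The tail bound for elementary integrals\<close>

lemma elementary_times:
  assumes "elementary F t m \<tau> \<xi>" "i < m"
  shows "0 \<le> \<tau> i" "\<tau> i \<le> \<tau> (Suc i)" "\<tau> (Suc i) \<le> t" "simple_function (F (\<tau> i)) (\<xi> i)"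
  using assms by (auto simp: elementary_def)

lemma elementary_times_mono:
  assumes el: "elementary F t m \<tau> \<xi>" and "i \<le> j" "j \<le> m"
  shows "\<tau> i \<le> \<tau> j"
  using assms(2,3)
proof (induction j rule: dec_induct)
  case (step n)
  then show ?case using elementary_times(2)[OF el, of n] by simp
qed simp

text \<open>The half-open cells of a monotone partition are disjoint, so at each time at most one
  summand of the process is active and its squared norm has no cross terms.\<close>

lemma elementary_energy:
  fixes \<xi> :: "nat \<Rightarrow> 'w \<Rightarrow> ((real^'d) \<Rightarrow>\<^sub>L real)"
  assumes el: "elementary F t m \<tau> \<xi>"
  shows "ennreal (\<Sum>i<m. hs_norm_sq (\<xi> i \<omega>) * (\<tau> (Suc i) - \<tau> i))
    \<le> energy t (elementary_process m \<tau> \<xi>) \<omega>"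
proof -
  have "ennreal (\<Sum>i<m. hs_norm_sq (\<xi> i \<omega>) * (\<tau> (Suc i) - \<tau> i))
      = (\<Sum>i<m. ennreal (hs_norm_sq (\<xi> i \<omega>)) * emeasure lborel {\<tau> i<..\<tau> (Suc i)})"
    using elementary_times(2)[OF el]
    by (subst sum_ennreal[symmetric]) (auto simp: ennreal_mult hs_norm_sq_nonneg)
  also have "\<dots> = (\<integral>\<^sup>+r. (\<Sum>i<m. ennreal (hs_norm_sq (\<xi> i \<omega>)) * indicator {\<tau> i<..\<tau> (Suc i)} r) \<partial>lborel)"
    by (subst nn_integral_sum) (auto simp: nn_integral_cmult_indicator)
  also have "\<dots> \<le> energy t (elementary_process m \<tau> \<xi>) \<omega>"
    unfolding energy_def
  proof (rule nn_integral_mono)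
    fix r
    show "(\<Sum>i<m. ennreal (hs_norm_sq (\<xi> i \<omega>)) * indicator {\<tau> i<..\<tau> (Suc i)} r)
      \<le> ennreal (hs_norm_sq (elementary_process m \<tau> \<xi> r \<omega>)) * indicator {0..t} r"
    proof (cases "\<exists>i<m. r \<in> {\<tau> i<..\<tau> (Suc i)}")
      case True
      then obtain i where i: "i < m" "r \<in> {\<tau> i<..\<tau> (Suc i)}" by blast
      have only: "j = i" if "j < m" "\<tau> j < r" "r \<le> \<tau> (Suc j)" for j
      proof (rule ccontr)
        assume "j \<noteq> i"
        then consider "Suc j \<le> i" | "Suc i \<le> j" by linarith
        then show False
          using elementary_times_mono[OF el, of "Suc j" i] elementary_times_mono[OF el, of "Suc i" j] i that
          by cases auto
      qed
      have off: "indicator {\<tau> j<..\<tau> (Suc j)} r = (0::ennreal)"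
        "indicator {\<tau> j<..\<tau> (Suc j)} r = (0::real)" if "j \<in> {..<m} - {i}" for j
        using only[of j] that by (auto simp: indicator_def)
      have 1: "(\<Sum>j<m. ennreal (hs_norm_sq (\<xi> j \<omega>)) * indicator {\<tau> j<..\<tau> (Suc j)} r)
          = ennreal (hs_norm_sq (\<xi> i \<omega>))"
        using i by (subst sum.remove[of _ i]) (simp_all add: off)
      have 2: "elementary_process m \<tau> \<xi> r \<omega> = \<xi> i \<omega>"
        unfolding elementary_process_def using i
        by (subst sum.remove[of _ i]) (simp_all add: off)
      have "r \<in> {0..t}" using elementary_times[OF el i(1)] i(2) by auto
      then show ?thesis by (simp add: 1 2)
    next
      case False
      then have "(\<Sum>i<m. ennreal (hs_norm_sq (\<xi> i \<omega>)) * indicator {\<tau> i<..\<tau> (Suc i)} r) = 0"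
        by (auto simp: indicator_def)
      then show ?thesis by simp
    qed
  qed
  finally show ?thesis .
qed

lemma simple_function_F_mono: "simple_function (F s) f \<Longrightarrow> s \<le> t \<Longrightarrow> simple_function (F t) f"
  using subalgebra_F_F[of s t] by (auto simp: subalgebra_def elim!: simple_function_subalgebra)

lemma elementary_integral_real:
  fixes \<xi> :: "nat \<Rightarrow> 'w \<Rightarrow> ((real^'d) \<Rightarrow>\<^sub>L real)"
  shows "elementary_integral W m \<tau> \<xi> \<omega>
    = (\<Sum>i<m. \<Sum>k\<in>UNIV. blinfun_apply (\<xi> i \<omega>) (axis k 1) * incr (\<tau> i) (\<tau> (Suc i)) k \<omega>)"
  unfolding elementary_integral_def incr_def
  by (subst blinfun_apply_axis_sum) (simp add: mult.commute)

text \<open>Stopping the sum as soon as the accumulated energy exceeds \<open>\<delta>\<close> makes its second moment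
  at most \<open>d \<delta>\<close>; on the event that the total energy is at most \<open>\<delta>\<close> nothing is stopped.  The
  factor \<open>d\<close> comes from bounding \<open>(\<Sum>k. a k)\<^sup>2\<close> by \<open>d (\<Sum>k. (a k)\<^sup>2)\<close>, which avoids the covariances of the
  components of \<open>W\<close>.\<close>

lemma elementary_integral_tail:
  fixes \<xi> :: "nat \<Rightarrow> 'w \<Rightarrow> ((real^'d) \<Rightarrow>\<^sub>L real)" and \<delta> \<epsilon> :: real
  assumes el: "elementary F t m \<tau> \<xi>" and t: "t \<le> T" and \<delta>: "0 < \<delta>" and \<epsilon>: "0 < \<epsilon>"
  shows "measure M {\<omega> \<in> space M. \<epsilon> < \<bar>elementary_integral W m \<tau> \<xi> \<omega>\<bar>}
    \<le> measure M {\<omega> \<in> space M. ennreal \<delta> < energy t (elementary_process m \<tau> \<xi>) \<omega>}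
      + CARD('d) * \<delta> / \<epsilon>\<^sup>2"
proof -
  note times = elementary_times[OF el]
  define q where "q i \<omega> = hs_norm_sq (\<xi> i \<omega>) * (\<tau> (Suc i) - \<tau> i)" for i \<omega>
  have q_nonneg: "0 \<le> q i \<omega>" if "i < m" for i \<omega>
    using times(2)[OF that] by (simp add: q_def hs_norm_sq_nonneg)
  \<comment> \<open>The sum includes the index n itself: the energy of cell n is already known at
    its left end point, so the cell that would overshoot \<delta> is dropped, and the decision
    remains measurable at \<tau> n.\<close>
  define act :: "nat \<Rightarrow> 'w \<Rightarrow> real" where "act n \<omega> = of_bool ((\<Sum>i\<le>n. q i \<omega>) \<le> \<delta>)" for n \<omega>
  define a where "a n k \<omega> = act n \<omega> * blinfun_apply (\<xi> n \<omega>) (axis k 1)" for n k \<omega>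
  define D where "D n \<omega> = (\<Sum>k\<in>UNIV. a n k \<omega> * incr (\<tau> n) (\<tau> (Suc n)) k \<omega>)" for n \<omega>
  define S where "S n \<omega> = (\<Sum>i<n. D i \<omega>)" for n \<omega>
  \<comment> \<open>If cell n is active, the whole energy up to n is at most \<delta>; if not, it
    adds nothing to the previous sum.\<close>
  have actq: "(\<Sum>i<n. act i \<omega> * q i \<omega>) \<le> \<delta>" if "n \<le> m" for n \<omega>
    using that
  proof (induction n)
    case 0
    then show ?case using \<delta> by simp
  next
    case (Suc n)
    show ?case
    proof (cases "(\<Sum>i\<le>n. q i \<omega>) \<le> \<delta>")
      case True
      have "(\<Sum>i<Suc n. act i \<omega> * q i \<omega>) \<le> (\<Sum>i<Suc n. q i \<omega>)"
        using Suc.prems q_nonneg by (intro sum_mono) (auto simp: act_def)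
      then show ?thesis using True by (simp add: lessThan_Suc_atMost)
    next
      case False
      then have "act n \<omega> = 0" by (simp add: act_def)
      then show ?thesis using Suc by simp
    qed
  qed
  have \<xi>_simple: "simple_function (F (\<tau> n)) (\<xi> i)" if "i \<le> n" "n < m" for i n
    using times(4)[of i] elementary_times_mono[OF el, of i n] that
    by (intro simple_function_F_mono[of "\<tau> i" "\<xi> i" "\<tau> n"]) auto
  have a_simple: "simple_function (F (\<tau> n)) (a n k)" if "n < m" for n k
  proof -
    have "simple_function (F (\<tau> n)) (q i)" if "i \<le> n" for i
      using \<xi>_simple[OF that \<open>n < m\<close>] unfolding q_def[abs_def]
      by (rule simple_function_compose1)
    then have "simple_function (F (\<tau> n)) (\<lambda>\<omega>. \<Sum>i\<le>n. q i \<omega>)"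
      by (intro simple_function_sum) simp
    then have "simple_function (F (\<tau> n)) (act n)"
      unfolding act_def[abs_def] by (rule simple_function_compose1)
    moreover have "simple_function (F (\<tau> n)) (\<lambda>\<omega>. blinfun_apply (\<xi> n \<omega>) (axis k 1))"
      using \<xi>_simple[OF order_refl that] by (rule simple_function_compose1)
    ultimately show ?thesis unfolding a_def[abs_def] by (rule simple_function_mult)
  qed
  have a_meas: "a n k \<in> borel_measurable (F (\<tau> n))" if "n < m" for n k
    using a_simple[OF that] by (rule borel_measurable_simple_function)
  \<comment> \<open>Simple coefficients are bounded, so multiplying by them preserves
    integrability.\<close>
  have a_bdd: "\<exists>B. \<forall>\<omega>\<in>space M. \<bar>a n k \<omega>\<bar> \<le> B" if "n < m" for n k
  proof -
    have "finite (a n k ` space M)" using simple_functionD(1)[OF a_simple[OF that]] by simp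
    then have "bounded (a n k ` space M)" by (rule finite_imp_bounded)
    then show ?thesis by (auto simp: bounded_iff)
  qed
  have F_M: "f \<in> borel_measurable (F (\<tau> n)) \<Longrightarrow> f \<in> borel_measurable M" if "n < m" for f :: "'w \<Rightarrow> real" and n
    using times(2,3)[OF that] t
    by (intro measurable_from_subalg[OF subalgebra_M_F[of "\<tau> n"]]) auto
  have int_bdd: "integrable M (\<lambda>\<omega>. Z \<omega> * a n k \<omega>)" if n: "n < m" and Z: "integrable M Z" for Z n k
  proof -
    obtain B where B: "\<And>\<omega>. \<omega> \<in> space M \<Longrightarrow> \<bar>a n k \<omega>\<bar> \<le> B" using a_bdd[OF n] by blast
    show ?thesis
    proof (rule Bochner_Integration.integrable_bound[OF integrable_mult_right[OF Z, of B]])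
      show "(\<lambda>\<omega>. Z \<omega> * a n k \<omega>) \<in> borel_measurable M"
        using F_M[OF n a_meas[OF n]] Z by (intro borel_measurable_times) auto
      show "AE \<omega> in M. norm (Z \<omega> * a n k \<omega>) \<le> norm (B * Z \<omega>)"
      proof (rule AE_I2)
        fix \<omega> assume "\<omega> \<in> space M"
        then have "\<bar>a n k \<omega>\<bar> \<le> \<bar>B\<bar>" using B[of \<omega>] by linarith
        then show "norm (Z \<omega> * a n k \<omega>) \<le> norm (B * Z \<omega>)"
          unfolding real_norm_def abs_mult
          by (metis abs_ge_zero mult.commute mult_left_mono)
      qed
    qed
  qed
  have S_meas: "S n \<in> borel_measurable (F (\<tau> n))" if "n < m" for n
    unfolding S_def[abs_def] D_def incr_def
  proof (intro borel_measurable_sum borel_measurable_times)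
    fix i k assume "i \<in> {..<n}"
    then have i: "Suc i \<le> n" "i < m" using that by auto
    have le: "\<tau> i \<le> \<tau> n" "\<tau> (Suc i) \<le> \<tau> n" using i that elementary_times_mono[OF el] by auto
    show "a i k \<in> borel_measurable (F (\<tau> n))"
      by (rule measurable_from_subalg[OF subalgebra_F_F[OF le(1)] a_meas[OF i(2)]])
    have "(\<lambda>\<omega>. W (\<tau> (Suc i)) \<omega> - W (\<tau> i) \<omega>) \<in> borel_measurable (F (\<tau> n))"
      using times[OF i(2)] le by (intro borel_measurable_diff W_measurable_F) auto
    then show "(\<lambda>\<omega>. (W (\<tau> (Suc i)) \<omega> - W (\<tau> i) \<omega>) $ k) \<in> borel_measurable (F (\<tau> n))"
      by (rule measurable_compose) (auto intro!: borel_measurable_continuous_onI continuous_intros)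
  qed
  \<comment> \<open>Induction over the cells: the cross term has mean 0 because S n and a n k are
    known at \<tau> n, and the squared increment contributes the length of the cell. Integrability
    is carried along because the next expansion needs it.\<close>
  have moment: "integrable M (\<lambda>\<omega>. (S n \<omega>)\<^sup>2) \<and>
      expectation (\<lambda>\<omega>. (S n \<omega>)\<^sup>2) \<le> CARD('d) * expectation (\<lambda>\<omega>. \<Sum>i<n. act i \<omega> * q i \<omega>)
      \<and> integrable M (\<lambda>\<omega>. \<Sum>i<n. act i \<omega> * q i \<omega>)"
    if "n \<le> m" for n
    using that
  proof (induction n)
    case 0
    then show ?case by (simp add: S_def)
  next
    case (Suc n)
    then have n: "n < m" and IH: "integrable M (\<lambda>\<omega>. (S n \<omega>)\<^sup>2)"
      "expectation (\<lambda>\<omega>. (S n \<omega>)\<^sup>2) \<le> CARD('d) * expectation (\<lambda>\<omega>. \<Sum>i<n. act i \<omega> * q i \<omega>)"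
      "integrable M (\<lambda>\<omega>. \<Sum>i<n. act i \<omega> * q i \<omega>)"
      by auto
    let ?s = "\<tau> n" and ?u = "\<tau> (Suc n)"
    have su: "0 \<le> ?s" "?s \<le> ?u" "?u \<le> T" using times(1-3)[OF n] t by auto
    have S_int: "integrable M (S n)"
      by (rule square_integrable_imp_integrable[OF F_M[OF n S_meas[OF n]] IH(1)])
    have aa_int: "integrable M (\<lambda>\<omega>. (a n k \<omega>)\<^sup>2)" for k
      using int_bdd[OF n int_bdd[OF n integrable_const[of 1]], of k k] by (simp add: power2_eq_square)
    note cross = incr_moments(1,2)[OF su borel_measurable_times[OF S_meas[OF n] a_meas[OF n]]
        int_bdd[OF n S_int]]
    note sq = incr_moments(3,4)[OF su borel_measurable_power[OF a_meas[OF n]] aa_int]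
    let ?C = "\<lambda>\<omega>. \<Sum>k\<in>UNIV. S n \<omega> * a n k \<omega> * incr ?s ?u k \<omega>"
    let ?Q = "\<lambda>\<omega>. \<Sum>k\<in>UNIV. (a n k \<omega>)\<^sup>2 * (incr ?s ?u k \<omega>)\<^sup>2"
    have C: "integrable M ?C" "expectation ?C = 0"
      using cross by (auto simp: Bochner_Integration.integral_sum)
    have Q: "integrable M ?Q" "expectation ?Q = expectation (\<lambda>\<omega>. act n \<omega> * q n \<omega>)"
    proof -
      show "integrable M ?Q" using sq(1) by auto
      have "expectation ?Q = (\<Sum>k\<in>UNIV. expectation (\<lambda>\<omega>. (a n k \<omega>)\<^sup>2) * (?u - ?s))"
        using sq by (simp add: Bochner_Integration.integral_sum)
      also have "\<dots> = expectation (\<lambda>\<omega>. (\<Sum>k\<in>UNIV. (a n k \<omega>)\<^sup>2) * (?u - ?s))"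
        using aa_int by (simp add: Bochner_Integration.integral_sum sum_distrib_right)
      also have "(\<lambda>\<omega>. (\<Sum>k\<in>UNIV. (a n k \<omega>)\<^sup>2) * (?u - ?s)) = (\<lambda>\<omega>. act n \<omega> * q n \<omega>)"
        by (auto simp: a_def act_def q_def hs_norm_sq_real fun_eq_iff)
      finally show "expectation ?Q = expectation (\<lambda>\<omega>. act n \<omega> * q n \<omega>)" .
    qed
    have actq_int: "integrable M (\<lambda>\<omega>. act n \<omega> * q n \<omega>)"
    proof -
      have "integrable M (\<lambda>\<omega>. (\<Sum>k\<in>UNIV. (a n k \<omega>)\<^sup>2) * (?u - ?s))" using aa_int by auto
      also have "(\<lambda>\<omega>. (\<Sum>k\<in>UNIV. (a n k \<omega>)\<^sup>2) * (?u - ?s)) = (\<lambda>\<omega>. act n \<omega> * q n \<omega>)"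
        by (auto simp: a_def act_def q_def hs_norm_sq_real fun_eq_iff)
      finally show ?thesis .
    qed
    have le: "(S (Suc n) \<omega>)\<^sup>2 \<le> (S n \<omega>)\<^sup>2 + 2 * ?C \<omega> + CARD('d) * ?Q \<omega>" for \<omega>
    proof -
      have "(D n \<omega>)\<^sup>2 \<le> CARD('d) * ?Q \<omega>"
        unfolding D_def using sum_squared_le_sum_of_squares[where I = "UNIV::'d set" and f = "\<lambda>k. a n k \<omega> * incr ?s ?u k \<omega>"]
        by (simp add: power_mult_distrib mult.commute)
      moreover have "?C \<omega> = S n \<omega> * D n \<omega>"
        by (simp add: D_def sum_distrib_left mult.assoc)
      moreover have "(S (Suc n) \<omega>)\<^sup>2 = (S n \<omega>)\<^sup>2 + 2 * (S n \<omega> * D n \<omega>) + (D n \<omega>)\<^sup>2"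
        by (simp add: S_def power2_eq_square algebra_simps)
      ultimately show ?thesis by simp
    qed
    have B_int: "integrable M (\<lambda>\<omega>. (S n \<omega>)\<^sup>2 + 2 * ?C \<omega> + CARD('d) * ?Q \<omega>)"
      \<comment> \<open>This integrable upper bound is what makes the square of S (Suc n)
        integrable.\<close>
      by (intro Bochner_Integration.integrable_add integrable_mult_right IH(1) C(1) Q(1))
    have D_meas: "D n \<in> borel_measurable M"
      unfolding D_def[abs_def]
    proof (intro borel_measurable_sum)
      fix k
      have "(\<lambda>\<omega>. 1 * a n k \<omega> * incr ?s ?u k \<omega>) \<in> borel_measurable M"
        using incr_moments(1)[OF su a_meas[OF n], of k k] int_bdd[OF n integrable_const[of 1], of k]
        by simp
      then show "(\<lambda>\<omega>. a n k \<omega> * incr ?s ?u k \<omega>) \<in> borel_measurable M" by simp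
    qed
    have "(\<lambda>\<omega>. (S (Suc n) \<omega>)\<^sup>2) \<in> borel_measurable M"
    proof -
      have "S (Suc n) \<omega> = S n \<omega> + D n \<omega>" for \<omega> by (simp add: S_def)
      then show ?thesis using D_meas F_M[OF n S_meas[OF n]] by simp
    qed
    then have int: "integrable M (\<lambda>\<omega>. (S (Suc n) \<omega>)\<^sup>2)"
      using le by (intro Bochner_Integration.integrable_bound[OF B_int]) (auto intro!: AE_I2 order_trans[OF le])
    have "expectation (\<lambda>\<omega>. (S (Suc n) \<omega>)\<^sup>2)
        \<le> expectation (\<lambda>\<omega>. (S n \<omega>)\<^sup>2 + 2 * ?C \<omega> + CARD('d) * ?Q \<omega>)"
      by (rule integral_mono[OF int B_int le])
    also have "\<dots> = expectation (\<lambda>\<omega>. (S n \<omega>)\<^sup>2) + CARD('d) * expectation (\<lambda>\<omega>. act n \<omega> * q n \<omega>)"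
      using IH(1) C Q by (simp add: Bochner_Integration.integral_add)
    also have "\<dots> \<le> CARD('d) * expectation (\<lambda>\<omega>. \<Sum>i<Suc n. act i \<omega> * q i \<omega>)"
      using IH(2,3) actq_int by (simp add: distrib_left)
    finally show ?case using int IH(3) actq_int by simp
  qed
  have "expectation (\<lambda>\<omega>. \<Sum>i<m. act i \<omega> * q i \<omega>) \<le> expectation (\<lambda>\<omega>. \<delta>)"
    using moment[of m] actq[of m] by (intro integral_mono) auto
  then have "CARD('d) * expectation (\<lambda>\<omega>. \<Sum>i<m. act i \<omega> * q i \<omega>) \<le> CARD('d) * \<delta>"
    by (intro mult_left_mono) (auto simp: prob_space)
  then have E: "integrable M (\<lambda>\<omega>. (S m \<omega>)\<^sup>2)" "expectation (\<lambda>\<omega>. (S m \<omega>)\<^sup>2) \<le> CARD('d) * \<delta>"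
    using moment[OF order_refl] by (blast intro: order_trans)+
  have unstopped: "elementary_integral W m \<tau> \<xi> \<omega> = S m \<omega>"
    if "energy t (elementary_process m \<tau> \<xi>) \<omega> \<le> ennreal \<delta>" for \<omega>
  proof -
    have "ennreal (\<Sum>i<m. q i \<omega>) \<le> ennreal \<delta>"
      using elementary_energy[OF el, of \<omega>] that unfolding q_def by (rule order_trans)
    then have le: "(\<Sum>i<m. q i \<omega>) \<le> \<delta>" using \<delta> by (simp add: ennreal_le_iff)
    have "act i \<omega> = 1" if "i < m" for i
    proof -
      have "(\<Sum>i\<le>i. q i \<omega>) \<le> (\<Sum>i<m. q i \<omega>)"
        using that q_nonneg by (intro sum_mono2) auto
      then show ?thesis using le by (simp add: act_def)
    qed
    then show ?thesis by (simp add: elementary_integral_real S_def D_def a_def)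
  qed
  have S_m: "S m \<in> borel_measurable M"
  proof -
    have "(\<lambda>\<omega>. a i k \<omega> * incr (\<tau> i) (\<tau> (Suc i)) k \<omega>) \<in> borel_measurable M" if "i < m" for i k
      using incr_moments(1)[OF _ _ _ a_meas[OF that], of "\<tau> (Suc i)" k k] times[OF that] t
        int_bdd[OF that integrable_const[of 1], of k] by simp
    then show ?thesis unfolding S_def[abs_def] D_def by (intro borel_measurable_sum) auto
  qed
  have en: "energy t (elementary_process m \<tau> \<xi>) \<in> borel_measurable M"
    by (rule energy_measurable[OF jointly_measurable_elementary[OF el] t])
  \<comment> \<open>A large integral whose stopped version is small must have been stopped, which
    means that its energy exceeds \<delta>. The remaining event is covered by Chebyshev's
    inequality.\<close>
  have "ennreal \<delta> < energy t (elementary_process m \<tau> \<xi>) \<omega>"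
    if "\<epsilon> < \<bar>elementary_integral W m \<tau> \<xi> \<omega>\<bar>" "\<not> \<epsilon> \<le> \<bar>S m \<omega>\<bar>" for \<omega>
    using unstopped[of \<omega>] that by (cases "energy t (elementary_process m \<tau> \<xi>) \<omega> \<le> ennreal \<delta>") auto
  then have "measure M {\<omega> \<in> space M. \<epsilon> < \<bar>elementary_integral W m \<tau> \<xi> \<omega>\<bar>}
      \<le> measure M ({\<omega> \<in> space M. ennreal \<delta> < energy t (elementary_process m \<tau> \<xi>) \<omega>}
        \<union> {\<omega> \<in> space M. \<epsilon> \<le> \<bar>S m \<omega>\<bar>})"
    using en S_m by (intro finite_measure_mono) (blast, auto)
  also have "\<dots> \<le> measure M {\<omega> \<in> space M. ennreal \<delta> < energy t (elementary_process m \<tau> \<xi>) \<omega>}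
      + measure M {\<omega> \<in> space M. \<epsilon> \<le> \<bar>S m \<omega>\<bar>}"
    using en S_m by (intro measure_Un_le) auto
  also have "measure M {\<omega> \<in> space M. \<epsilon> \<le> \<bar>S m \<omega>\<bar>} \<le> expectation (\<lambda>\<omega>. (S m \<omega>)\<^sup>2) / \<epsilon>\<^sup>2"
    by (rule second_moment_method[OF S_m E(1) \<epsilon>])
  also have "\<dots> \<le> CARD('d) * \<delta> / \<epsilon>\<^sup>2" using E(2) \<epsilon> by (simp add: divide_right_mono)
  finally show ?thesis by simp
qed

section \<open>Common refinement of elementary integrands\<close>

text \<open>The weights pick the grid cells between a and b; strict monotonicity of p translates
  comparisons of grid points into comparisons of indices. With f a Brownian path it serves the
  integral, with f built from indicators of rays it serves the process.\<close>

lemma telescope_grid: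
  fixes f :: "real \<Rightarrow> 'v::real_vector"
  assumes p: "strict_mono_on {..N::nat} p" and ab: "a \<in> p ` {..N}" "b \<in> p ` {..N}" "a \<le> b"
  shows "(\<Sum>j<N. of_bool (a \<le> p j \<and> p j < b) *\<^sub>R (f (p (Suc j)) - f (p j))) = f b - f a"
proof -
  obtain x y where xy': "x \<le> N" "y \<le> N" "a = p x" "b = p y" using ab by auto
  have xy: "x \<le> y" "y \<le> N"
    using strict_mono_onD[OF p, of y x] xy' ab(3) by (auto simp: not_less[symmetric])
  have "(\<Sum>j<N. of_bool (p x \<le> p j \<and> p j < p y) *\<^sub>R (f (p (Suc j)) - f (p j)))
      = (\<Sum>j\<in>{x..<y}. f (p (Suc j)) - f (p j))"
  proof (rule sum.mono_neutral_cong_right)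
    have iff: "p x \<le> p j \<and> p j < p y \<longleftrightarrow> x \<le> j \<and> j < y" if "j < N" for j
      using strict_mono_onD[OF p, of x j] strict_mono_onD[OF p, of j x]
        strict_mono_onD[OF p, of j y] strict_mono_onD[OF p, of y j] xy that
      by (cases "x = j"; cases "j = y") (auto simp: not_less not_le, (force simp: linorder_neq_iff)+)
    show "\<forall>j\<in>{..<N} - {x..<y}. of_bool (p x \<le> p j \<and> p j < p y) *\<^sub>R (f (p (Suc j)) - f (p j)) = 0"
      using iff by auto
    show "of_bool (p x \<le> p j \<and> p j < p y) *\<^sub>R (f (p (Suc j)) - f (p j)) = f (p (Suc j)) - f (p j)"
      if "j \<in> {x..<y}" for j
      using iff[of j] that xy by auto
  qed (use xy in auto)
  also have "\<dots> = f (p y) - f (p x)"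
    using sum_Suc_diff'[OF xy(1), of "\<lambda>j. f (p j)"] .
  finally show ?thesis by (simp add: xy')
qed

text \<open>The values of an elementary process on a finer partition \<open>p\<close>.\<close>

definition refined ::
  "(nat \<Rightarrow> real) \<Rightarrow> nat \<Rightarrow> (nat \<Rightarrow> real) \<Rightarrow> (nat \<Rightarrow> 'w \<Rightarrow> ((real^'d) \<Rightarrow>\<^sub>L 'b::real_normed_vector))
    \<Rightarrow> nat \<Rightarrow> 'w \<Rightarrow> ((real^'d) \<Rightarrow>\<^sub>L 'b)" where
  "refined p m \<tau> \<xi> j \<omega> = (\<Sum>i<m. of_bool (\<tau> i \<le> p j \<and> p j < \<tau> (Suc i)) *\<^sub>R \<xi> i \<omega>)"

text \<open>After exchanging the sums over old and new cells, the new cells inside each old cell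
  telescope to it.\<close>

lemma refined_properties:
  fixes \<xi> :: "nat \<Rightarrow> 'w \<Rightarrow> ((real^'d) \<Rightarrow>\<^sub>L 'b::real_normed_vector)"
  assumes el: "elementary F t m \<tau> \<xi>" and p: "strict_mono_on {..N} p"
    and points: "\<And>i. i < m \<Longrightarrow> \<tau> i \<in> p ` {..N} \<and> \<tau> (Suc i) \<in> p ` {..N}"
  shows "simple_function (F (p j)) (refined p m \<tau> \<xi> j)"
    "elementary_process N p (refined p m \<tau> \<xi>) r \<omega> = elementary_process m \<tau> \<xi> r \<omega>"
    "elementary_integral W N p (refined p m \<tau> \<xi>) \<omega> = elementary_integral W m \<tau> \<xi> \<omega>"
proof -
  have tele: "i < m \<Longrightarrow> (\<Sum>j<N. of_bool (\<tau> i \<le> p j \<and> p j < \<tau> (Suc i)) * (f (p (Suc j)) - f (p j)))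
      = f (\<tau> (Suc i)) - f (\<tau> i)" for i and f :: "real \<Rightarrow> real"
    using telescope_grid[OF p, of "\<tau> i" "\<tau> (Suc i)" f] points elementary_times(2)[OF el] by simp
  have teleW: "i < m \<Longrightarrow> (\<Sum>j<N. of_bool (\<tau> i \<le> p j \<and> p j < \<tau> (Suc i)) *\<^sub>R (W (p (Suc j)) \<omega> - W (p j) \<omega>))
      = W (\<tau> (Suc i)) \<omega> - W (\<tau> i) \<omega>" for i
    using telescope_grid[OF p, of "\<tau> i" "\<tau> (Suc i)" "\<lambda>u. W u \<omega>"] points elementary_times(2)[OF el]
    by simp
  \<comment> \<open>If \<tau> i comes after p j, then \<xi> i need not be known at p j, but its
    weight is 0.\<close>
  have "simple_function (F (p j)) (\<lambda>\<omega>. of_bool (\<tau> i \<le> p j \<and> p j < \<tau> (Suc i)) *\<^sub>R \<xi> i \<omega>)"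
    if "i < m" for i
  proof (cases "\<tau> i \<le> p j")
    case True
    then have "simple_function (F (p j)) (\<xi> i)"
      by (rule simple_function_F_mono[OF elementary_times(4)[OF el that]])
    then show ?thesis by (rule simple_function_compose1)
  qed simp
  then show "simple_function (F (p j)) (refined p m \<tau> \<xi> j)"
    unfolding refined_def[abs_def] by (intro simple_function_sum) simp
  have "elementary_process N p (refined p m \<tau> \<xi>) r \<omega>
      = (\<Sum>i<m. (\<Sum>j<N. of_bool (\<tau> i \<le> p j \<and> p j < \<tau> (Suc i)) *\<^sub>R indicator {p j<..p (Suc j)} r) *\<^sub>R \<xi> i \<omega>)"
    unfolding elementary_process_def refined_def scaleR_sum_right scaleR_sum_left
    by (subst sum.swap) (simp add: mult.commute)
  also have "\<dots> = (\<Sum>i<m. indicator {\<tau> i<..\<tau> (Suc i)} r *\<^sub>R \<xi> i \<omega>)"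
  proof (intro sum.cong refl arg_cong2[where f = scaleR])
    fix i assume "i \<in> {..<m}"
    then have i: "i < m" by simp
    \<comment> \<open>Writing a half-open cell as a difference of rays makes the indicator an
      increment in its end points, the form to which telescoping applies.\<close>
    have ind: "(indicator {a<..b} r :: real) = - indicator {b<..} r - - indicator {a<..} r" if "a \<le> b"
      for a b :: real
      using that by (auto simp: indicator_def)
    have pj: "p j \<le> p (Suc j)" if "j < N" for j
      using p that by (auto simp: strict_mono_on_def intro: less_imp_le)
    show "(\<Sum>j<N. of_bool (\<tau> i \<le> p j \<and> p j < \<tau> (Suc i)) *\<^sub>R indicator {p j<..p (Suc j)} r)
        = (indicator {\<tau> i<..\<tau> (Suc i)} r :: real)"
      unfolding ind[OF elementary_times(2)[OF el i]] tele[OF i, of "\<lambda>u. - indicator {u<..} r", symmetric]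
      by (intro sum.cong refl) (simp add: ind[OF pj])
  qed
  finally show "elementary_process N p (refined p m \<tau> \<xi>) r \<omega> = elementary_process m \<tau> \<xi> r \<omega>"
    by (simp add: elementary_process_def)
  have "elementary_integral W N p (refined p m \<tau> \<xi>) \<omega>
      = (\<Sum>i<m. blinfun_apply (\<xi> i \<omega>)
          (\<Sum>j<N. of_bool (\<tau> i \<le> p j \<and> p j < \<tau> (Suc i)) *\<^sub>R (W (p (Suc j)) \<omega> - W (p j) \<omega>)))"
    unfolding elementary_integral_def refined_def blinfun.sum_right blinfun.sum_left
    by (subst sum.swap) (simp add: blinfun.scaleR_left blinfun.scaleR_right)
  also have "\<dots> = elementary_integral W m \<tau> \<xi> \<omega>"
    unfolding elementary_integral_def
    using teleW by (intro sum.cong refl) simp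
  finally show "elementary_integral W N p (refined p m \<tau> \<xi>) \<omega> = elementary_integral W m \<tau> \<xi> \<omega>" .
qed

text \<open>The tail bound concerns one elementary integrand, whereas two approximations come with
  unrelated partitions. Both are refined to the union of their end points.\<close>

lemma elementary_diff:
  fixes \<xi> \<xi>' :: "nat \<Rightarrow> 'w \<Rightarrow> ((real^'d) \<Rightarrow>\<^sub>L 'b::real_normed_vector)"
  assumes el: "elementary F t m \<tau> \<xi>" and el': "elementary F t m' \<tau>' \<xi>'"
  obtains N p \<eta> where "elementary F t N p \<eta>"
    "\<And>r \<omega>. elementary_process N p \<eta> r \<omega> = elementary_process m \<tau> \<xi> r \<omega> - elementary_process m' \<tau>' \<xi>' r \<omega>"
    "\<And>\<omega>. elementary_integral W N p \<eta> \<omega> = elementary_integral W m \<tau> \<xi> \<omega> - elementary_integral W m' \<tau>' \<xi>' \<omega>"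
proof -
  define P where "P = (\<Union>i<m. {\<tau> i, \<tau> (Suc i)}) \<union> (\<Union>i<m'. {\<tau>' i, \<tau>' (Suc i)})"
  have P: "finite P" "P \<subseteq> {0..t}"
    using elementary_times(1-3)[OF el] elementary_times(1-3)[OF el']
    by (force simp: P_def)+
  define L where "L = sorted_list_of_set P"
  \<comment> \<open>There is one cell fewer than points. Without any points natural subtraction
    gives N = 0, that is, no cells.\<close>
  define N where "N = card P - 1"
  define p where "p j = L ! j" for j
  have L: "set L = P" "length L = card P" "sorted_wrt (<) L"
    using P by (auto simp: L_def)
  have sm: "strict_mono_on {..N} p" if "P \<noteq> {}"
  proof (rule strict_mono_onI)
    fix i j assume "i \<in> {..N}" "j \<in> {..N}" "i < j"
    moreover have "0 < card P" using that P by (simp add: card_gt_0_iff)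
    ultimately have "j < length L" by (auto simp: N_def L)
    then show "p i < p j" unfolding p_def using L(3) \<open>i < j\<close> by (simp add: sorted_wrt_nth_less)
  qed
  have sm': "strict_mono_on {..N} p"
  proof (cases "P = {}")
    case True
    then show ?thesis by (auto simp: N_def strict_mono_on_def)
  qed (rule sm)
  have img: "x \<in> p ` {..N}" if x: "x \<in> P" for x
  proof -
    obtain j where "j < length L" "L ! j = x" using x L(1) in_set_conv_nth[of x L] by auto
    then show ?thesis by (auto simp: p_def N_def L intro!: image_eqI[of _ _ j])
  qed
  have points: "\<tau> i \<in> p ` {..N} \<and> \<tau> (Suc i) \<in> p ` {..N}" if "i < m" for i
    using that by (intro conjI img) (auto simp: P_def)
  have points': "\<tau>' i \<in> p ` {..N} \<and> \<tau>' (Suc i) \<in> p ` {..N}" if "i < m'" for i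
    using that by (intro conjI img) (auto simp: P_def)
  note R = refined_properties[OF el sm' points] and R' = refined_properties[OF el' sm' points']
  define \<eta> where "\<eta> j \<omega> = refined p m \<tau> \<xi> j \<omega> - refined p m' \<tau>' \<xi>' j \<omega>" for j \<omega>
  show thesis
  proof
    have "simple_function (F (p j)) (\<eta> j)" for j
      unfolding \<eta>_def[abs_def] by (intro simple_function_diff R(1) R'(1))
    moreover have "p j \<in> {0..t}" if "j \<le> N" "0 < N" for j
    proof -
      have "p j \<in> set L" unfolding p_def using that by (intro nth_mem) (auto simp: N_def L)
      then show ?thesis using P L by blast
    qed
    moreover have "p j \<le> p (Suc j)" if "j < N" for j
      using sm' that by (auto simp: strict_mono_on_def intro: less_imp_le)
    ultimately show "elementary F t N p \<eta>"
      unfolding elementary_def by (auto simp: Suc_le_eq)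
    show "elementary_process N p \<eta> r \<omega>
        = elementary_process m \<tau> \<xi> r \<omega> - elementary_process m' \<tau>' \<xi>' r \<omega>" for r \<omega>
    proof -
      have "elementary_process N p \<eta> r \<omega> = elementary_process N p (refined p m \<tau> \<xi>) r \<omega>
          - elementary_process N p (refined p m' \<tau>' \<xi>') r \<omega>"
        by (simp add: elementary_process_def \<eta>_def scaleR_diff_right sum_subtractf)
      then show ?thesis by (simp only: R(2) R'(2))
    qed
    show "elementary_integral W N p \<eta> \<omega>
        = elementary_integral W m \<tau> \<xi> \<omega> - elementary_integral W m' \<tau>' \<xi>' \<omega>" for \<omega>
    proof -
      have "elementary_integral W N p \<eta> \<omega> = elementary_integral W N p (refined p m \<tau> \<xi>) \<omega>
          - elementary_integral W N p (refined p m' \<tau>' \<xi>') \<omega>"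
        by (simp add: elementary_integral_def \<eta>_def blinfun.diff_left sum_subtractf)
      then show ?thesis by (simp only: R(3) R'(3))
    qed
  qed
qed

text \<open>Used with C the limiting integrand: approximations close to it are close to each other.
  The 2 comes from (a + b)^2 \<le> 2 (a^2 + b^2).\<close>

lemma hs_norm_sq_triangle:
  "hs_norm_sq (A - B) \<le> 2 * (hs_norm_sq (A - C) + hs_norm_sq (B - C))"
  for A B C :: "(real^'d) \<Rightarrow>\<^sub>L 'b::real_normed_vector"
proof -
  have "(norm (x - y))\<^sup>2 \<le> 2 * ((norm (x - z))\<^sup>2 + (norm (y - z))\<^sup>2)" for x y z :: 'b
  proof -
    have "norm (x - y) \<le> norm (x - z) + norm (y - z)"
      using norm_triangle_ineq4[of "x - z" "y - z"] by simp
    then have "(norm (x - y))\<^sup>2 \<le> (norm (x - z) + norm (y - z))\<^sup>2" by (intro power_mono) auto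
    also have "\<dots> \<le> 2 * ((norm (x - z))\<^sup>2 + (norm (y - z))\<^sup>2)"
      using sum_squares_bound[of "norm (x - z)" "norm (y - z)"] by (simp add: power2_sum)
    finally show ?thesis .
  qed
  then show ?thesis
    unfolding hs_norm_sq_def blinfun.diff_left sum.distrib[symmetric] sum_distrib_left
    by (intro sum_mono)
qed

text \<open>The difference of two approximating sequences is elementary and its energy tends to 0 in
  probability; the tail bound then makes the difference of their integrals small in
  probability.\<close>

lemma has_ito_integral_unique_real:
  fixes \<Phi> :: "real \<Rightarrow> 'w \<Rightarrow> ((real^'d) \<Rightarrow>\<^sub>L real)"
  assumes t: "t \<in> {0..T}" and J: "has_ito_integral M F W t \<Phi> J" and J': "has_ito_integral M F W t \<Phi> J'"
  shows "AE \<omega> in M. J \<omega> = J' \<omega>"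
proof -
  have \<Phi>: "jointly_measurable t \<Phi>" and Jm: "J \<in> borel_measurable M" "J' \<in> borel_measurable M"
    using J J' t by (auto simp: has_ito_integral_def intro!: jointly_measurable_progressive)
  obtain m \<tau> \<xi> where el: "\<And>k. elementary F t (m k) (\<tau> k) (\<xi> k)"
    and c1: "\<And>\<epsilon>. \<epsilon> > 0 \<Longrightarrow> (\<lambda>k. measure M {\<omega> \<in> space M. ennreal \<epsilon> <
        energy t (\<lambda>r \<omega>. elementary_process (m k) (\<tau> k) (\<xi> k) r \<omega> - \<Phi> r \<omega>) \<omega>}) \<longlonglongrightarrow> 0"
    and c2: "\<And>\<epsilon>. \<epsilon> > 0 \<Longrightarrow> (\<lambda>k. measure M {\<omega> \<in> space M. \<epsilon> <
        norm (elementary_integral W (m k) (\<tau> k) (\<xi> k) \<omega> - J \<omega>)}) \<longlonglongrightarrow> 0"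
    using J unfolding has_ito_integral_iff_energy by blast
  obtain m' \<tau>' \<xi>' where el': "\<And>k. elementary F t (m' k) (\<tau>' k) (\<xi>' k)"
    and c1': "\<And>\<epsilon>. \<epsilon> > 0 \<Longrightarrow> (\<lambda>k. measure M {\<omega> \<in> space M. ennreal \<epsilon> <
        energy t (\<lambda>r \<omega>. elementary_process (m' k) (\<tau>' k) (\<xi>' k) r \<omega> - \<Phi> r \<omega>) \<omega>}) \<longlonglongrightarrow> 0"
    and c2': "\<And>\<epsilon>. \<epsilon> > 0 \<Longrightarrow> (\<lambda>k. measure M {\<omega> \<in> space M. \<epsilon> <
        norm (elementary_integral W (m' k) (\<tau>' k) (\<xi>' k) \<omega> - J' \<omega>)}) \<longlonglongrightarrow> 0"
    using J' unfolding has_ito_integral_iff_energy by blast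
  define EI where "EI k = elementary_integral W (m k) (\<tau> k) (\<xi> k)" for k
  define EI' where "EI' k = elementary_integral W (m' k) (\<tau>' k) (\<xi>' k)" for k
  define en where "en k = energy t (\<lambda>r \<omega>. elementary_process (m k) (\<tau> k) (\<xi> k) r \<omega> - \<Phi> r \<omega>)" for k
  define en' where "en' k = energy t (\<lambda>r \<omega>. elementary_process (m' k) (\<tau>' k) (\<xi>' k) r \<omega> - \<Phi> r \<omega>)" for k
  have jm: "jointly_measurable t (\<lambda>r \<omega>. elementary_process (m k) (\<tau> k) (\<xi> k) r \<omega> - \<Phi> r \<omega>)"
    "jointly_measurable t (\<lambda>r \<omega>. elementary_process (m' k) (\<tau>' k) (\<xi>' k) r \<omega> - \<Phi> r \<omega>)" for k
    by (intro jointly_measurable_diff jointly_measurable_elementary el el' \<Phi>)+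
  have meas [measurable]: "EI k \<in> borel_measurable M" "EI' k \<in> borel_measurable M"
    "en k \<in> borel_measurable M" "en' k \<in> borel_measurable M" for k
    using t unfolding EI_def EI'_def en_def en'_def
    by (auto intro!: elementary_integral_measurable[OF el] elementary_integral_measurable[OF el']
        energy_measurable jm)
  note Jm [measurable]
  \<comment> \<open>The difference of J and J' splits into three parts of size \<epsilon>: two
    approximation errors and one elementary integral. Energies of at most \<delta> each give at most
    2 (\<delta> + \<delta>) for the latter, and only its tail term survives as k grows.\<close>
  have tail: "measure M {\<omega> \<in> space M. 3 * \<epsilon> < \<bar>J \<omega> - J' \<omega>\<bar>} \<le> CARD('d) * (4 * \<delta>) / \<epsilon>\<^sup>2"
    if \<epsilon>: "0 < \<epsilon>" and \<delta>: "0 < \<delta>" for \<epsilon> \<delta> :: real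
  proof (rule LIMSEQ_le_const)
    have "measure M {\<omega> \<in> space M. 3 * \<epsilon> < \<bar>J \<omega> - J' \<omega>\<bar>}
      \<le> (measure M {\<omega> \<in> space M. \<epsilon> < norm (EI k \<omega> - J \<omega>)} + measure M {\<omega> \<in> space M. \<epsilon> < norm (EI' k \<omega> - J' \<omega>)})
        + ((measure M {\<omega> \<in> space M. ennreal \<delta> < en k \<omega>} + measure M {\<omega> \<in> space M. ennreal \<delta> < en' k \<omega>})
        + CARD('d) * (4 * \<delta>) / \<epsilon>\<^sup>2)" for k
    proof -
      obtain N p \<eta> where \<eta>: "elementary F t N p \<eta>"
        "\<And>r \<omega>. elementary_process N p \<eta> r \<omega>
          = elementary_process (m k) (\<tau> k) (\<xi> k) r \<omega> - elementary_process (m' k) (\<tau>' k) (\<xi>' k) r \<omega>"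
        "\<And>\<omega>. elementary_integral W N p \<eta> \<omega> = EI k \<omega> - EI' k \<omega>"
        unfolding EI_def EI'_def using elementary_diff[OF el el'] by blast
      have [measurable]: "elementary_integral W N p \<eta> \<in> borel_measurable M"
        using t by (intro elementary_integral_measurable[OF \<eta>(1)]) auto
      have "energy t (elementary_process N p \<eta>) \<omega> \<le> ennreal 2 * (en k \<omega> + en' k \<omega>)"
        if "\<omega> \<in> space M" for \<omega>
        unfolding en_def en'_def using that
        by (intro energy_le_add jm)
          (simp_all add: \<eta>(2) hs_norm_sq_triangle del: distrib_left_numeral)
      moreover have "ennreal 2 * (a + b) \<le> ennreal (4 * \<delta>)" if "a \<le> ennreal \<delta>" "b \<le> ennreal \<delta>" for a b
      proof -
        have "ennreal 2 * (a + b) \<le> ennreal 2 * (ennreal \<delta> + ennreal \<delta>)"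
          using that by (intro mult_left_mono add_mono) auto
        also have "\<dots> = ennreal (4 * \<delta>)"
          using \<delta> by (simp add: ennreal_plus[symmetric] ennreal_mult[symmetric] del: ennreal_plus ennreal_numeral)
        finally show ?thesis .
      qed
      ultimately have en_le: "ennreal \<delta> < en k \<omega> \<or> ennreal \<delta> < en' k \<omega>"
        if "\<omega> \<in> space M" "ennreal (4 * \<delta>) < energy t (elementary_process N p \<eta>) \<omega>" for \<omega>
        using that by (meson leD le_less_linear order_trans)
      have "measure M {\<omega> \<in> space M. 3 * \<epsilon> < \<bar>J \<omega> - J' \<omega>\<bar>}
        \<le> measure M (({\<omega> \<in> space M. \<epsilon> < norm (EI k \<omega> - J \<omega>)} \<union> {\<omega> \<in> space M. \<epsilon> < norm (EI' k \<omega> - J' \<omega>)})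
          \<union> {\<omega> \<in> space M. \<epsilon> < \<bar>elementary_integral W N p \<eta> \<omega>\<bar>})"
        by (rule finite_measure_mono) (auto simp: \<eta>(3))
      also have "\<dots> \<le> measure M ({\<omega> \<in> space M. \<epsilon> < norm (EI k \<omega> - J \<omega>)} \<union> {\<omega> \<in> space M. \<epsilon> < norm (EI' k \<omega> - J' \<omega>)})
          + measure M {\<omega> \<in> space M. \<epsilon> < \<bar>elementary_integral W N p \<eta> \<omega>\<bar>}"
        by (rule measure_Un_le) measurable
      also have "measure M ({\<omega> \<in> space M. \<epsilon> < norm (EI k \<omega> - J \<omega>)} \<union> {\<omega> \<in> space M. \<epsilon> < norm (EI' k \<omega> - J' \<omega>)})
          \<le> measure M {\<omega> \<in> space M. \<epsilon> < norm (EI k \<omega> - J \<omega>)} + measure M {\<omega> \<in> space M. \<epsilon> < norm (EI' k \<omega> - J' \<omega>)}"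
        by (rule measure_Un_le) measurable
      also have "measure M {\<omega> \<in> space M. \<epsilon> < \<bar>elementary_integral W N p \<eta> \<omega>\<bar>}
          \<le> measure M {\<omega> \<in> space M. ennreal (4 * \<delta>) < energy t (elementary_process N p \<eta>) \<omega>}
            + CARD('d) * (4 * \<delta>) / \<epsilon>\<^sup>2"
        using t \<epsilon> \<delta> by (intro elementary_integral_tail[OF \<eta>(1)]) auto
      also have "measure M {\<omega> \<in> space M. ennreal (4 * \<delta>) < energy t (elementary_process N p \<eta>) \<omega>}
          \<le> measure M ({\<omega> \<in> space M. ennreal \<delta> < en k \<omega>} \<union> {\<omega> \<in> space M. ennreal \<delta> < en' k \<omega>})"
        using en_le by (intro finite_measure_mono) auto
      also have "\<dots> \<le> measure M {\<omega> \<in> space M. ennreal \<delta> < en k \<omega>} + measure M {\<omega> \<in> space M. ennreal \<delta> < en' k \<omega>}"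
        by (rule measure_Un_le) measurable
      finally show ?thesis by simp
    qed
    then show "\<exists>N. \<forall>k\<ge>N. measure M {\<omega> \<in> space M. 3 * \<epsilon> < \<bar>J \<omega> - J' \<omega>\<bar>}
      \<le> (measure M {\<omega> \<in> space M. \<epsilon> < norm (EI k \<omega> - J \<omega>)} + measure M {\<omega> \<in> space M. \<epsilon> < norm (EI' k \<omega> - J' \<omega>)})
        + ((measure M {\<omega> \<in> space M. ennreal \<delta> < en k \<omega>} + measure M {\<omega> \<in> space M. ennreal \<delta> < en' k \<omega>})
        + CARD('d) * (4 * \<delta>) / \<epsilon>\<^sup>2)" by blast
    have "(\<lambda>k. (measure M {\<omega> \<in> space M. \<epsilon> < norm (EI k \<omega> - J \<omega>)} + measure M {\<omega> \<in> space M. \<epsilon> < norm (EI' k \<omega> - J' \<omega>)})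
        + ((measure M {\<omega> \<in> space M. ennreal \<delta> < en k \<omega>} + measure M {\<omega> \<in> space M. ennreal \<delta> < en' k \<omega>})
        + CARD('d) * (4 * \<delta>) / \<epsilon>\<^sup>2)) \<longlonglongrightarrow> (0 + 0) + ((0 + 0) + CARD('d) * (4 * \<delta>) / \<epsilon>\<^sup>2)"
      unfolding EI_def EI'_def en_def en'_def
      by (intro tendsto_add tendsto_const c1 c2 c1' c2' \<epsilon> \<delta>)
    then show "(\<lambda>k. (measure M {\<omega> \<in> space M. \<epsilon> < norm (EI k \<omega> - J \<omega>)} + measure M {\<omega> \<in> space M. \<epsilon> < norm (EI' k \<omega> - J' \<omega>)})
        + ((measure M {\<omega> \<in> space M. ennreal \<delta> < en k \<omega>} + measure M {\<omega> \<in> space M. ennreal \<delta> < en' k \<omega>})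
        + CARD('d) * (4 * \<delta>) / \<epsilon>\<^sup>2)) \<longlonglongrightarrow> CARD('d) * (4 * \<delta>) / \<epsilon>\<^sup>2" by simp
  qed
  have "AE \<omega> in M. J \<omega> - J' \<omega> = 0"
  proof (rule AE_zero_if_tail_zero)
    fix \<epsilon> :: real assume \<epsilon>: "0 < \<epsilon>"
    define c where "c = measure M {\<omega> \<in> space M. \<epsilon> < norm (J \<omega> - J' \<omega>)}"
    have "c \<le> 0"
    proof (rule field_le_epsilon)
      fix e :: real assume e: "0 < e"
      \<comment> \<open>Solves the tail bound at threshold \<epsilon> / 3 for the prescribed value
        e.\<close>
      define \<delta> where "\<delta> = e * (\<epsilon> / 3)\<^sup>2 / (4 * CARD('d))"
      have "0 < \<delta>" using e \<epsilon> by (simp add: \<delta>_def)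
      then have "c \<le> CARD('d) * (4 * \<delta>) / (\<epsilon> / 3)\<^sup>2"
        using tail[of "\<epsilon> / 3" \<delta>] \<epsilon> by (simp add: c_def)
      also have "\<dots> = e" using \<epsilon> by (simp add: \<delta>_def)
      finally show "c \<le> 0 + e" by simp
    qed
    then show "measure M {\<omega> \<in> space M. \<epsilon> < norm (J \<omega> - J' \<omega>)} = 0"
      using measure_nonneg[of M] unfolding c_def by (meson antisym)
  qed measurable
  then show ?thesis by simp
qed

lemma has_ito_integral_unique:
  fixes \<Phi> :: "real \<Rightarrow> 'w \<Rightarrow> ((real^'d) \<Rightarrow>\<^sub>L (real^'n))"
  assumes t: "t \<in> {0..T}" and J: "has_ito_integral M F W t \<Phi> J" and J': "has_ito_integral M F W t \<Phi> J'"
  shows "AE \<omega> in M. J \<omega> = J' \<omega>"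
proof -
  have "AE \<omega> in M. J \<omega> $ k = J' \<omega> $ k" for k
  proof (rule has_ito_integral_unique_real[OF t])
    have bl: "bounded_linear (\<lambda>x::real^'n. x $ k)" by (rule bounded_linear_vec_nth)
    define \<Psi> where "\<Psi> r \<omega> = Blinfun (\<lambda>x::real^'n. x $ k) o\<^sub>L \<Phi> r \<omega>" for r \<omega>
    have \<Psi>: "blinfun_apply (\<Psi> r \<omega>) z = blinfun_apply (\<Phi> r \<omega>) z $ k" for r \<omega> z
      by (simp add: \<Psi>_def bounded_linear_Blinfun_apply[OF bl])
    show "has_ito_integral M F W t \<Psi> (\<lambda>\<omega>. J \<omega> $ k)"
      by (rule has_ito_integral_bounded_linear[OF J t bl \<Psi>])
    show "has_ito_integral M F W t \<Psi> (\<lambda>\<omega>. J' \<omega> $ k)"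
      by (rule has_ito_integral_bounded_linear[OF J' t bl \<Psi>])
  qed
  then have "AE \<omega> in M. \<forall>k\<in>UNIV. J \<omega> $ k = J' \<omega> $ k"
    by (intro AE_finite_allI) auto
  then show ?thesis by eventually_elim (simp add: vec_eq_iff)
qed

end

section \<open>The lifted, pointwise and Volterra equations\<close>

lemma mat_blinfun_apply: "blinfun_apply (mat_blinfun A) z = A *v z"
  unfolding mat_blinfun_def
  by (simp add: bounded_linear_Blinfun_apply matrix_vector_mul_bounded_linear)

section \<open>Evaluations on the abstract Hilbert space\<close>

context
  fixes T :: real
    and val :: "'h::{real_inner, banach, second_countable_topology} \<Rightarrow> real \<Rightarrow> real^'n"
  assumes T_pos: "0 < T" and H: "represents_H T val"
begin

lemma val_in_H: "val h \<in> sobolev_H T"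
  using H by (auto simp: represents_H_def bij_betw_def)

lemma val_add: "s \<in> {0..T} \<Longrightarrow> val (h + k) s = val h s + val k s"
  and val_scale: "s \<in> {0..T} \<Longrightarrow> val (c *\<^sub>R h) s = c *\<^sub>R val h s"
  and inner_eq_H_inner: "inner h k = H_inner T (val h) (val k)"
  using H by (auto simp: represents_H_def)

text \<open>Outside [0,T] both functions have the default value of extensional functions, so
  agreement on the interval is equality; then \<open>val\<close> is injective.\<close>

lemma val_eqI:
  assumes "\<And>s. s \<in> {0..T} \<Longrightarrow> val h s = val k s"
  shows "h = k"
proof -
  have "val h = val k"
    using assms val_in_H[of h] val_in_H[of k]
    by (intro extensionalityI[of _ "{0..T}"]) (auto simp: sobolev_H_def)
  then show ?thesis using H by (auto simp: represents_H_def bij_betw_def inj_on_def)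
qed

lemma val_elem_of:
  assumes "restrict x {0..T} \<in> sobolev_H T" "s \<in> {0..T}"
  shows "val (elem_of T val x) s = x s"
proof -
  have "val (elem_of T val x) = restrict x {0..T}"
    unfolding elem_of_def using H assms(1)
    by (intro f_the_inv_into_f_bij_betw[of val UNIV "sobolev_H T"]) (simp_all only: represents_H_def)
  then show ?thesis using assms(2) by simp
qed

lemma continuous_on_val: "continuous_on {0..T} (val h)"
proof -
  have "continuous_on {0..T} (\<lambda>s. \<chi> k. val h s $ k)"
    using val_in_H[of h] by (intro continuous_on_vec_lambda) (auto simp: sobolev_H_def sobolev_W12_def)
  then show ?thesis by simp
qed

text \<open>On the unit sphere the quadratic bound is a constant, with 1 + 1 giving the factor 2;
  scaling by \<open>norm h\<close> turns it into a linear bound. One K serves all s, which joint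
  continuity in (h, s) relies on.\<close>

lemma val_bounded:
  obtains K where "\<And>h s. s \<in> {0..T} \<Longrightarrow> norm (val h s) \<le> K * norm h"
proof -
  obtain C where C: "0 \<le> C"
    "\<And>u g s. continuous_on {0..T} u \<Longrightarrow> weak_derivative T u g \<Longrightarrow> s \<in> {0..T} \<Longrightarrow>
       \<bar>u s\<bar> \<le> C * (1 + (LINT s:{0..T}|lborel. (u s)\<^sup>2) + (LINT s:{0..T}|lborel. (g s)\<^sup>2))"
    using sobolev_pointwise_bound[OF T_pos] by blast
  have comp: "\<bar>val h s $ k\<bar> \<le> C * (1 + (norm h)\<^sup>2)" if s: "s \<in> {0..T}" for h s k
  proof -
    let ?U = "\<lambda>k. LINT s:{0..T}|lborel. (val h s $ k)\<^sup>2"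
    let ?G = "\<lambda>k. LINT s:{0..T}|lborel. (wderiv T (\<lambda>s. val h s $ k) s)\<^sup>2"
    have "(\<lambda>s. val h s $ k) \<in> sobolev_W12 T" using val_in_H[of h] by (simp add: sobolev_H_def)
    then have u: "continuous_on {0..T} (\<lambda>s. val h s $ k)"
      "weak_derivative T (\<lambda>s. val h s $ k) (wderiv T (\<lambda>s. val h s $ k))"
      unfolding sobolev_W12_def wderiv_def by (simp_all add: someI_ex)
    have nn: "0 \<le> ?U k" "0 \<le> ?G k" for k by (auto simp: set_lebesgue_integral_def)
    \<comment> \<open>The Sobolev terms of one coordinate are one nonnegative summand of the squared
      norm.\<close>
    have "?U k + ?G k \<le> (\<Sum>k\<in>UNIV. ?U k + ?G k)"
      using nn by (intro member_le_sum) (auto intro: add_nonneg_nonneg)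
    also have "\<dots> = (norm h)\<^sup>2"
      unfolding power2_norm_eq_inner inner_eq_H_inner H_inner_def by (simp add: power2_eq_square)
    finally have "C * (1 + ?U k + ?G k) \<le> C * (1 + (norm h)\<^sup>2)"
      using C(1) by (intro mult_left_mono) auto
    then show ?thesis using C(2)[OF u s] by linarith
  qed
  have quad: "norm (val h s) \<le> CARD('n) * (C * (1 + (norm h)\<^sup>2))" if s: "s \<in> {0..T}" for h s
  proof -
    have "norm (val h s) \<le> (\<Sum>k\<in>UNIV. \<bar>val h s $ k\<bar>)" by (rule norm_le_l1_cart)
    also have "\<dots> \<le> (\<Sum>k\<in>(UNIV::'n set). C * (1 + (norm h)\<^sup>2))" by (intro sum_mono comp s)
    finally show ?thesis by simp
  qed
  have "norm (val h s) \<le> (CARD('n) * (C * 2)) * norm h" if s: "s \<in> {0..T}" for h s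
  proof (cases "h = 0")
    case True
    then show ?thesis using val_scale[OF s, of 0 h] by simp
  next
    case False
    have "norm (val (sgn h) s) \<le> CARD('n) * (C * 2)"
      using quad[OF s, of "sgn h"] False by (simp add: norm_sgn)
    moreover have "val h s = norm h *\<^sub>R val (sgn h) s"
      using False by (simp add: val_scale[OF s, symmetric] sgn_div_norm)
    ultimately show ?thesis using False by (simp add: mult.commute mult_left_mono)
  qed
  then show thesis using that by blast
qed

lemma bounded_linear_val:
  assumes s: "s \<in> {0..T}"
  shows "bounded_linear (\<lambda>h. val h s)"
proof -
  obtain K where "\<And>h s. s \<in> {0..T} \<Longrightarrow> norm (val h s) \<le> K * norm h" using val_bounded by blast
  then show ?thesis
    using s by (intro bounded_linear_intro[where K = K]) (auto simp: val_add val_scale mult.commute)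
qed

text \<open>A change of h moves all evaluations uniformly by at most K times its norm, and a fixed
  path is continuous in s. The clamp retracts the reals onto [0,T], so that continuity can be stated
  on the whole product.\<close>

lemma continuous_on_val_clamp:
  "continuous_on UNIV (\<lambda>x. val (fst x) (max 0 (min T (snd x))))"
  unfolding continuous_on_def
proof
  fix x :: "'h \<times> real"
  obtain K where K: "\<And>h s. s \<in> {0..T} \<Longrightarrow> norm (val h s) \<le> K * norm h" using val_bounded by blast
  define c where "c = (\<lambda>u. max 0 (min T u))"
  have c: "c u \<in> {0..T}" for u using T_pos by (auto simp: c_def)
  have cc: "continuous_on UNIV c" unfolding c_def by (intro continuous_intros)
  have "continuous_on UNIV (\<lambda>u. val (fst x) (c u))"
    using c by (intro continuous_on_compose2[OF continuous_on_val cc]) auto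
  then have "continuous_on UNIV (\<lambda>y::'h \<times> real. val (fst x) (c (snd y)))"
    by (rule continuous_on_compose2) (auto intro: continuous_intros)
  then have 1: "((\<lambda>y. val (fst x) (c (snd y))) \<longlongrightarrow> val (fst x) (c (snd x))) (at x)"
    by (metis continuous_on_def UNIV_I)
  have 2: "((\<lambda>y. val (fst y - fst x) (c (snd y))) \<longlongrightarrow> 0) (at x)"
  proof (rule Lim_null_comparison[OF always_eventually])
    show "\<forall>y. norm (val (fst y - fst x) (c (snd y))) \<le> K * norm (fst y - fst x)"
      using K c by blast
    have "((\<lambda>y. K * norm (fst y - fst x)) \<longlongrightarrow> K * norm (fst x - fst x)) (at x)"
      by (intro tendsto_intros)
    then show "((\<lambda>y. K * norm (fst y - fst x)) \<longlongrightarrow> 0) (at x)" by simp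
  qed
  have "val (fst y - fst x) (c (snd y)) + val (fst x) (c (snd y)) = val (fst y) (c (snd y))" for y
    by (simp add: val_add[OF c, symmetric])
  then show "((\<lambda>x. val (fst x) (max 0 (min T (snd x))))
      \<longlongrightarrow> val (fst x) (max 0 (min T (snd x)))) (at x)"
    using tendsto_add[OF 2 1] by (simp add: c_def)
qed

lemma borel_measurable_if_val:
  assumes "\<And>s. s \<in> {0..T} \<Longrightarrow> (\<lambda>\<omega>. val (X \<omega>) s) \<in> borel_measurable N"
  shows "X \<in> borel_measurable N"
proof (rule borel_measurable_if_separating[where \<F> = "{\<lambda>h. val h s $ k | s k. s \<in> {0..T}}"])
  fix f assume "f \<in> {\<lambda>h. val h s $ k | s k. s \<in> {0..T}}"
  then obtain s k where f: "f = (\<lambda>h. val h s $ k)" and s: "s \<in> {0..T}" by blast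
  show "bounded_linear f"
    unfolding f by (rule bounded_linear_compose[OF bounded_linear_vec_nth bounded_linear_val[OF s]])
  show "(\<lambda>\<omega>. f (X \<omega>)) \<in> borel_measurable N"
    unfolding f using assms[OF s]
    by (rule measurable_compose) (auto intro!: borel_measurable_continuous_onI continuous_intros)
next
  fix h assume 0: "\<And>f. f \<in> {\<lambda>h. val h s $ k | s k. s \<in> {0..T}} \<Longrightarrow> f h = 0"
  show "h = 0"
  proof (rule val_eqI)
    fix s assume s: "s \<in> {0..T}"
    have "val h s $ k = 0" for k using 0[of "\<lambda>h. val h s $ k"] s by blast
    moreover have "val 0 s = 0" using val_scale[OF s, of 0 0] by simp
    ultimately show "val h s = val 0 s" by (simp add: vec_eq_iff)
  qed
qed

lemma progressive_if_val:
  assumes "\<And>s. s \<in> {0..T} \<Longrightarrow> progressive F T (\<lambda>t \<omega>. val (X t \<omega>) s)"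
  shows "progressive F T X"
  unfolding progressive_def
proof (intro ballI borel_measurable_if_val)
  fix t s assume "t \<in> {0..T}" "s \<in> {0..T}"
  then show "(\<lambda>\<omega>. val (case \<omega> of (r, \<omega>) \<Rightarrow> X r \<omega>) s)
      \<in> borel_measurable (restrict_space borel {0..t} \<Otimes>\<^sub>M F t)"
    using assms[of s] by (auto simp: progressive_def case_prod_beta')
qed

text \<open>The diagonal is the jointly continuous evaluation composed with the measurable pair of
  state and time.\<close>

lemma progressive_diagonal:
  assumes X: "progressive F T X"
  shows "progressive F T (\<lambda>t \<omega>. val (X t \<omega>) t)"
  unfolding progressive_def
proof
  fix t assume t: "t \<in> {0..T}"
  let ?N = "restrict_space borel {0..t} \<Otimes>\<^sub>M F t"
  have "(\<lambda>x. X (fst x) (snd x)) \<in> borel_measurable ?N"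
    using X t by (auto simp: progressive_def case_prod_beta')
  moreover have "(\<lambda>r. r) \<in> borel_measurable (restrict_space borel {0..t})"
    by (rule measurable_restrict_space1) simp
  then have "fst \<in> borel_measurable ?N"
    using measurable_compose[OF measurable_fst] by blast
  ultimately have "(\<lambda>x. val (X (fst x) (snd x)) (max 0 (min T (fst x)))) \<in> borel_measurable ?N"
    by (rule borel_measurable_continuous_Pair[where H = "\<lambda>h s. val h (max 0 (min T s))"])
      (rule continuous_on_val_clamp)
  moreover have "max 0 (min T r) = r" if "0 \<le> r" "r \<le> t" for r
    using that t by auto
  ultimately show "(\<lambda>(r, \<omega>). val (X r \<omega>) r) \<in> borel_measurable ?N"
    by (elim measurable_cong[THEN iffD1, rotated]) (auto simp: space_pair_measure space_restrict_space)
qed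

end

lemma set_integral_bounded_linear:
  fixes f :: "'b::{banach, second_countable_topology} \<Rightarrow> 'c::{banach, second_countable_topology}"
  assumes f: "bounded_linear f" and g: "set_integrable M A g"
  shows "set_integrable M A (\<lambda>x. f (g x))" "(LINT x:A|M. f (g x)) = f (LINT x:A|M. g x)"
proof -
  interpret f: bounded_linear f by (rule f)
  show "set_integrable M A (\<lambda>x. f (g x))"
    using integrable_bounded_linear[OF f g[unfolded set_integrable_def]]
    by (simp add: set_integrable_def f.scale)
  show "(LINT x:A|M. f (g x)) = f (LINT x:A|M. g x)"
    using integral_bounded_linear[OF f g[unfolded set_integrable_def]]
    by (simp add: set_lebesgue_integral_def f.scale)
qed

text \<open>Upgrades equality at each fixed time to indistinguishability: countably many times share
  a null set, and continuity fills in the rest.\<close>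

lemma AE_eq_on_interval:
  fixes f g :: "real \<Rightarrow> 'w \<Rightarrow> 'b::real_normed_vector"
  assumes f: "AE \<omega> in M. continuous_on {a..b} (\<lambda>t. f t \<omega>)"
    and g: "AE \<omega> in M. continuous_on {a..b} (\<lambda>t. g t \<omega>)"
    and eq: "\<And>t. t \<in> {a..b} \<Longrightarrow> AE \<omega> in M. f t \<omega> = g t \<omega>"
  shows "AE \<omega> in M. \<forall>t\<in>{a..b}. f t \<omega> = g t \<omega>"
proof -
  obtain D where D: "countable D" "D \<subseteq> {a..b}" "{a..b} \<subseteq> closure D" using separable by blast
  then have cl: "closure D = {a..b}" by (simp add: closure_minimal subset_antisym)
  have "AE \<omega> in M. \<forall>t\<in>D. f t \<omega> = g t \<omega>"
    using D eq by (subst AE_ball_countable) auto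
  with f g show ?thesis
  proof eventually_elim
    case (elim \<omega>)
    show ?case
    proof
      fix t assume t: "t \<in> {a..b}"
      have "continuous_on (closure D) (\<lambda>t. f t \<omega> - g t \<omega>)"
        unfolding cl using elim by (intro continuous_intros) auto
      then have "f t \<omega> - g t \<omega> = 0"
        by (rule continuous_constant_on_closure) (use elim t cl in auto)
      then show "f t \<omega> = g t \<omega>" by simp
    qed
  qed
qed

section \<open>Passage between the equations\<close>

context brownian
begin

lemma has_ito_process_bounded_linear:
  fixes \<Phi> :: "real \<Rightarrow> 'w \<Rightarrow> ((real^'d) \<Rightarrow>\<^sub>L 'b::{real_inner, banach, second_countable_topology})"
    and \<Psi> :: "real \<Rightarrow> 'w \<Rightarrow> ((real^'d) \<Rightarrow>\<^sub>L 'c::{real_inner, banach, second_countable_topology})"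
  assumes I: "has_ito_process M F W T \<Phi> I" and f: "bounded_linear f"
    and \<Psi>: "\<And>r \<omega> z. r \<in> {0..T} \<Longrightarrow> \<omega> \<in> space M \<Longrightarrow>
      blinfun_apply (\<Psi> r \<omega>) z = f (blinfun_apply (\<Phi> r \<omega>) z)"
  shows "has_ito_process M F W T \<Psi> (\<lambda>t \<omega>. f (I t \<omega>))"
  unfolding has_ito_process_def
proof
  have "AE \<omega> in M. continuous_on {0..T} (\<lambda>t. I t \<omega>)" using I by (simp add: has_ito_process_def)
  then show "AE \<omega> in M. continuous_on {0..T} (\<lambda>t. f (I t \<omega>))"
    by eventually_elim (rule bounded_linear.continuous_on[OF f])
  show "\<forall>t\<in>{0..T}. has_ito_integral M F W t \<Psi> (\<lambda>\<omega>. f (I t \<omega>))"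
    using I \<Psi> by (auto simp: has_ito_process_def intro!: has_ito_integral_bounded_linear[OF _ _ f])
qed

text \<open>Every ingredient of the equation commutes with \<open>f\<close>. The image coefficients
  are given by identities on [0,T] rather than as composites, because (P) presents them through
  evaluations.\<close>

lemma ito_equation_bounded_linear:
  fixes \<Phi> :: "real \<Rightarrow> 'w \<Rightarrow> ((real^'d) \<Rightarrow>\<^sub>L 'b::{real_inner, banach, second_countable_topology})"
    and \<Psi> :: "real \<Rightarrow> 'w \<Rightarrow> ((real^'d) \<Rightarrow>\<^sub>L 'c::{real_inner, banach, second_countable_topology})"
  assumes X: "ito_equation M F W T x\<^sub>0 \<beta> \<Phi> X" and f: "bounded_linear f"
    and \<gamma>: "\<And>r \<omega>. r \<in> {0..T} \<Longrightarrow> \<omega> \<in> space M \<Longrightarrow> \<gamma> r \<omega> = f (\<beta> r \<omega>)"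
    and \<Psi>: "\<And>r \<omega> z. r \<in> {0..T} \<Longrightarrow> \<omega> \<in> space M \<Longrightarrow>
      blinfun_apply (\<Psi> r \<omega>) z = f (blinfun_apply (\<Phi> r \<omega>) z)"
  shows "ito_equation M F W T (f x\<^sub>0) \<gamma> \<Psi> (\<lambda>t \<omega>. f (X t \<omega>))"
  unfolding ito_equation_def
proof (intro conjI)
  interpret f: bounded_linear f by (rule f)
  have f_meas: "f \<in> borel_measurable borel"
    by (intro borel_measurable_continuous_onI f.continuous_on continuous_on_id)
  obtain I where I: "has_ito_process M F W T \<Phi> I"
    and eq: "AE \<omega> in M. \<forall>t\<in>{0..T}. X t \<omega> = x\<^sub>0 + (LINT r:{0..t}|lborel. \<beta> r \<omega>) + I t \<omega>"
    using X by (auto simp: ito_equation_def)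
  have \<beta>: "AE \<omega> in M. set_integrable lborel {0..T} (\<lambda>r. \<beta> r \<omega>)" and p: "progressive F T X"
    using X by (auto simp: ito_equation_def)
  show "progressive F T (\<lambda>t \<omega>. f (X t \<omega>))"
    using p measurable_compose[OF _ f_meas] by (auto simp: progressive_def case_prod_beta')
  have cong: "set_integrable lborel {0..T} (\<lambda>r. \<gamma> r \<omega>)
      \<longleftrightarrow> set_integrable lborel {0..T} (\<lambda>r. f (\<beta> r \<omega>))" if "\<omega> \<in> space M" for \<omega>
    using that \<gamma> by (intro set_integrable_cong) auto
  show "AE \<omega> in M. set_integrable lborel {0..T} (\<lambda>r. \<gamma> r \<omega>)"
    using \<beta> AE_space by eventually_elim (simp add: cong set_integral_bounded_linear(1)[OF f])
  show "\<exists>I. has_ito_process M F W T \<Psi> I \<and>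
      (AE \<omega> in M. \<forall>t\<in>{0..T}. f (X t \<omega>) = f x\<^sub>0 + (LINT r:{0..t}|lborel. \<gamma> r \<omega>) + I t \<omega>)"
  proof (intro exI conjI)
    show "has_ito_process M F W T \<Psi> (\<lambda>t \<omega>. f (I t \<omega>))"
      by (rule has_ito_process_bounded_linear[OF I f \<Psi>])
    show "AE \<omega> in M. \<forall>t\<in>{0..T}. f (X t \<omega>) = f x\<^sub>0 + (LINT r:{0..t}|lborel. \<gamma> r \<omega>) + f (I t \<omega>)"
      using \<beta> eq AE_space
    proof eventually_elim
      case (elim \<omega>)
      show ?case
      proof
        fix t assume t: "t \<in> {0..T}"
        have "set_integrable lborel {0..t} (\<lambda>r. \<beta> r \<omega>)"
          by (rule set_integrable_subset[OF elim(1)]) (use t in auto)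
        then have "f (LINT r:{0..t}|lborel. \<beta> r \<omega>) = (LINT r:{0..t}|lborel. f (\<beta> r \<omega>))"
          by (simp add: set_integral_bounded_linear(2)[OF f])
        also have "\<dots> = (LINT r:{0..t}|lborel. \<gamma> r \<omega>)"
          using t \<gamma> elim(3) by (intro set_lebesgue_integral_cong) auto
        finally show "f (X t \<omega>) = f x\<^sub>0 + (LINT r:{0..t}|lborel. \<gamma> r \<omega>) + f (I t \<omega>)"
          using elim(2) t by (simp add: f.add)
      qed
    qed
  qed
qed

lemma lifted_imp_pointwise:
  fixes val :: "'h::{real_inner, banach, second_countable_topology} \<Rightarrow> real \<Rightarrow> real^'n"
  assumes T: "0 < T" and H: "represents_H T val"
    and B: "\<And>t h a s. t \<in> {0..T} \<Longrightarrow> s \<in> {0..T} \<Longrightarrow>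
              val (B t h a) s = b t s (val h t) (val h s) a"
    and \<Sigma>: "\<And>t h a s z. t \<in> {0..T} \<Longrightarrow> s \<in> {0..T} \<Longrightarrow>
              val (blinfun_apply (\<Sigma> t h a) z) s = \<sigma> t s (val h t) (val h s) a *v z"
    and X: "lifted_solution M W T B \<Sigma> x\<^sub>0 \<alpha> X" and s: "s \<in> {0..T}"
  shows "pointwise_solution M W T b \<sigma> (val x\<^sub>0) \<alpha> (\<lambda>s t \<omega>. val (X t \<omega>) s) s"
  unfolding pointwise_solution_def
  by (rule ito_equation_bounded_linear[OF X[unfolded lifted_solution_def] bounded_linear_val[OF T H s]])
    (use s in \<open>auto simp: B \<Sigma> mat_blinfun_apply\<close>)

text \<open>The two integrability hypotheses supply a right-hand side in \<open>H\<close>. Its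
  evaluations reproduce (P): the drift because evaluation commutes with the Bochner integral, the
  stochastic part by uniqueness.\<close>

lemma pointwise_imp_lifted:
  fixes val :: "'h::{real_inner, banach, second_countable_topology} \<Rightarrow> real \<Rightarrow> real^'n"
  assumes T: "0 < T" and H: "represents_H T val"
    and B: "\<And>t h a s. t \<in> {0..T} \<Longrightarrow> s \<in> {0..T} \<Longrightarrow>
              val (B t h a) s = b t s (val h t) (val h s) a"
    and \<Sigma>: "\<And>t h a s z. t \<in> {0..T} \<Longrightarrow> s \<in> {0..T} \<Longrightarrow>
              val (blinfun_apply (\<Sigma> t h a) z) s = \<sigma> t s (val h t) (val h s) a *v z"
    and Y: "\<And>s. s \<in> {0..T} \<Longrightarrow> pointwise_solution M W T b \<sigma> (val x\<^sub>0) \<alpha> Y s"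
    and X: "\<And>t s \<omega>. t \<in> {0..T} \<Longrightarrow> s \<in> {0..T} \<Longrightarrow> \<omega> \<in> space M \<Longrightarrow> val (X t \<omega>) s = Y s t \<omega>"
    and B_int: "AE \<omega> in M. set_integrable lborel {0..T} (\<lambda>r. B r (X r \<omega>) (\<alpha> r \<omega>))"
    and \<Sigma>_int: "ito_integrable M F W T (\<lambda>r \<omega>. \<Sigma> r (X r \<omega>) (\<alpha> r \<omega>))"
  shows "lifted_solution M W T B \<Sigma> x\<^sub>0 \<alpha> X"
proof -
  obtain I where I: "has_ito_process M F W T (\<lambda>r \<omega>. \<Sigma> r (X r \<omega>) (\<alpha> r \<omega>)) I"
    using \<Sigma>_int by (auto simp: ito_integrable_def)
  define R where "R t \<omega> = x\<^sub>0 + (LINT r:{0..t}|lborel. B r (X r \<omega>) (\<alpha> r \<omega>)) + I t \<omega>" for t \<omega>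
  have "progressive F T (\<lambda>t \<omega>. val (X t \<omega>) s)" if s: "s \<in> {0..T}" for s
    unfolding progressive_def
  proof
    fix t assume t: "t \<in> {0..T}"
    then have "(\<lambda>(r, \<omega>). Y s r \<omega>) \<in> borel_measurable (restrict_space borel {0..t} \<Otimes>\<^sub>M F t)"
      using Y[OF s] by (simp add: pointwise_solution_def ito_equation_def progressive_def)
    then show "(\<lambda>(r, \<omega>). val (X r \<omega>) s) \<in> borel_measurable (restrict_space borel {0..t} \<Otimes>\<^sub>M F t)"
      by (rule measurable_cong[THEN iffD1, rotated])
        (use t s X in \<open>auto simp: space_pair_measure space_restrict_space\<close>)
  qed
  then have p: "progressive F T X" by (rule progressive_if_val[OF T H])
  have at_s: "AE \<omega> in M. \<forall>t\<in>{0..T}. val (X t \<omega>) s = val (R t \<omega>) s" if s: "s \<in> {0..T}" for s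
  proof -
    interpret ev: bounded_linear "\<lambda>h. val h s" by (rule bounded_linear_val[OF T H s])
    let ?\<beta> = "\<lambda>r \<omega>. b r s (Y r r \<omega>) (Y s r \<omega>) (\<alpha> r \<omega>)"
    let ?\<Psi> = "\<lambda>r \<omega>. mat_blinfun (\<sigma> r s (Y r r \<omega>) (Y s r \<omega>) (\<alpha> r \<omega>))"
    obtain I' where I': "has_ito_process M F W T ?\<Psi> I'"
      and eq: "AE \<omega> in M. \<forall>t\<in>{0..T}. Y s t \<omega> = val x\<^sub>0 s + (LINT r:{0..t}|lborel. ?\<beta> r \<omega>) + I' t \<omega>"
      using Y[OF s] by (auto simp: pointwise_solution_def ito_equation_def)
    have I'': "has_ito_process M F W T ?\<Psi> (\<lambda>t \<omega>. val (I t \<omega>) s)"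
      by (rule has_ito_process_bounded_linear[OF I ev.bounded_linear_axioms])
        (use s in \<open>auto simp: mat_blinfun_apply \<Sigma> X\<close>)
    have "AE \<omega> in M. \<forall>t\<in>{0..T}. I' t \<omega> = val (I t \<omega>) s"
    proof (rule AE_eq_on_interval)
      fix t assume t: "t \<in> {0..T}"
      show "AE \<omega> in M. I' t \<omega> = val (I t \<omega>) s"
        by (rule has_ito_integral_unique[OF t])
          (use I' I'' t in \<open>auto simp: has_ito_process_def\<close>)
    qed (use I' I'' in \<open>auto simp: has_ito_process_def\<close>)
    with eq B_int AE_space show ?thesis
    proof eventually_elim
      case (elim \<omega>)
      show ?case
      proof
        fix t assume t: "t \<in> {0..T}"
        have "set_integrable lborel {0..t} (\<lambda>r. B r (X r \<omega>) (\<alpha> r \<omega>))"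
          by (rule set_integrable_subset[OF elim(2)]) (use t in auto)
        then have "val (LINT r:{0..t}|lborel. B r (X r \<omega>) (\<alpha> r \<omega>)) s
            = (LINT r:{0..t}|lborel. val (B r (X r \<omega>) (\<alpha> r \<omega>)) s)"
          by (simp add: set_integral_bounded_linear(2)[OF ev.bounded_linear_axioms])
        also have "\<dots> = (LINT r:{0..t}|lborel. ?\<beta> r \<omega>)"
          using t s elim(3) by (intro set_lebesgue_integral_cong) (auto simp: B X)
        finally show "val (X t \<omega>) s = val (R t \<omega>) s"
          using elim t s by (simp add: R_def ev.add X)
      qed
    qed
  qed
  \<comment> \<open>The identity at s holds off a null set that depends on s; countably many
    parameters leave one null set. Continuity in s then holds for every outcome, as both sides are
    values of elements of \<open>H\<close>.\<close>
  obtain D where D: "countable D" "D \<subseteq> {0..T}" "{0..T} \<subseteq> closure D" using separable by blast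
  then have cl: "closure D = {0..T}" by (simp add: closure_minimal subset_antisym)
  have "AE \<omega> in M. \<forall>s\<in>D. \<forall>t\<in>{0..T}. val (X t \<omega>) s = val (R t \<omega>) s"
    using D at_s by (subst AE_ball_countable) auto
  then have "AE \<omega> in M. \<forall>t\<in>{0..T}. X t \<omega> = R t \<omega>"
  proof eventually_elim
    case (elim \<omega>)
    show ?case
    proof
      fix t assume t: "t \<in> {0..T}"
      show "X t \<omega> = R t \<omega>"
      proof (rule val_eqI[OF T H])
        fix s assume s: "s \<in> {0..T}"
        have "continuous_on (closure D) (\<lambda>s. val (X t \<omega>) s - val (R t \<omega>) s)"
          unfolding cl by (intro continuous_on_diff continuous_on_val[OF T H])
        then have "val (X t \<omega>) s - val (R t \<omega>) s = 0"
          by (rule continuous_constant_on_closure) (use elim t s cl in auto)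
        then show "val (X t \<omega>) s = val (R t \<omega>) s" by simp
      qed
    qed
  qed
  then show ?thesis
    unfolding lifted_solution_def ito_equation_def R_def using p B_int I by blast
qed

text \<open>For each t the equation with parameter s = t is read at time t. The reduced coefficients
  see the state only through its diagonal, which closes the equation. The null set varies with t, as
  \<open>volterra_solution\<close> allows.\<close>

lemma pointwise_imp_volterra:
  fixes val :: "'h::{real_inner, banach, second_countable_topology} \<Rightarrow> real \<Rightarrow> real^'n"
  assumes T: "0 < T" and H: "represents_H T val"
    and X: "\<And>s. s \<in> {0..T} \<Longrightarrow>
      pointwise_solution M W T b \<sigma> (val x\<^sub>0) \<alpha> (\<lambda>s t \<omega>. val (X t \<omega>) s) s"
    and bb: "\<And>r s u v a. r \<in> {0..T} \<Longrightarrow> s \<in> {0..T} \<Longrightarrow> b r s u v a = bb r s u a"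
    and \<sigma>b: "\<And>r s u v a. r \<in> {0..T} \<Longrightarrow> s \<in> {0..T} \<Longrightarrow> \<sigma> r s u v a = \<sigma>b r s u a"
    and X0: "AE \<omega> in M. X 0 \<omega> = const_path T val x"
  shows "volterra_solution M W T bb \<sigma>b x \<alpha> (\<lambda>t \<omega>. val (X t \<omega>) t)"
  unfolding volterra_solution_def
proof (intro conjI ballI)
  have "progressive F T (\<lambda>t \<omega>. val (X t \<omega>) s)" if "s \<in> {0..T}" for s
    using X[OF that] by (simp add: pointwise_solution_def ito_equation_def)
  then have "progressive F T X" by (rule progressive_if_val[OF T H])
  then show "progressive F T (\<lambda>t \<omega>. val (X t \<omega>) t)" by (rule progressive_diagonal[OF T H])
  fix t assume t: "t \<in> {0..T}"
  let ?\<beta> = "\<lambda>r \<omega>. b r t (val (X r \<omega>) r) (val (X r \<omega>) t) (\<alpha> r \<omega>)"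
  let ?\<Psi> = "\<lambda>r \<omega>. mat_blinfun (\<sigma> r t (val (X r \<omega>) r) (val (X r \<omega>) t) (\<alpha> r \<omega>))"
  have \<beta>: "AE \<omega> in M. set_integrable lborel {0..T} (\<lambda>r. ?\<beta> r \<omega>)"
    using X[OF t] by (simp add: pointwise_solution_def ito_equation_def)
  obtain I where I: "has_ito_process M F W T ?\<Psi> I"
    and eq: "AE \<omega> in M. \<forall>u\<in>{0..T}. val (X u \<omega>) t
      = val x\<^sub>0 t + (LINT r:{0..u}|lborel. ?\<beta> r \<omega>) + I u \<omega>"
    using X[OF t] by (auto simp: pointwise_solution_def ito_equation_def)
  have cong: "set_integrable lborel {0..t} (\<lambda>r. ?\<beta> r \<omega>)
      \<longleftrightarrow> set_integrable lborel {0..t} (\<lambda>r. bb r t (val (X r \<omega>) r) (\<alpha> r \<omega>))" for \<omega>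
    using t bb by (intro set_integrable_cong) auto
  show "AE \<omega> in M. set_integrable lborel {0..t} (\<lambda>r. bb r t (val (X r \<omega>) r) (\<alpha> r \<omega>))"
    using \<beta>
  proof eventually_elim
    case (elim \<omega>)
    have "set_integrable lborel {0..t} (\<lambda>r. ?\<beta> r \<omega>)"
      by (rule set_integrable_subset[OF elim]) (use t in auto)
    then show ?case by (simp only: cong)
  qed
  \<comment> \<open>Both integrals in (P) vanish at time 0. The resulting identity does not involve
    the outcome, so holding almost surely in a probability space means that it holds.\<close>
  have x0: "val x\<^sub>0 t = x"
  proof -
    have "has_ito_integral M F W 0 ?\<Psi> (I 0)" using I T by (simp add: has_ito_process_def)
    then have "AE \<omega> in M. I 0 \<omega> = 0" by (rule has_ito_integral_0)
    with X0 eq have "AE \<omega> in M. val x\<^sub>0 t = x"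
    proof eventually_elim
      case (elim \<omega>)
      have "(LINT r:{0..0}|lborel. ?\<beta> r \<omega>) = 0"
        unfolding set_lebesgue_integral_def
        by (rule integral_eq_zero_AE, rule AE_mp[OF AE_lborel_singleton[of 0]]) (auto simp: indicator_def)
      moreover have "val (X 0 \<omega>) t = x"
        unfolding elim(1) const_path_def
        by (rule val_elem_of[OF T H const_in_sobolev_H[OF T] t])
      ultimately show ?case using elim(2)[rule_format, of 0] elim(3) T by simp
    qed
    then show ?thesis by simp
  qed
  \<comment> \<open>The bounded linear map is the identity: it exchanges integrands that coincide on
    [0,t].\<close>
  have J: "has_ito_integral M F W t (\<lambda>r \<omega>. mat_blinfun (\<sigma>b r t (val (X r \<omega>) r) (\<alpha> r \<omega>))) (I t)"
  proof (rule has_ito_integral_bounded_linear[OF _ t bounded_linear_ident])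
    show "has_ito_integral M F W t ?\<Psi> (I t)" using I t by (simp add: has_ito_process_def)
  qed (use t \<sigma>b in simp)
  have "AE \<omega> in M. val (X t \<omega>) t
      = x + (LINT r:{0..t}|lborel. bb r t (val (X r \<omega>) r) (\<alpha> r \<omega>)) + I t \<omega>"
    using eq
  proof eventually_elim
    case (elim \<omega>)
    have "(LINT r:{0..t}|lborel. ?\<beta> r \<omega>) = (LINT r:{0..t}|lborel. bb r t (val (X r \<omega>) r) (\<alpha> r \<omega>))"
      using t bb by (intro set_lebesgue_integral_cong) auto
    then show ?case using elim t x0 by auto
  qed
  with J show "\<exists>J. has_ito_integral M F W t
        (\<lambda>r \<omega>. mat_blinfun (\<sigma>b r t (val (X r \<omega>) r) (\<alpha> r \<omega>))) J \<and>
      (AE \<omega> in M. val (X t \<omega>) t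
        = x + (LINT r:{0..t}|lborel. bb r t (val (X r \<omega>) r) (\<alpha> r \<omega>)) + J \<omega>)"
    by blast
qed

end

theorem proposition2p3:
  fixes T :: real
    and val :: "'h::{real_inner, banach, second_countable_topology} \<Rightarrow> real \<Rightarrow> real^'n"
    and b :: "real \<Rightarrow> real \<Rightarrow> real^'n \<Rightarrow> real^'n \<Rightarrow> 'a::polish_space \<Rightarrow> real^'n"
    and \<sigma> :: "real \<Rightarrow> real \<Rightarrow> real^'n \<Rightarrow> real^'n \<Rightarrow> 'a \<Rightarrow> real^'d^'n"
    and B :: "real \<Rightarrow> 'h \<Rightarrow> 'a \<Rightarrow> 'h"
    and \<Sigma> :: "real \<Rightarrow> 'h \<Rightarrow> 'a \<Rightarrow> ((real^'d) \<Rightarrow>\<^sub>L 'h)"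
    and M :: "'w measure"
    and W :: "real \<Rightarrow> 'w \<Rightarrow> real^'d"
    and x\<^sub>0 :: 'h
  assumes T_pos: "0 < T"
    and H: "represents_H T val"
    and b_cont: "continuous_on ({0..T} \<times> {0..T} \<times> UNIV) (\<lambda>(t, s, x, y, a). b t s x y a)"
    and \<sigma>_cont: "continuous_on ({0..T} \<times> {0..T} \<times> UNIV) (\<lambda>(t, s, x, y, a). \<sigma> t s x y a)"
    and B: "\<And>t h a s. t \<in> {0..T} \<Longrightarrow> s \<in> {0..T} \<Longrightarrow>
              val (B t h a) s = b t s (val h t) (val h s) a"
    and \<Sigma>: "\<And>t h a s z. t \<in> {0..T} \<Longrightarrow> s \<in> {0..T} \<Longrightarrow>
              val (blinfun_apply (\<Sigma> t h a) z) s = \<sigma> t s (val h t) (val h s) a *v z"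
    and M: "prob_space M"
    and W: "brownian_motion M T W"
  shows "(\<forall>s\<in>{0..T}. continuous_on UNIV (\<lambda>h. val h s)) \<and>
    (\<forall>\<alpha>\<in>admissible_controls M W T B \<Sigma> x\<^sub>0.
      (\<forall>X. lifted_solution M W T B \<Sigma> x\<^sub>0 \<alpha> X \<longrightarrow>
         (\<forall>s\<in>{0..T}. pointwise_solution M W T b \<sigma> (val x\<^sub>0) \<alpha> (\<lambda>s t \<omega>. val (X t \<omega>) s) s)) \<and>
      (\<forall>Y X.
         (\<forall>t\<in>{0..T}. \<forall>\<omega>\<in>space M. (\<lambda>s\<in>{0..T}. Y s t \<omega>) \<in> sobolev_H T) \<and>
         (\<forall>s\<in>{0..T}. pointwise_solution M W T b \<sigma> (val x\<^sub>0) \<alpha> Y s) \<and>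
         X = (\<lambda>t \<omega>. elem_of T val (\<lambda>s. Y s t \<omega>)) \<and>
         (AE \<omega> in M. set_integrable lborel {0..T} (\<lambda>r. B r (X r \<omega>) (\<alpha> r \<omega>))) \<and>
         ito_integrable M (natural_filtration M W) W T (\<lambda>r \<omega>. \<Sigma> r (X r \<omega>) (\<alpha> r \<omega>)) \<longrightarrow>
         lifted_solution M W T B \<Sigma> x\<^sub>0 \<alpha> X) \<and>
      (\<forall>X bb \<sigma>b x.
         (lifted_solution M W T B \<Sigma> x\<^sub>0 \<alpha> X \<or>
          (\<forall>s\<in>{0..T}. pointwise_solution M W T b \<sigma> (val x\<^sub>0) \<alpha> (\<lambda>s t \<omega>. val (X t \<omega>) s) s)) \<and>
         (\<forall>r\<in>{0..T}. \<forall>s\<in>{0..T}. \<forall>u v a.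
            b r s u v a = bb r s u a \<and> \<sigma> r s u v a = \<sigma>b r s u a) \<and>
         (AE \<omega> in M. X 0 \<omega> = const_path T val x) \<longrightarrow>
         volterra_solution M W T bb \<sigma>b x \<alpha> (\<lambda>t \<omega>. val (X t \<omega>) t)))"
proof -
  interpret prob_space M by (rule M)
  interpret brownian M T W by unfold_locales (rule W)
  have ev: "continuous_on UNIV (\<lambda>h. val h s)" if "s \<in> {0..T}" for s
    using bounded_linear.continuous_on[OF bounded_linear_val[OF T_pos H that] continuous_on_id] .
  have LP: "\<forall>s\<in>{0..T}. pointwise_solution M W T b \<sigma> (val x\<^sub>0) \<alpha> (\<lambda>s t \<omega>. val (X t \<omega>) s) s"
    if "lifted_solution M W T B \<Sigma> x\<^sub>0 \<alpha> X" for X \<alpha>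
    using lifted_imp_pointwise[where b = b and \<sigma> = \<sigma>, OF T_pos H B \<Sigma> that] by blast
  show ?thesis
  proof (intro conjI ballI allI impI)
    fix \<alpha> Y X
    assume asm: "(\<forall>t\<in>{0..T}. \<forall>\<omega>\<in>space M. (\<lambda>s\<in>{0..T}. Y s t \<omega>) \<in> sobolev_H T) \<and>
         (\<forall>s\<in>{0..T}. pointwise_solution M W T b \<sigma> (val x\<^sub>0) \<alpha> Y s) \<and>
         X = (\<lambda>t \<omega>. elem_of T val (\<lambda>s. Y s t \<omega>)) \<and>
         (AE \<omega> in M. set_integrable lborel {0..T} (\<lambda>r. B r (X r \<omega>) (\<alpha> r \<omega>))) \<and>
         ito_integrable M (natural_filtration M W) W T (\<lambda>r \<omega>. \<Sigma> r (X r \<omega>) (\<alpha> r \<omega>))"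
    show "lifted_solution M W T B \<Sigma> x\<^sub>0 \<alpha> X"
    proof (rule pointwise_imp_lifted[where b = b and \<sigma> = \<sigma> and Y = Y, OF T_pos H B \<Sigma>])
      show "val (X t \<omega>) s = Y s t \<omega>" if "t \<in> {0..T}" "s \<in> {0..T}" "\<omega> \<in> space M" for t s \<omega>
        using asm that val_elem_of[OF T_pos H, of "\<lambda>s. Y s t \<omega>" s] by blast
    qed (use asm in blast)+
  next
    fix \<alpha> X bb \<sigma>b x
    assume asm: "(lifted_solution M W T B \<Sigma> x\<^sub>0 \<alpha> X \<or>
          (\<forall>s\<in>{0..T}. pointwise_solution M W T b \<sigma> (val x\<^sub>0) \<alpha> (\<lambda>s t \<omega>. val (X t \<omega>) s) s)) \<and>
         (\<forall>r\<in>{0..T}. \<forall>s\<in>{0..T}. \<forall>u v a.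
            b r s u v a = bb r s u a \<and> \<sigma> r s u v a = \<sigma>b r s u a) \<and>
         (AE \<omega> in M. X 0 \<omega> = const_path T val x)"
    show "volterra_solution M W T bb \<sigma>b x \<alpha> (\<lambda>t \<omega>. val (X t \<omega>) t)"
    proof (rule pointwise_imp_volterra[where b = b and \<sigma> = \<sigma>, OF T_pos H])
      \<comment> \<open>Either alternative of the hypothesis leads to (P), the first one by
        evaluating (L).\<close>
      show "pointwise_solution M W T b \<sigma> (val x\<^sub>0) \<alpha> (\<lambda>s t \<omega>. val (X t \<omega>) s) s"
        if "s \<in> {0..T}" for s
        using asm LP that by blast
    qed (use asm in blast)+
  qed (use ev LP in blast)+
qed

end
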